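(* Let $\mathcal{G}$ be the topological $2$-group associated to a topological crossed module $\partial\colon H\to G$ and let $\Gamma$ be a discrete group. The assignment sending a normalised $1$-cocycle $(\alpha,u)$ on $\Gamma$ with values in $\mathcal{G}$ to the homotopy class of the geometric realisation of the simplicial map $N_*\Gamma\to N_*^D(\mathcal{G})$ it induces gives rise to a well-defined map of pointed sets $$H^1(\Gamma,\mathcal{G})\to[B\Gamma,B^D\mathcal{G}]$$ which is natural both in $\Gamma$ and in $\mathcal{G}$.
   Context: All spaces are compactly generated weakly Hausdorff. A (topological) crossed module $\mathcal{G}=(\partial\colon H\to G)$ is a continuous homomorphism of topological groups with a continuous left action of $G$ on $H$ such that $\partial(\alpha(u))=\alpha\partial(u)\alpha^{-1}$ and $\partial(u)(v)=uvu^{-1}$. Morphisms are pairs of continuous homomorphisms $\phi_1\colon H_1\to H_2$, $\phi_2\colon G_1\to G_2$ with $\partial_2\phi_1=\phi_2\partial_1$ and $\phi_1(\alpha(u))=\phi_2(\alpha)(\phi_1(u))$. The associated topological $2$-group has one object, $1$-morphisms $G$, and $2$-morphisms $(\alpha,u)\colon\alpha\Rightarrow\partial(u)\alpha$ for $(\alpha,u)\in G\rtimes H$. Cohomology: $Z^1(\Gamma,\mathcal{G})$ is the set of pairs $(\alpha\colon\Gamma\to G,u\colon\Gamma\times\Gamma\to H)$ with $\alpha_g\alpha_h=\partial(u_{g,h})\alpha_{gh}$ and $\alpha_g(u_{h,k})u_{g,hk}=u_{g,h}u_{gh,k}$; two are cohomologous if there are $\gamma\in G$, $w\colon\Gamma\to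 H$ with $\alpha^{(1)}_g=\partial(w_g)\gamma\alpha^{(0)}_g\gamma^{-1}$ and $u^{(1)}_{g,h}=w_g\gamma(\alpha^{(0)}_g(\gamma^{-1}(w_h))u^{(0)}_{g,h})w_{gh}^{-1}$; $H^1(\Gamma,\mathcal{G})$ is the set of classes pointed by the trivial cocycle. A cocycle is normalised if $\alpha_e=1$ and $u_{g,e}=u_{e,g}=1$ for all $g$; every class contains a normalised cocycle. Duskin nerve: $N_n^D(\mathcal{G})$ is the space (with the subspace topology from $G^{\binom{n+1}{2}}\times H^{\binom{n+1}{3}}$) of families $(\alpha_{ij})_{0\le i<j\le n}$ in $G$ and $(u_{ijk})_{0\le i<j<k\le n}$ in $H$ with $\alpha_{ij}\alpha_{jk}=\partial(u_{ijk})\alpha_{ik}$ and $\alpha_{ij}(u_{jkl})u_{ijl}=u_{ijk}u_{ikl}$. (Equivalently, strictly unital pseudofunctors $[n]\to\mathcal{G}$.) For order-preserving $f\colon[m]\to[n]$, $f^*(\alpha,u)=(\beta,v)$ with $\beta_{rs}=\alpha_{f(r)f(s)}$ if $f(r)<f(s)$ and $1$ otherwise, $v_{rst}=u_{f(r)f(s)f(t)}$ if $f(r)<f(s)<f(t)$ and $1$ otherwise. $B^D\mathcal{G}=\lVert N_*^D(\mathcal{G})\rVert$, where $\lVert\cdot\rVert$ is the fat geometric realisation (quotient of $\coprod_nX_n\times\Delta^n$ using face maps only). $N_n\Gamma=\Gamma^n$ is the nerve of the one-object category with morphisms $\Gamma$; $B\Gamma$ denotes its realisation (thin and fat realisations are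 canonically homotopy equivalent as $\Gamma$ is discrete). A normalised cocycle $(\alpha,u)$ induces the simplicial map $N_*\Gamma\to N_*^D(\mathcal{G})$, $(g_1,\dots,g_n)\mapsto(\alpha_{ij},u_{ijk})$ with $\alpha_{ij}=\alpha_{g_{i+1}\cdots g_j}$ and $u_{ijk}=u_{g_{i+1}\cdots g_j,\,g_{j+1}\cdots g_k}$. $[X,Y]$ is the set of (unbased) homotopy classes of continuous maps; the base point of $[B\Gamma,B^D\mathcal{G}]$ is the class of the constant map. *)

theory Defs
  imports "HOL-Analysis.Analysis" "HOL-Homology.Simplices"
begin

section \<open>Compactly generated weakly Hausdorff spaces\<close>

text \<open>
  The test spaces range over topologies on \<^typ>\<open>'a set set\<close>, which is no loss of generality.
  Given an arbitrary compact Hausdorff space \<open>K\<close> and a continuous \<open>u : K \<rightarrow> X\<close>, choose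
  \<open>S \<subseteq> K\<close> meeting each nonempty fibre of \<open>u\<close> in exactly one point; the closure of \<open>S\<close> is compact
  Hausdorff, has the same image as \<open>K\<close>, and has at most \<open>2^2^|S|\<close> points, so that it is homeomorphic
  to a space with points in \<^typ>\<open>'a set set\<close>.
\<close>

definition weakly_Hausdorff :: "'a topology \<Rightarrow> bool" where
  "weakly_Hausdorff X \<longleftrightarrow>
     (\<forall>(K :: 'a set set topology) u.
        compact_space K \<and> Hausdorff_space K \<and> continuous_map K X u \<longrightarrow>
        closedin X (u ` topspace K))"

text \<open>
  The compactly generated refinement of a weakly Hausdorff space. In such a space every continuous
  image of a compact Hausdorff space is a compact Hausdorff subspace, so testing openness on these
  subspaces is the same as testing it along all continuous maps from compact Hausdorff spaces.
  The library's \<^const>\<open>kification\<close> and \<^const>\<open>k_space\<close> test on all compact subsets,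
  Hausdorff or not, and are therefore a different notion.
\<close>

definition cg_open :: "'a topology \<Rightarrow> 'a set \<Rightarrow> bool" where
  "cg_open X U \<longleftrightarrow>
     U \<subseteq> topspace X \<and>
     (\<forall>C \<subseteq> topspace X.
        compact_space (subtopology X C) \<and> Hausdorff_space (subtopology X C) \<longrightarrow>
        openin (subtopology X C) (U \<inter> C))"

definition cg_refine :: "'a topology \<Rightarrow> 'a topology" where
  "cg_refine X = topology (cg_open X)"

lemma istopology_cg_open: "istopology (cg_open X)"
  unfolding istopology_def
proof (intro conjI allI impI)
  fix S T assume *: "cg_open X S" "cg_open X T"
  have "S \<inter> T \<inter> C = (S \<inter> C) \<inter> (T \<inter> C)" for C
    by blast
  with * show "cg_open X (S \<inter> T)"
    unfolding cg_open_def by (simp add: openin_Int le_infI1)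
next
  fix \<K> assume *: "\<forall>K\<in>\<K>. cg_open X K"
  show "cg_open X (\<Union>\<K>)"
    unfolding cg_open_def
  proof (intro conjI allI impI)
    show "\<Union>\<K> \<subseteq> topspace X"
      using * unfolding cg_open_def by blast
  next
    fix C
    assume C: "C \<subseteq> topspace X"
      "compact_space (subtopology X C) \<and> Hausdorff_space (subtopology X C)"
    have "openin (subtopology X C) (\<Union>((\<lambda>K. K \<inter> C) ` \<K>))"
      using * C unfolding cg_open_def by (intro openin_Union) blast
    then show "openin (subtopology X C) (\<Union>\<K> \<inter> C)"
      by (simp only: Int_Union2)
  qed
qed

lemma openin_cg_refine: "openin (cg_refine X) U \<longleftrightarrow> cg_open X U"
  by (simp add: cg_refine_def istopology_cg_open)

definition cgwh_space :: "'a topology \<Rightarrow> bool" where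
  "cgwh_space X \<longleftrightarrow> weakly_Hausdorff X \<and> cg_refine X = X"

text \<open>The product of compactly generated weakly Hausdorff spaces.\<close>

abbreviation cg_prod :: "'a topology \<Rightarrow> 'b topology \<Rightarrow> ('a \<times> 'b) topology" where
  "cg_prod X Y \<equiv> cg_refine (prod_topology X Y)"


section \<open>Topological crossed modules\<close>

definition topological_group :: "'a monoid \<Rightarrow> 'a topology \<Rightarrow> bool" where
  "topological_group G T \<longleftrightarrow>
     group G \<and> topspace T = carrier G \<and> cgwh_space T \<and>
     continuous_map (cg_prod T T) T (\<lambda>(x, y). x \<otimes>\<^bsub>G\<^esub> y) \<and>
     continuous_map T T (\<lambda>x. inv\<^bsub>G\<^esub> x)"

record ('g, 'h) crossed_module =
  Ggrp :: "'g monoid"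
  Gtop :: "'g topology"
  Hgrp :: "'h monoid"
  Htop :: "'h topology"
  bd :: "'h \<Rightarrow> 'g"
  act :: "'g \<Rightarrow> 'h \<Rightarrow> 'h"

definition topological_crossed_module :: "('g, 'h) crossed_module \<Rightarrow> bool" where
  "topological_crossed_module \<G> \<longleftrightarrow>
     (let G = Ggrp \<G>; H = Hgrp \<G>; d = bd \<G>; a = act \<G> in
      topological_group G (Gtop \<G>) \<and> topological_group H (Htop \<G>) \<and>
      d \<in> hom H G \<and> continuous_map (Htop \<G>) (Gtop \<G>) d \<and>
      (\<forall>\<alpha>\<in>carrier G. a \<alpha> \<in> hom H H) \<and>
      (\<forall>u\<in>carrier H. a \<one>\<^bsub>G\<^esub> u = u) \<and>
      (\<forall>\<alpha>\<in>carrier G. \<forall>\<beta>\<in>carrier G. \<forall>u\<in>carrier H. a (\<alpha> \<otimes>\<^bsub>G\<^esub> \<beta>) u = a \<alpha> (a \<beta> u)) \<and>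
      continuous_map (cg_prod (Gtop \<G>) (Htop \<G>)) (Htop \<G>) (\<lambda>(\<alpha>, u). a \<alpha> u) \<and>
      (\<forall>\<alpha>\<in>carrier G. \<forall>u\<in>carrier H. d (a \<alpha> u) = \<alpha> \<otimes>\<^bsub>G\<^esub> d u \<otimes>\<^bsub>G\<^esub> inv\<^bsub>G\<^esub> \<alpha>) \<and>
      (\<forall>u\<in>carrier H. \<forall>v\<in>carrier H. a (d u) v = u \<otimes>\<^bsub>H\<^esub> v \<otimes>\<^bsub>H\<^esub> inv\<^bsub>H\<^esub> u))"

definition crossed_module_morphism ::
  "('g, 'h) crossed_module \<Rightarrow> ('g2, 'h2) crossed_module \<Rightarrow> ('h \<Rightarrow> 'h2) \<Rightarrow> ('g \<Rightarrow> 'g2) \<Rightarrow> bool" where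
  "crossed_module_morphism \<G> \<G>' \<phi>\<^sub>1 \<phi>\<^sub>2 \<longleftrightarrow>
     \<phi>\<^sub>1 \<in> hom (Hgrp \<G>) (Hgrp \<G>') \<and> continuous_map (Htop \<G>) (Htop \<G>') \<phi>\<^sub>1 \<and>
     \<phi>\<^sub>2 \<in> hom (Ggrp \<G>) (Ggrp \<G>') \<and> continuous_map (Gtop \<G>) (Gtop \<G>') \<phi>\<^sub>2 \<and>
     (\<forall>u\<in>carrier (Hgrp \<G>). bd \<G>' (\<phi>\<^sub>1 u) = \<phi>\<^sub>2 (bd \<G> u)) \<and>
     (\<forall>\<alpha>\<in>carrier (Ggrp \<G>). \<forall>u\<in>carrier (Hgrp \<G>). \<phi>\<^sub>1 (act \<G> \<alpha> u) = act \<G>' (\<phi>\<^sub>2 \<alpha>) (\<phi>\<^sub>1 u))"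


section \<open>First cohomology with values in a crossed module\<close>

type_synonym ('c, 'g, 'h) cochain = "('c \<Rightarrow> 'g) \<times> ('c \<times> 'c \<Rightarrow> 'h)"

definition Z1 :: "'c monoid \<Rightarrow> ('g, 'h) crossed_module \<Rightarrow> ('c, 'g, 'h) cochain set" where
  "Z1 \<Gamma> \<G> =
     (let G = Ggrp \<G>; H = Hgrp \<G> in
      {(\<alpha>, u).
        \<alpha> \<in> carrier \<Gamma> \<rightarrow>\<^sub>E carrier G \<and>
        u \<in> carrier \<Gamma> \<times> carrier \<Gamma> \<rightarrow>\<^sub>E carrier H \<and>
        (\<forall>g\<in>carrier \<Gamma>. \<forall>h\<in>carrier \<Gamma>.
           \<alpha> g \<otimes>\<^bsub>G\<^esub> \<alpha> h = bd \<G> (u (g, h)) \<otimes>\<^bsub>G\<^esub> \<alpha> (g \<otimes>\<^bsub>\<Gamma>\<^esub> h)) \<and>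
        (\<forall>g\<in>carrier \<Gamma>. \<forall>h\<in>carrier \<Gamma>. \<forall>k\<in>carrier \<Gamma>.
           act \<G> (\<alpha> g) (u (h, k)) \<otimes>\<^bsub>H\<^esub> u (g, h \<otimes>\<^bsub>\<Gamma>\<^esub> k) =
           u (g, h) \<otimes>\<^bsub>H\<^esub> u (g \<otimes>\<^bsub>\<Gamma>\<^esub> h, k))})"

definition normalised_Z1 :: "'c monoid \<Rightarrow> ('g, 'h) crossed_module \<Rightarrow> ('c, 'g, 'h) cochain set" where
  "normalised_Z1 \<Gamma> \<G> =
     {(\<alpha>, u) \<in> Z1 \<Gamma> \<G>.
        \<alpha> \<one>\<^bsub>\<Gamma>\<^esub> = \<one>\<^bsub>Ggrp \<G>\<^esub> \<and>
        (\<forall>g\<in>carrier \<Gamma>. u (g, \<one>\<^bsub>\<Gamma>\<^esub>) = \<one>\<^bsub>Hgrp \<G>\<^esub> \<and> u (\<one>\<^bsub>\<Gamma>\<^esub>, g) = \<one>\<^bsub>Hgrp \<G>\<^esub>)}"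

definition cohomologous ::
  "'c monoid \<Rightarrow> ('g, 'h) crossed_module \<Rightarrow> (('c, 'g, 'h) cochain \<times> ('c, 'g, 'h) cochain) set" where
  "cohomologous \<Gamma> \<G> =
     (let G = Ggrp \<G>; H = Hgrp \<G>; d = bd \<G>; a = act \<G> in
      {((\<alpha>0, u0), (\<alpha>1, u1)).
        (\<alpha>0, u0) \<in> Z1 \<Gamma> \<G> \<and> (\<alpha>1, u1) \<in> Z1 \<Gamma> \<G> \<and>
        (\<exists>\<gamma>\<in>carrier G. \<exists>w\<in>carrier \<Gamma> \<rightarrow> carrier H.
          (\<forall>g\<in>carrier \<Gamma>.
             \<alpha>1 g = d (w g) \<otimes>\<^bsub>G\<^esub> \<gamma> \<otimes>\<^bsub>G\<^esub> \<alpha>0 g \<otimes>\<^bsub>G\<^esub> inv\<^bsub>G\<^esub> \<gamma>) \<and>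
          (\<forall>g\<in>carrier \<Gamma>. \<forall>h\<in>carrier \<Gamma>.
             u1 (g, h) =
               w g \<otimes>\<^bsub>H\<^esub> a \<gamma> (a (\<alpha>0 g) (a (inv\<^bsub>G\<^esub> \<gamma>) (w h)) \<otimes>\<^bsub>H\<^esub> u0 (g, h))
                 \<otimes>\<^bsub>H\<^esub> inv\<^bsub>H\<^esub> w (g \<otimes>\<^bsub>\<Gamma>\<^esub> h)))})"

definition coh_class ::
  "'c monoid \<Rightarrow> ('g, 'h) crossed_module \<Rightarrow> ('c, 'g, 'h) cochain \<Rightarrow> ('c, 'g, 'h) cochain set" where
  "coh_class \<Gamma> \<G> c = cohomologous \<Gamma> \<G> `` {c}"

definition H1 :: "'c monoid \<Rightarrow> ('g, 'h) crossed_module \<Rightarrow> ('c, 'g, 'h) cochain set set" where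
  "H1 \<Gamma> \<G> = Z1 \<Gamma> \<G> // cohomologous \<Gamma> \<G>"

definition trivial_cocycle :: "'c monoid \<Rightarrow> ('g, 'h) crossed_module \<Rightarrow> ('c, 'g, 'h) cochain" where
  "trivial_cocycle \<Gamma> \<G> =
     (restrict (\<lambda>_. \<one>\<^bsub>Ggrp \<G>\<^esub>) (carrier \<Gamma>),
      restrict (\<lambda>_. \<one>\<^bsub>Hgrp \<G>\<^esub>) (carrier \<Gamma> \<times> carrier \<Gamma>))"

text \<open>
  Maps out of a set of classes are written, as in \<^theory>\<open>HOL.Equiv_Relations\<close>, as the union over
  all representatives of the class of the value; if the value depended on the representative, this
  union would not be a single class.
\<close>

definition H1_pull ::
  "'d monoid \<Rightarrow> ('g, 'h) crossed_module \<Rightarrow> ('d \<Rightarrow> 'c) \<Rightarrow>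
   ('c, 'g, 'h) cochain set \<Rightarrow> ('d, 'g, 'h) cochain set" where
  "H1_pull \<Gamma>' \<G> \<psi> x =
     (\<Union>(\<alpha>, u)\<in>x. coh_class \<Gamma>' \<G>
        (restrict (\<lambda>g. \<alpha> (\<psi> g)) (carrier \<Gamma>'),
         restrict (\<lambda>(g, h). u (\<psi> g, \<psi> h)) (carrier \<Gamma>' \<times> carrier \<Gamma>')))"

definition H1_push ::
  "'c monoid \<Rightarrow> ('g2, 'h2) crossed_module \<Rightarrow> ('h \<Rightarrow> 'h2) \<Rightarrow> ('g \<Rightarrow> 'g2) \<Rightarrow>
   ('c, 'g, 'h) cochain set \<Rightarrow> ('c, 'g2, 'h2) cochain set" where
  "H1_push \<Gamma> \<G>' \<phi>\<^sub>1 \<phi>\<^sub>2 x =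
     (\<Union>(\<alpha>, u)\<in>x. coh_class \<Gamma> \<G>'
        (restrict (\<lambda>g. \<phi>\<^sub>2 (\<alpha> g)) (carrier \<Gamma>),
         restrict (\<lambda>p. \<phi>\<^sub>1 (u p)) (carrier \<Gamma> \<times> carrier \<Gamma>)))"


section \<open>Simplicial spaces and the fat geometric realisation\<close>

text \<open>
  \<open>pull X m n \<theta>\<close> is the map \<open>X\<^sub>n \<rightarrow> X\<^sub>m\<close> induced by an order-preserving \<open>\<theta> : [m] \<rightarrow> [n]\<close>.
\<close>

record 'a simplicial_space =
  level :: "nat \<Rightarrow> 'a topology"
  pull :: "nat \<Rightarrow> nat \<Rightarrow> (nat \<Rightarrow> nat) \<Rightarrow> 'a \<Rightarrow> 'a"

definition order_preserving :: "nat \<Rightarrow> nat \<Rightarrow> (nat \<Rightarrow> nat) \<Rightarrow> bool" where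
  "order_preserving m n \<theta> \<longleftrightarrow> \<theta> \<in> {..m} \<rightarrow> {..n} \<and> mono_on {..m} \<theta>"

definition simplicial_map ::
  "'a simplicial_space \<Rightarrow> 'b simplicial_space \<Rightarrow> (nat \<Rightarrow> 'a \<Rightarrow> 'b) \<Rightarrow> bool" where
  "simplicial_map X Y f \<longleftrightarrow>
     (\<forall>n. continuous_map (level X n) (level Y n) (f n)) \<and>
     (\<forall>m n \<theta>. order_preserving m n \<theta> \<longrightarrow>
        (\<forall>x\<in>topspace (level X n). f m (pull X m n \<theta> x) = pull Y m n \<theta> (f n x)))"

definition coface :: "nat \<Rightarrow> nat \<Rightarrow> nat" where
  "coface i k = (if k < i then k else Suc k)"

type_synonym 'a fat_pt = "nat \<times> 'a \<times> (nat \<Rightarrow> real)"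

text \<open>
  Since simplices are compact Hausdorff, the ordinary product with a simplex is already the
  compactly generated one.
\<close>

definition fat_coproduct :: "'a simplicial_space \<Rightarrow> 'a fat_pt topology" where
  "fat_coproduct X =
     sum_topology
       (\<lambda>n. prod_topology (level X n) (subtopology (powertop_real UNIV) (standard_simplex n))) UNIV"

text \<open>\<^const>\<open>simplical_face\<close> \<open>i\<close> (so spelt in the library) is the \<open>i\<close>-th coface map of simplices.\<close>

definition face_glue :: "'a simplicial_space \<Rightarrow> ('a fat_pt \<times> 'a fat_pt) set" where
  "face_glue X =
     {((n, pull X n (Suc n) (coface i) x, t), (Suc n, x, simplical_face i t)) | n i x t.
        i \<le> Suc n \<and> x \<in> topspace (level X (Suc n)) \<and> t \<in> standard_simplex n}"

definition fat_rel :: "'a simplicial_space \<Rightarrow> ('a fat_pt \<times> 'a fat_pt) set" where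
  "fat_rel X = (face_glue X \<union> (face_glue X)\<inverse>)\<^sup>*"

definition quotient_topology :: "'a topology \<Rightarrow> ('a \<times> 'a) set \<Rightarrow> 'a set topology" where
  "quotient_topology X r =
     topology (\<lambda>U. U \<subseteq> topspace X // r \<and> openin X {x \<in> topspace X. r `` {x} \<in> U})"

lemma openin_quotient_topology:
  "openin (quotient_topology X r) U \<longleftrightarrow>
     U \<subseteq> topspace X // r \<and> openin X {x \<in> topspace X. r `` {x} \<in> U}"
proof -
  have "istopology (\<lambda>U. U \<subseteq> topspace X // r \<and> openin X {x \<in> topspace X. r `` {x} \<in> U})"
    unfolding istopology_def
  proof (intro conjI allI impI)
    fix S T
    assume S: "S \<subseteq> topspace X // r \<and> openin X {x \<in> topspace X. r `` {x} \<in> S}"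
      and T: "T \<subseteq> topspace X // r \<and> openin X {x \<in> topspace X. r `` {x} \<in> T}"
    show "S \<inter> T \<subseteq> topspace X // r" using S by auto
    have "{x \<in> topspace X. r `` {x} \<in> S \<inter> T} =
        {x \<in> topspace X. r `` {x} \<in> S} \<inter> {x \<in> topspace X. r `` {x} \<in> T}" by auto
    then show "openin X {x \<in> topspace X. r `` {x} \<in> S \<inter> T}" using S T by auto
  next
    fix \<K>
    assume *: "\<forall>K\<in>\<K>. K \<subseteq> topspace X // r \<and> openin X {x \<in> topspace X. r `` {x} \<in> K}"
    show "\<Union>\<K> \<subseteq> topspace X // r" using * by auto
    have "{x \<in> topspace X. r `` {x} \<in> \<Union>\<K>} = (\<Union>K\<in>\<K>. {x \<in> topspace X. r `` {x} \<in> K})" by auto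
    then show "openin X {x \<in> topspace X. r `` {x} \<in> \<Union>\<K>}" using * by auto
  qed
  then show ?thesis by (simp add: quotient_topology_def)
qed

definition fat_realisation :: "'a simplicial_space \<Rightarrow> 'a fat_pt set topology" where
  "fat_realisation X = quotient_topology (fat_coproduct X) (fat_rel X)"

definition fat_map ::
  "'b simplicial_space \<Rightarrow> (nat \<Rightarrow> 'a \<Rightarrow> 'b) \<Rightarrow> 'a fat_pt set \<Rightarrow> 'b fat_pt set" where
  "fat_map Y f p = (\<Union>(n, x, t)\<in>p. fat_rel Y `` {(n, f n x, t)})"


section \<open>Nerves\<close>

text \<open>The product \<open>g\<^sub>i\<^sub>+\<^sub>1 \<cdots> g\<^sub>j\<close>, where \<open>gs = [g\<^sub>1, \<dots>, g\<^sub>n]\<close> and \<open>i \<le> j \<le> n\<close>.\<close>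

definition seg_prod :: "'c monoid \<Rightarrow> 'c list \<Rightarrow> nat \<Rightarrow> nat \<Rightarrow> 'c" where
  "seg_prod \<Gamma> gs i j = foldr (\<lambda>g h. g \<otimes>\<^bsub>\<Gamma>\<^esub> h) (take (j - i) (drop i gs)) \<one>\<^bsub>\<Gamma>\<^esub>"

definition nerve :: "'c monoid \<Rightarrow> 'c list simplicial_space" where
  "nerve \<Gamma> =
     \<lparr> level = (\<lambda>n. discrete_topology {gs. length gs = n \<and> set gs \<subseteq> carrier \<Gamma>}),
       pull = (\<lambda>m n \<theta> gs. map (\<lambda>k. seg_prod \<Gamma> gs (\<theta> k) (\<theta> (Suc k))) [0..<m]) \<rparr>"

definition pairs :: "nat \<Rightarrow> (nat \<times> nat) set" where
  "pairs n = {(i, j). i < j \<and> j \<le> n}"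

definition triples :: "nat \<Rightarrow> (nat \<times> nat \<times> nat) set" where
  "triples n = {(i, j, k). i < j \<and> j < k \<and> k \<le> n}"

type_synonym ('g, 'h) duskin_simplex = "(nat \<times> nat \<Rightarrow> 'g) \<times> (nat \<times> nat \<times> nat \<Rightarrow> 'h)"

definition duskin_simplices :: "('g, 'h) crossed_module \<Rightarrow> nat \<Rightarrow> ('g, 'h) duskin_simplex set" where
  "duskin_simplices \<G> n =
     (let G = Ggrp \<G>; H = Hgrp \<G> in
      {(\<alpha>, u).
        \<alpha> \<in> pairs n \<rightarrow>\<^sub>E carrier G \<and> u \<in> triples n \<rightarrow>\<^sub>E carrier H \<and>
        (\<forall>i j k. i < j \<and> j < k \<and> k \<le> n \<longrightarrow>
           \<alpha> (i, j) \<otimes>\<^bsub>G\<^esub> \<alpha> (j, k) = bd \<G> (u (i, j, k)) \<otimes>\<^bsub>G\<^esub> \<alpha> (i, k)) \<and>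
        (\<forall>i j k l. i < j \<and> j < k \<and> k < l \<and> l \<le> n \<longrightarrow>
           act \<G> (\<alpha> (i, j)) (u (j, k, l)) \<otimes>\<^bsub>H\<^esub> u (i, j, l) =
           u (i, j, k) \<otimes>\<^bsub>H\<^esub> u (i, k, l))})"

definition duskin_nerve :: "('g, 'h) crossed_module \<Rightarrow> ('g, 'h) duskin_simplex simplicial_space" where
  "duskin_nerve \<G> =
     \<lparr> level = (\<lambda>n.
         subtopology
           (cg_prod (product_topology (\<lambda>_. Gtop \<G>) (pairs n))
                    (product_topology (\<lambda>_. Htop \<G>) (triples n)))
           (duskin_simplices \<G> n)),
       pull = (\<lambda>m n \<theta> (\<alpha>, u).
         (restrict (\<lambda>(r, s). if \<theta> r < \<theta> s then \<alpha> (\<theta> r, \<theta> s) else \<one>\<^bsub>Ggrp \<G>\<^esub>) (pairs m),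
          restrict (\<lambda>(r, s, t). if \<theta> r < \<theta> s \<and> \<theta> s < \<theta> t then u (\<theta> r, \<theta> s, \<theta> t)
                               else \<one>\<^bsub>Hgrp \<G>\<^esub>) (triples m))) \<rparr>"

text \<open>
  The thin and the fat realisation of the nerve of a discrete group are homotopy equivalent; we use
  the fat one throughout.
\<close>

abbreviation B :: "'c monoid \<Rightarrow> 'c list fat_pt set topology" where
  "B \<Gamma> \<equiv> fat_realisation (nerve \<Gamma>)"

abbreviation BD :: "('g, 'h) crossed_module \<Rightarrow> ('g, 'h) duskin_simplex fat_pt set topology" where
  "BD \<G> \<equiv> fat_realisation (duskin_nerve \<G>)"

definition nerve_map :: "('d \<Rightarrow> 'c) \<Rightarrow> nat \<Rightarrow> 'd list \<Rightarrow> 'c list" where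
  "nerve_map \<psi> n gs = map \<psi> gs"

definition duskin_map ::
  "('h \<Rightarrow> 'h2) \<Rightarrow> ('g \<Rightarrow> 'g2) \<Rightarrow> nat \<Rightarrow> ('g, 'h) duskin_simplex \<Rightarrow> ('g2, 'h2) duskin_simplex" where
  "duskin_map \<phi>\<^sub>1 \<phi>\<^sub>2 n =
     (\<lambda>(\<alpha>, u). (restrict (\<lambda>p. \<phi>\<^sub>2 (\<alpha> p)) (pairs n), restrict (\<lambda>p. \<phi>\<^sub>1 (u p)) (triples n)))"

definition cocycle_map ::
  "'c monoid \<Rightarrow> ('c, 'g, 'h) cochain \<Rightarrow> nat \<Rightarrow> 'c list \<Rightarrow> ('g, 'h) duskin_simplex" where
  "cocycle_map \<Gamma> c n gs =
     (restrict (\<lambda>(i, j). fst c (seg_prod \<Gamma> gs i j)) (pairs n),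
      restrict (\<lambda>(i, j, k). snd c (seg_prod \<Gamma> gs i j, seg_prod \<Gamma> gs j k)) (triples n))"


section \<open>Homotopy classes\<close>

definition homotopy_rel :: "'a topology \<Rightarrow> 'b topology \<Rightarrow> (('a \<Rightarrow> 'b) \<times> ('a \<Rightarrow> 'b)) set" where
  "homotopy_rel X Y = {(f, g). homotopic_with (\<lambda>_. True) X Y f g}"

definition htpy_class :: "'a topology \<Rightarrow> 'b topology \<Rightarrow> ('a \<Rightarrow> 'b) \<Rightarrow> ('a \<Rightarrow> 'b) set" where
  "htpy_class X Y f = homotopy_rel X Y `` {f}"

definition htpy_classes :: "'a topology \<Rightarrow> 'b topology \<Rightarrow> ('a \<Rightarrow> 'b) set set" where
  "htpy_classes X Y = {f. continuous_map X Y f} // homotopy_rel X Y"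

definition htpy_precompose ::
  "'a topology \<Rightarrow> 'c topology \<Rightarrow> ('a \<Rightarrow> 'b) \<Rightarrow> ('b \<Rightarrow> 'c) set \<Rightarrow> ('a \<Rightarrow> 'c) set" where
  "htpy_precompose X Z p C = (\<Union>f\<in>C. htpy_class X Z (f \<circ> p))"

definition htpy_postcompose ::
  "'a topology \<Rightarrow> 'c topology \<Rightarrow> ('b \<Rightarrow> 'c) \<Rightarrow> ('a \<Rightarrow> 'b) set \<Rightarrow> ('a \<Rightarrow> 'c) set" where
  "htpy_postcompose X Z q C = (\<Union>f\<in>C. htpy_class X Z (q \<circ> f))"

text \<open>
  The space \<open>N\<^sub>0\<close> is a single point (the empty families), which gives a canonical point of the
  realisation. The realisation is path connected, so every constant map represents the same class.
\<close>

definition BD_vertex :: "('g, 'h) crossed_module \<Rightarrow> ('g, 'h) duskin_simplex fat_pt set" where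
  "BD_vertex \<G> =
     fat_rel (duskin_nerve \<G>) ``
       {(0, (\<lambda>_. undefined, \<lambda>_. undefined), (\<lambda>i. if i = 0 then 1 else 0))}"

text \<open>The assignment on \<^const>\<open>H1\<close> given by normalised representatives.\<close>

definition classifying_map ::
  "'c monoid \<Rightarrow> ('g, 'h) crossed_module \<Rightarrow> ('c, 'g, 'h) cochain set \<Rightarrow>
   ('c list fat_pt set \<Rightarrow> ('g, 'h) duskin_simplex fat_pt set) set" where
  "classifying_map \<Gamma> \<G> x =
     (\<Union>c \<in> x \<inter> normalised_Z1 \<Gamma> \<G>.
        htpy_class (B \<Gamma>) (BD \<G>) (fat_map (duskin_nerve \<G>) (cocycle_map \<Gamma> c)))"

end

theory Submission
  imports Defs
begin

text \<open>
  The fat realisation is glued along faces alone, so it is functorial for maps that are compatible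
  with faces. Every cocycle induces such a map, and a normalised one induces a map compatible with
  degeneracies as well. So every cocycle \<open>c\<close> has a realisation \<open>|c|\<close> from \<open>B\<Gamma>\<close> to \<open>B\<^sup>D\<G>\<close>. The
  whole statement then rests on one fact, \<open>cohomologous_imp_homotopic\<close>: if \<open>c\<^sub>0\<close> and \<open>c\<^sub>1\<close> are
  cohomologous, then \<open>|c\<^sub>0|\<close> and \<open>|c\<^sub>1|\<close> are homotopic.

  Since \<open>\<Gamma>\<close> is a group, its nerve is that of a groupoid, and a simplex with vertices \<open>p\<^sub>0, \<dots>, p\<^sub>n\<close>
  has edges \<open>p\<^sub>i\<inverse>p\<^sub>j\<close> in both directions. So its vertices may be repeated: the string
  \<open>p\<^sub>0, \<dots>, p\<^sub>n, p\<^sub>0, \<dots>, p\<^sub>n\<close>, coloured 0 in the first half and 1 in the second, is a join of two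
  copies of the simplex. A witness \<open>(\<gamma>, w)\<close> that \<open>c\<^sub>0\<close> and \<open>c\<^sub>1\<close> are cohomologous yields
  a way of filling this join in the Duskin nerve, with \<open>c\<^sub>0\<close> on colour 0, \<open>c\<^sub>1\<close> on colour 1,
  \<open>\<alpha>\<^sup>0\<^sub>g \<gamma>\<inverse>\<close> on the edges that change colour, and \<open>\<alpha>\<^sup>0\<^sub>g(\<gamma>\<inverse>(w\<^sub>h)) u\<^sup>0\<^sub>g\<^sub>,\<^sub>h\<close> on the triangles
  that change colour after their first edge (\<open>crossed_labelling_join\<close>). The homotopy moves
  a point with barycentric coordinates \<open>t\<close> along \<open>((1 - s) t, s t)\<close> inside this
  \<open>(2n+1)\<close>-simplex. The formula is polynomial and needs no subdivision of the prism, and it is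
  compatible with faces because deleting a vertex of the simplex deletes both of its copies.

  Two further ingredients give well-definedness and the base point. Every cocycle is cohomologous to
  a normalised one, with \<open>\<gamma> = 1\<close> and \<open>w\<close> constantly \<open>u(1, 1)\<inverse>\<close>. The trivial cocycle sends every
  \<open>n\<close>-simplex to the \<open>n\<close>-simplex with entries 1, so its realisation factors through the fat
  realisation of a point, which is contracted by coning off with one more vertex.
  Because all cocycles, normalised or not, have realisations, each of the unions over classes is
  evaluated by comparing every member with one chosen representative.

  There are two point-set issues. A homotopy on \<open>B\<Gamma>\<close> is constructed simplexwise, which is
  legitimate because the product of a quotient map with the locally compact interval is again a
  quotient map. For naturality in \<open>\<G>\<close>, a morphism of crossed modules must be continuous on the
  compactly generated products in which the Duskin nerve lives. The refinement is functorial as soon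
  as images of compact Hausdorff subspaces are Hausdorff, and this follows from weak
  Hausdorffness of the two groups of the target (\<open>weakly_Hausdorff_compact_image\<close>).
\<close>

section \<open>Weak Hausdorffness and compactly generated refinements\<close>

lemma topspace_cg_refine [simp]: "topspace (cg_refine X) = topspace X"
proof (rule antisym)
  show "topspace (cg_refine X) \<subseteq> topspace X"
    using openin_cg_refine[of X "topspace (cg_refine X)"] by (simp add: cg_open_def)
  have "topspace X \<inter> C = topspace (subtopology X C)" for C
    by simp
  then have "cg_open X (topspace X)"
    unfolding cg_open_def by (metis openin_topspace order_refl)
  then show "topspace X \<subseteq> topspace (cg_refine X)"
    by (metis openin_cg_refine openin_subset)
qed

lemma homeomorphic_space_pullback_injection:
  assumes "inj_on j (topspace X)"
  shows "X homeomorphic_space pullback_topology (j ` topspace X) (inv_into (topspace X) j) X"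
  unfolding homeomorphic_space_def
proof (intro exI)
  let ?i = "inv_into (topspace X) j" and ?P = "pullback_topology (j ` topspace X) (inv_into (topspace X) j) X"
  have "?i ` (j ` topspace X) \<subseteq> topspace X"
    using assms by auto
  then have top: "topspace ?P = j ` topspace X"
    by (auto simp: topspace_pullback_topology)
  have "continuous_map X ?P j"
  proof (rule continuous_map_pullback')
    show "continuous_map X X (?i \<circ> j)"
      using assms by (simp add: continuous_map_eq[OF continuous_map_id])
  qed auto
  moreover have "continuous_map ?P X ?i"
    using continuous_map_pullback[OF continuous_map_id, of "j ` topspace X" ?i X] by simp
  ultimately show "homeomorphic_maps X ?P j ?i"
    using assms top by (auto simp: homeomorphic_maps_def)
qed

text \<open>
  The test spaces for weak Hausdorffness have points in a fixed type; a compact Hausdorff space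
  that injects into that type can be transported along the injection.
\<close>

lemma closedin_image_of_small_compact_Hausdorff:
  fixes Y :: "'a topology" and X :: "'k topology" and j :: "'k \<Rightarrow> 'a set set"
  assumes "weakly_Hausdorff Y" "compact_space X" "Hausdorff_space X"
    and f: "continuous_map X Y f" and j: "inj_on j (topspace X)"
  shows "closedin Y (f ` topspace X)"
proof -
  let ?P = "pullback_topology (j ` topspace X) (inv_into (topspace X) j) X"
  have hom: "X homeomorphic_space ?P"
    by (rule homeomorphic_space_pullback_injection[OF j])
  have "continuous_map ?P X (inv_into (topspace X) j)"
    using continuous_map_pullback[OF continuous_map_id, of "j ` topspace X" _ X] by simp
  then have c: "continuous_map ?P Y (f \<circ> inv_into (topspace X) j)"
    using f by (rule continuous_map_compose)
  have "topspace ?P = j ` topspace X"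
    using j by (auto simp: topspace_pullback_topology)
  then have im: "(f \<circ> inv_into (topspace X) j) ` topspace ?P = f ` topspace X"
    using j by (force simp: image_comp)
  have "compact_space ?P" "Hausdorff_space ?P"
    using assms hom homeomorphic_compact_space homeomorphic_Hausdorff_space by blast+
  then show ?thesis
    using assms(1) c im unfolding weakly_Hausdorff_def by metis
qed

text \<open>
  Choose a section \<open>s\<close> of \<open>f\<close> over its image \<open>F\<close>. The closure \<open>L\<close> of \<open>s(F)\<close> still maps onto \<open>F\<close>, and
  a point of \<open>L\<close> is determined by the sets \<open>A \<subseteq> F\<close> for which it adheres to \<open>s(A)\<close>, because
  \<open>K\<close> is Hausdorff. So closed subsets of \<open>L\<close> are small enough to serve as test spaces and have
  closed images: \<open>f\<close> restricts to a closed map from the compact Hausdorff space \<open>L\<close> onto \<open>F\<close>.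
  Such a map carries normality over to \<open>F\<close>, whose points are closed as images of points.
\<close>

lemma weakly_Hausdorff_compact_image:
  fixes Y :: "'a topology" and K :: "'k topology"
  assumes wh: "weakly_Hausdorff Y" and cpt: "compact_space K" and haus: "Hausdorff_space K"
    and f: "continuous_map K Y f"
  shows "Hausdorff_space (subtopology Y (f ` topspace K))"
proof -
  define s where "s = inv_into (topspace K) f"
  define F where "F = f ` topspace K"
  define L where "L = K closure_of (s ` F)"
  have s: "s b \<in> topspace K" "f (s b) = b" if "b \<in> F" for b
    using that by (auto simp: s_def F_def f_inv_into_f inv_into_into)
  have sF: "s ` F \<subseteq> L"
    unfolding L_def using s by (intro closure_of_subset) auto
  have L: "closedin K L" "L \<subseteq> topspace K"
    unfolding L_def by (simp_all add: closure_of_subset_topspace)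
  have fL: "f ` L = F"
  proof
    show "f ` L \<subseteq> F"
      using L(2) unfolding F_def by (rule image_mono)
    show "F \<subseteq> f ` L"
    proof
      fix b assume "b \<in> F"
      then show "b \<in> f ` L"
        using s(2)[of b] sF by (metis imageI subsetD)
    qed
  qed
  define j where "j x = {A. A \<subseteq> F \<and> x \<in> K closure_of (s ` A)}" for x
  have inj: "inj_on j L"
  proof (rule inj_onI, rule ccontr)
    fix x y assume xy: "x \<in> L" "y \<in> L" "j x = j y" "x \<noteq> y"
    then obtain U V where UV: "openin K U" "openin K V" "x \<in> U" "y \<in> V" "disjnt U V"
      using haus L(2) unfolding Hausdorff_space_def by (meson subsetD)
    \<comment> \<open>a set that belongs to \<open>j x\<close> but not to \<open>j y\<close>\<close>
    define A where "A = {b \<in> F. s b \<in> U}"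
    have "x \<in> K closure_of (s ` A)"
      unfolding in_closure_of
    proof (intro conjI allI impI)
      show "x \<in> topspace K" using xy L by auto
      fix W assume W: "x \<in> W \<and> openin K W"
      then have "openin K (W \<inter> U)" "x \<in> W \<inter> U"
        using UV by auto
      then obtain z where "z \<in> s ` F" "z \<in> W \<inter> U"
        using \<open>x \<in> L\<close> unfolding L_def in_closure_of by meson
      then show "\<exists>z. z \<in> s ` A \<and> z \<in> W"
        unfolding A_def by auto
    qed
    then have "A \<in> j y"
      using xy(3) by (auto simp: j_def A_def)
    then have "y \<in> K closure_of (s ` A)"
      by (simp add: j_def)
    then obtain z where "z \<in> s ` A" "z \<in> V"
      using UV unfolding in_closure_of by meson
    then show False
      using UV(5) by (auto simp: A_def disjnt_iff)
  qed
  have closed: "closedin Y (f ` D)" if D: "closedin K D" "D \<subseteq> L" for D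
  proof -
    have top: "topspace (subtopology K D) = D"
      using closedin_subset[OF D(1)] by auto
    have "closedin Y (f ` topspace (subtopology K D))"
    proof (rule closedin_image_of_small_compact_Hausdorff[OF wh])
      show "compact_space (subtopology K D)"
        using closedin_compact_space[OF cpt D(1)] by (rule compact_space_subtopology)
      show "Hausdorff_space (subtopology K D)"
        by (rule Hausdorff_space_subtopology[OF haus])
      show "continuous_map (subtopology K D) Y f"
        by (rule continuous_map_from_subtopology[OF f])
      show "inj_on j (topspace (subtopology K D))"
        unfolding top using inj D(2) by (rule inj_on_subset)
    qed
    then show ?thesis by (simp only: top)
  qed
  let ?K = "subtopology K L" and ?Y = "subtopology Y F"
  have FY: "F \<subseteq> topspace Y"
    using continuous_map_image_subset_topspace[OF f] by (simp add: F_def)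
  have topK: "topspace ?K = L" and topY: "topspace ?Y = F"
    using L FY by auto
  have "Hausdorff_space ?Y"
  proof (rule Hausdorff_normal_space_closed_continuous_map_image[where X = ?K and f = f])
    have "compact_space ?K" "Hausdorff_space ?K"
      using closedin_compact_space[OF cpt L(1)] haus
      by (auto intro: compact_space_subtopology Hausdorff_space_subtopology)
    then show "normal_space ?K"
      by (rule compact_Hausdorff_or_regular_imp_normal_space[OF _ disjI1])
    show "continuous_map ?K ?Y f"
      using continuous_map_from_subtopology[OF f, of L] fL topK
      by (auto simp: continuous_map_in_subtopology)
    show "closed_map ?K ?Y f"
      unfolding closed_map_def
    proof (intro allI impI)
      fix D assume "closedin ?K D"
      then have "closedin K D" "D \<subseteq> L"
        using L(1) closedin_trans_full closedin_subset topK by metis+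
      then have "closedin Y (f ` D)" "f ` D \<subseteq> f ` L"
        by (blast intro: closed)+
      then show "closedin ?Y (f ` D)"
        unfolding fL by (rule closedin_subset_topspace)
    qed
    show "f ` topspace ?K = topspace ?Y"
      by (simp only: topK topY fL)
    show "t1_space ?Y"
      unfolding t1_space_closedin_singleton topY
    proof
      fix b assume b: "b \<in> F"
      then obtain x where x: "x \<in> L" "f x = b" using fL by auto
      have "closedin K {x}"
        using Hausdorff_imp_t1_space[OF haus] x L by (auto simp: t1_space_closedin_singleton)
      then have "closedin Y (f ` {x})"
        using x by (intro closed) auto
      then show "closedin ?Y {b}"
        using x b by (intro closedin_subset_topspace) auto
    qed
  qed
  then show ?thesis by (simp add: F_def)
qed

text \<open>
  The refinement is not functorial in general: it tests openness on compact Hausdorff subspaces only,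
  and the image of one need not be Hausdorff.
\<close>

lemma continuous_map_cg_refine:
  assumes f: "continuous_map X Y f"
    and haus: "\<And>C. C \<subseteq> topspace X \<Longrightarrow> compact_space (subtopology X C) \<Longrightarrow>
      Hausdorff_space (subtopology X C) \<Longrightarrow> Hausdorff_space (subtopology Y (f ` C))"
  shows "continuous_map (cg_refine X) (cg_refine Y) f"
  unfolding continuous_map_def
proof (intro conjI allI impI)
  show "f \<in> topspace (cg_refine X) \<rightarrow> topspace (cg_refine Y)"
    using f by (simp add: continuous_map_def)
  fix U assume "openin (cg_refine Y) U"
  then have U: "cg_open Y U" by (simp add: openin_cg_refine)
  have "cg_open X {x \<in> topspace X. f x \<in> U}"
    unfolding cg_open_def
  proof (intro conjI allI impI)
    fix C assume C: "C \<subseteq> topspace X" "compact_space (subtopology X C) \<and> Hausdorff_space (subtopology X C)"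
    let ?fC = "subtopology Y (f ` C)"
    have sub: "f ` C \<subseteq> topspace Y"
      using f C(1) by (auto simp: continuous_map_def)
    have "compactin X C"
      using C by (simp add: compactin_subspace)
    then have "compact_space ?fC"
      by (simp add: compact_space_subtopology image_compactin[OF _ f])
    moreover have "Hausdorff_space ?fC"
      using haus C by blast
    ultimately have "openin ?fC (U \<inter> f ` C)"
      using U sub unfolding cg_open_def by blast
    moreover have "continuous_map (subtopology X C) ?fC f"
      using f by (auto simp: continuous_map_in_subtopology continuous_map_from_subtopology)
    ultimately have "openin (subtopology X C) {x \<in> topspace (subtopology X C). f x \<in> U \<inter> f ` C}"
      by (rule openin_continuous_map_preimage[rotated])
    moreover have "{x \<in> topspace (subtopology X C). f x \<in> U \<inter> f ` C} = {x \<in> topspace X. f x \<in> U} \<inter> C"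
      using C(1) by auto
    ultimately show "openin (subtopology X C) ({x \<in> topspace X. f x \<in> U} \<inter> C)"
      by simp
  qed auto
  then show "openin (cg_refine X) {x \<in> topspace (cg_refine X). f x \<in> U}"
    by (simp add: openin_cg_refine)
qed

text \<open>
  A subset of a product lies in the product of its projections, so it is Hausdorff when these are.
\<close>

lemma Hausdorff_space_product_image:
  assumes "\<And>i. i \<in> I \<Longrightarrow> Hausdorff_space (subtopology (X i) ((\<lambda>x. x i) ` D))"
    and D: "D \<subseteq> topspace (product_topology X I)"
  shows "Hausdorff_space (subtopology (product_topology X I) D)"
proof -
  let ?S = "PiE I (\<lambda>i. (\<lambda>x. x i) ` D)"
  have "D \<subseteq> ?S"
    using D by (auto simp: PiE_iff)
  then have "subtopology (product_topology X I) D = subtopology (subtopology (product_topology X I) ?S) D"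
    by (simp add: subtopology_subtopology Int_absorb1)
  moreover have "Hausdorff_space (subtopology (product_topology X I) ?S)"
    using assms(1) by (simp add: subtopology_product_topology Hausdorff_space_product_topology)
  ultimately show ?thesis
    by (simp add: Hausdorff_space_subtopology)
qed

lemma Hausdorff_space_prod_image:
  assumes "Hausdorff_space (subtopology X (fst ` D))" "Hausdorff_space (subtopology Y (snd ` D))"
  shows "Hausdorff_space (subtopology (prod_topology X Y) D)"
proof -
  have "D \<subseteq> fst ` D \<times> snd ` D"
    by force
  then have "subtopology (prod_topology X Y) D
      = subtopology (subtopology (prod_topology X Y) (fst ` D \<times> snd ` D)) D"
    by (simp add: subtopology_subtopology Int_absorb1)
  moreover have "Hausdorff_space (subtopology (prod_topology X Y) (fst ` D \<times> snd ` D))"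
    using assms by (simp add: Hausdorff_space_prod_topology subtopology_Times)
  ultimately show ?thesis
    by (simp add: Hausdorff_space_subtopology)
qed

lemma weakly_Hausdorff_compact_image_subset:
  assumes "weakly_Hausdorff Y" "compact_space (subtopology X C)" "Hausdorff_space (subtopology X C)"
    and "C \<subseteq> topspace X" "continuous_map X Y f"
  shows "Hausdorff_space (subtopology Y (f ` C))"
  using weakly_Hausdorff_compact_image[OF assms(1-3), of f] assms(4,5)
  by (simp add: continuous_map_from_subtopology Int_absorb1)

text \<open>
  Weak Hausdorffness is used one coordinate at a time: each coordinate of the image of a compact
  Hausdorff subspace is a compact image in one of the two weakly Hausdorff factors, hence Hausdorff.
\<close>

lemma continuous_map_cg_prod_of_powers:
  assumes "weakly_Hausdorff S'" "weakly_Hausdorff T'"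
    and f: "continuous_map S S' f" and g: "continuous_map T T' g"
  shows "continuous_map
      (cg_prod (product_topology (\<lambda>_. S) I) (product_topology (\<lambda>_. T) J))
      (cg_prod (product_topology (\<lambda>_. S') I) (product_topology (\<lambda>_. T') J))
      (\<lambda>(x, y). (restrict (\<lambda>i. f (x i)) I, restrict (\<lambda>j. g (y j)) J))"
    (is "continuous_map (cg_refine ?X) (cg_refine ?Y) ?F")
proof (rule continuous_map_cg_refine)
  have c1: "continuous_map ?X S' (\<lambda>p. f (fst p i))" if "i \<in> I" for i
  proof -
    have "continuous_map ?X S (\<lambda>p. fst p i)"
      by (rule continuous_map_compose[OF continuous_map_fst continuous_map_product_projection[OF that],
            unfolded o_def])
    then show ?thesis
      using continuous_map_compose[OF _ f] by (fastforce simp: o_def)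
  qed
  have c2: "continuous_map ?X T' (\<lambda>p. g (snd p j))" if "j \<in> J" for j
  proof -
    have "continuous_map ?X T (\<lambda>p. snd p j)"
      by (rule continuous_map_compose[OF continuous_map_snd continuous_map_product_projection[OF that],
            unfolded o_def])
    then show ?thesis
      using continuous_map_compose[OF _ g] by (fastforce simp: o_def)
  qed
  show F: "continuous_map ?X ?Y ?F"
    using c1 c2 by (auto simp: case_prod_unfold continuous_map_pairwise o_def continuous_map_componentwise)
  fix C assume C: "C \<subseteq> topspace ?X" "compact_space (subtopology ?X C)" "Hausdorff_space (subtopology ?X C)"
  have "fst ` ?F ` C \<subseteq> topspace (product_topology (\<lambda>_. S') I)"
    "snd ` ?F ` C \<subseteq> topspace (product_topology (\<lambda>_. T') J)"
    using F C(1) by (fastforce simp: continuous_map_def Pi_iff)+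
  moreover have "Hausdorff_space (subtopology S' ((\<lambda>x. x i) ` fst ` ?F ` C))" if "i \<in> I" for i
  proof -
    have "(\<lambda>x. x i) ` fst ` ?F ` C = (\<lambda>p. f (fst p i)) ` C"
      using that by (auto simp: image_image case_prod_unfold)
    then show ?thesis
      using weakly_Hausdorff_compact_image_subset[OF assms(1) C(2,3,1) c1[OF that]] by simp
  qed
  moreover have "Hausdorff_space (subtopology T' ((\<lambda>x. x j) ` snd ` ?F ` C))" if "j \<in> J" for j
  proof -
    have "(\<lambda>x. x j) ` snd ` ?F ` C = (\<lambda>p. g (snd p j)) ` C"
      using that by (auto simp: image_image case_prod_unfold)
    then show ?thesis
      using weakly_Hausdorff_compact_image_subset[OF assms(2) C(2,3,1) c2[OF that]] by simp
  qed
  ultimately show "Hausdorff_space (subtopology ?Y (?F ` C))"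
    by (intro Hausdorff_space_prod_image Hausdorff_space_product_image) auto
qed

section \<open>The fat realisation\<close>

lemma fat_rel_equiv: "equiv UNIV (fat_rel X)"
proof (rule equivI)
  show "refl_on UNIV (fat_rel X)"
    by (simp add: fat_rel_def refl_on_def)
  have "sym (face_glue X \<union> (face_glue X)\<inverse>)"
    by (auto simp: sym_def)
  then show "sym (fat_rel X)"
    unfolding fat_rel_def by (rule sym_rtrancl)
  show "trans (fat_rel X)"
    unfolding fat_rel_def by (rule trans_rtrancl)
qed auto

lemma fat_rel_sym: "(p, q) \<in> fat_rel X \<Longrightarrow> (q, p) \<in> fat_rel X"
  using fat_rel_equiv by (auto simp: equiv_def dest: symD)

lemma fat_rel_trans: "(p, q) \<in> fat_rel X \<Longrightarrow> (q, r) \<in> fat_rel X \<Longrightarrow> (p, r) \<in> fat_rel X"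
  unfolding fat_rel_def by (rule rtrancl_trans)

lemma fat_rel_class_eq: "(p, q) \<in> fat_rel X \<Longrightarrow> fat_rel X `` {p} = fat_rel X `` {q}"
  using equiv_class_eq[OF fat_rel_equiv] .

lemma face_glue_fat_rel: "(p, q) \<in> face_glue X \<Longrightarrow> (p, q) \<in> fat_rel X"
  unfolding fat_rel_def by blast

lemma face_glueI:
  assumes "i \<le> Suc n" "x \<in> topspace (level X (Suc n))" "t \<in> standard_simplex n"
    and "y = pull X n (Suc n) (coface i) x" "s = simplical_face i t"
  shows "((n, y, t), (Suc n, x, s)) \<in> face_glue X"
  using assms by (auto simp: face_glue_def)

lemma fat_rel_transfer:
  assumes "\<And>p q. (p, q) \<in> face_glue X \<Longrightarrow> (k p, k q) \<in> fat_rel Y"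
    and "(p, q) \<in> fat_rel X"
  shows "(k p, k q) \<in> fat_rel Y"
  using assms(2) unfolding fat_rel_def
proof (induction rule: rtrancl_induct)
  case base
  show ?case by simp
next
  case (step y z)
  have "(k y, k z) \<in> fat_rel Y"
    using step(2) assms(1) fat_rel_sym by blast
  then show ?case
    using step(3) unfolding fat_rel_def by (meson rtrancl_trans)
qed

text \<open>
  Maps between realisations are unions over representatives; when the map on representatives respects
  the gluing, such a union collapses to a single class.
\<close>

lemma UN_fat_rel_class:
  assumes "\<And>p q. (p, q) \<in> face_glue X \<Longrightarrow> (k p, k q) \<in> fat_rel Y"
  shows "(\<Union>q\<in>fat_rel X `` {p}. fat_rel Y `` {k q}) = fat_rel Y `` {k p}"
proof -
  have "fat_rel Y `` {k q} = fat_rel Y `` {k p}" if "q \<in> fat_rel X `` {p}" for q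
  proof -
    have "(k p, k q) \<in> fat_rel Y"
      by (rule fat_rel_transfer[of X k Y, OF assms]) (use that in auto)
    then show ?thesis
      by (metis fat_rel_class_eq)
  qed
  moreover have "p \<in> fat_rel X `` {p}"
    by (simp add: fat_rel_def)
  ultimately show ?thesis by blast
qed

lemma topspace_fat_coproduct:
  "topspace (fat_coproduct X) =
    {(n, x, t). x \<in> topspace (level X n) \<and> t \<in> standard_simplex n}"
  by (auto simp: fat_coproduct_def)

lemma topspace_fat_realisation:
  "topspace (fat_realisation X) = topspace (fat_coproduct X) // fat_rel X"
proof (rule antisym)
  show "topspace (fat_realisation X) \<subseteq> topspace (fat_coproduct X) // fat_rel X"
    unfolding fat_realisation_def
    using openin_quotient_topology openin_topspace by blast
  have "{p \<in> topspace (fat_coproduct X). fat_rel X `` {p} \<in> topspace (fat_coproduct X) // fat_rel X}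
      = topspace (fat_coproduct X)"
    by (auto intro: quotientI)
  then have "openin (fat_realisation X) (topspace (fat_coproduct X) // fat_rel X)"
    unfolding fat_realisation_def openin_quotient_topology by simp
  then show "topspace (fat_coproduct X) // fat_rel X \<subseteq> topspace (fat_realisation X)"
    by (rule openin_subset)
qed

lemma topspace_fat_realisation_cases:
  assumes "c \<in> topspace (fat_realisation X)"
  obtains n x t where "c = fat_rel X `` {(n, x, t)}"
    "x \<in> topspace (level X n)" "t \<in> standard_simplex n"
  using assms unfolding topspace_fat_realisation topspace_fat_coproduct quotient_def by blast

lemma quotient_map_fat_realisation:
  "quotient_map (fat_coproduct X) (fat_realisation X) (\<lambda>p. fat_rel X `` {p})"
  unfolding quotient_map_def
proof (intro conjI allI impI)
  show "(\<lambda>p. fat_rel X `` {p}) ` topspace (fat_coproduct X) = topspace (fat_realisation X)"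
    unfolding topspace_fat_realisation quotient_def by blast
next
  fix U assume "U \<subseteq> topspace (fat_realisation X)"
  then have "U \<subseteq> topspace (fat_coproduct X) // fat_rel X"
    by (simp add: topspace_fat_realisation)
  then show "openin (fat_coproduct X) {p \<in> topspace (fat_coproduct X). fat_rel X `` {p} \<in> U}
      = openin (fat_realisation X) U"
    unfolding fat_realisation_def openin_quotient_topology by simp
qed

text \<open>
  Each summand is open in the sum, so continuity is a local question on each cylinder \<open>Z \<times> X\<^sub>i\<close>.
\<close>

lemma continuous_map_prod_sum_topology:
  assumes "\<And>i. i \<in> I \<Longrightarrow> continuous_map (prod_topology Z (X i)) Y (\<lambda>(z, x). f (z, (i, x)))"
  shows "continuous_map (prod_topology Z (sum_topology X I)) Y f"
  unfolding continuous_map_def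
proof (intro conjI allI impI)
  show "f \<in> topspace (prod_topology Z (sum_topology X I)) \<rightarrow> topspace Y"
    using assms by (fastforce simp: continuous_map_def Pi_iff)
next
  fix U assume U: "openin Y U"
  let ?W = "{p \<in> topspace (prod_topology Z (sum_topology X I)). f p \<in> U}"
  show "openin (prod_topology Z (sum_topology X I)) ?W"
    unfolding openin_prod_topology_alt
  proof (intro allI impI)
    fix z p assume zp: "(z, p) \<in> ?W"
    obtain i x where p: "p = (i, x)" by force
    with zp have ix: "i \<in> I" "x \<in> topspace (X i)" "z \<in> topspace Z" "f (z, (i, x)) \<in> U"
      by auto
    have "openin (prod_topology Z (X i))
        {q \<in> topspace (prod_topology Z (X i)). (\<lambda>(z, x). f (z, (i, x))) q \<in> U}" (is "openin _ ?V")
      using assms[OF ix(1)] U by (rule openin_continuous_map_preimage)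
    moreover have "(z, x) \<in> ?V"
      using ix by simp
    ultimately obtain A B where AB: "openin Z A" "openin (X i) B" "z \<in> A" "x \<in> B" "A \<times> B \<subseteq> ?V"
      unfolding openin_prod_topology_alt by meson
    have "openin (sum_topology X I) (Pair i ` B)"
      using open_map_component_injection[OF ix(1), of X] AB(2) by (simp add: open_map_def)
    moreover have "A \<times> Pair i ` B \<subseteq> ?W"
      using AB(5) ix(1) by auto
    ultimately show "\<exists>A B. openin Z A \<and> openin (sum_topology X I) B \<and> z \<in> A \<and> p \<in> B \<and> A \<times> B \<subseteq> ?W"
      using AB p by blast
  qed
qed

text \<open>
  All maps and homotopies below are instances of this lemma. Local compactness of the parameter space
  \<open>Z\<close> makes \<open>Z \<times> (\<Coprod>X\<^sub>n \<times> \<Delta>\<^sup>n)\<close> \<open>\<rightarrow>\<close> \<open>Z \<times> \<parallel>X\<parallel>\<close> a quotient map, so that continuity can be checked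
  before gluing.
\<close>

lemma continuous_map_fat_realisation_family:
  assumes Z: "locally_compact_space Z" "Hausdorff_space Z"
    and cont: "\<And>n. continuous_map
        (prod_topology Z (prod_topology (level X n)
          (subtopology (powertop_real UNIV) (standard_simplex n))))
        (fat_coproduct Y) (\<lambda>(z, x, t). k z (n, x, t))"
    and glue: "\<And>z p q. z \<in> topspace Z \<Longrightarrow> (p, q) \<in> face_glue X \<Longrightarrow> (k z p, k z q) \<in> fat_rel Y"
  shows "continuous_map (prod_topology Z (fat_realisation X)) (fat_realisation Y)
    (\<lambda>(z, c). \<Union>p\<in>c. fat_rel Y `` {k z p})" (is "continuous_map _ _ ?K")
proof (rule continuous_compose_quotient_map)
  show "quotient_map (prod_topology Z (fat_coproduct X)) (prod_topology Z (fat_realisation X))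
      (\<lambda>(z, p). (z, fat_rel X `` {p}))"
    by (intro quotient_map_prod_right Z disjI1 quotient_map_fat_realisation)
  have "continuous_map (prod_topology Z (fat_coproduct X)) (fat_coproduct Y) (\<lambda>(z, p). k z p)"
    unfolding fat_coproduct_def[of X] 
    by (rule continuous_map_prod_sum_topology) (use cont in \<open>simp add: case_prod_unfold\<close>)
  then have *: "continuous_map (prod_topology Z (fat_coproduct X)) (fat_realisation Y)
      (\<lambda>(z, p). fat_rel Y `` {k z p})"
    using continuous_map_compose[OF _ quotient_imp_continuous_map[OF quotient_map_fat_realisation]]
    by (fastforce simp: o_def case_prod_unfold)
  show "continuous_map (prod_topology Z (fat_coproduct X)) (fat_realisation Y)
      (?K \<circ> (\<lambda>(z, p). (z, fat_rel X `` {p})))"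
  proof (rule continuous_map_eq[OF *])
    fix q assume "q \<in> topspace (prod_topology Z (fat_coproduct X))"
    then obtain z p where q: "q = (z, p)" "z \<in> topspace Z" by auto
    show "(case q of (z, p) \<Rightarrow> fat_rel Y `` {k z p}) = (?K \<circ> (\<lambda>(z, p). (z, fat_rel X `` {p}))) q"
      using UN_fat_rel_class[of X "k z" Y p] glue[OF q(2)] by (simp add: q(1))
  qed
qed

lemma continuous_map_into_fat_coproduct:
  assumes J: "continuous_map W (level Y m) J"
    and l: "\<And>i. continuous_map W euclideanreal (\<lambda>w. l w i)"
    and ls: "\<And>w. w \<in> topspace W \<Longrightarrow> l w \<in> standard_simplex m"
  shows "continuous_map W (fat_coproduct Y) (\<lambda>w. (m, J w, l w))"
proof -
  have "continuous_map W (powertop_real UNIV) l"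
    using l by (simp add: continuous_map_componentwise_UNIV)
  then have "continuous_map W (subtopology (powertop_real UNIV) (standard_simplex m)) l"
    using ls by (auto simp: continuous_map_in_subtopology)
  then have *: "continuous_map W (prod_topology (level Y m)
      (subtopology (powertop_real UNIV) (standard_simplex m))) (\<lambda>w. (J w, l w))"
    using J by (simp add: continuous_map_paired)
  have "continuous_map (prod_topology (level Y m)
      (subtopology (powertop_real UNIV) (standard_simplex m))) (fat_coproduct Y) (Pair m)"
    unfolding fat_coproduct_def
    using continuous_map_component_injection[where i = m and I = UNIV and X = "\<lambda>n. prod_topology (level Y n)
      (subtopology (powertop_real UNIV) (standard_simplex n))"] by simp
  from continuous_map_compose[OF * this] show ?thesis
    by (simp add: o_def)
qed

text \<open>
  A simplicial map required to respect faces only. The fat realisation is functorial for these, and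
  cocycles that are not normalised induce maps of this kind.
\<close>

definition semisimplicial_map :: "'a simplicial_space \<Rightarrow> 'b simplicial_space \<Rightarrow> (nat \<Rightarrow> 'a \<Rightarrow> 'b) \<Rightarrow> bool" where
  "semisimplicial_map X Y f \<longleftrightarrow>
     (\<forall>n. continuous_map (level X n) (level Y n) (f n)) \<and>
     (\<forall>n i. i \<le> Suc n \<longrightarrow> (\<forall>x\<in>topspace (level X (Suc n)).
        f n (pull X n (Suc n) (coface i) x) = pull Y n (Suc n) (coface i) (f (Suc n) x)))"

lemma semisimplicial_map_glue:
  assumes "semisimplicial_map X Y f" and "(p, q) \<in> face_glue X"
  shows "((case p of (n, x, t) \<Rightarrow> (n, f n x, t)), (case q of (n, x, t) \<Rightarrow> (n, f n x, t))) \<in> fat_rel Y"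
proof -
  obtain n i x t where "p = (n, pull X n (Suc n) (coface i) x, t)" "q = (Suc n, x, simplical_face i t)"
    "i \<le> Suc n" "x \<in> topspace (level X (Suc n))" "t \<in> standard_simplex n"
    using assms(2) unfolding face_glue_def by blast
  moreover from this have "f (Suc n) x \<in> topspace (level Y (Suc n))"
    using assms(1) unfolding semisimplicial_map_def continuous_map_def by blast
  ultimately show ?thesis
    using assms(1) unfolding semisimplicial_map_def
    by (intro face_glue_fat_rel) (auto simp: face_glue_def)
qed

lemma fat_map_class:
  assumes "semisimplicial_map X Y f"
  shows "fat_map Y f (fat_rel X `` {(n, x, t)}) = fat_rel Y `` {(n, f n x, t)}"
proof -
  have "fat_map Y f (fat_rel X `` {(n, x, t)})
      = (\<Union>q\<in>fat_rel X `` {(n, x, t)}. fat_rel Y `` {case q of (n, x, t) \<Rightarrow> (n, f n x, t)})"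
    unfolding fat_map_def by (auto split: prod.splits)
  also have "\<dots> = fat_rel Y `` {case (n, x, t) of (n, x, t) \<Rightarrow> (n, f n x, t)}"
    by (rule UN_fat_rel_class) (rule semisimplicial_map_glue[OF assms])
  finally show ?thesis by simp
qed

text \<open>
  The case of a one-point parameter space, for which the point 0 of the real line is used.
\<close>

lemma continuous_map_fat_map:
  assumes f: "semisimplicial_map X Y f"
  shows "continuous_map (fat_realisation X) (fat_realisation Y) (fat_map Y f)"
proof -
  let ?Z = "top_of_set {0::real}"
  let ?k = "\<lambda>(z::real) (n, x, t). (n, f n x, t)"
  have Z: "locally_compact_space ?Z" "Hausdorff_space ?Z"
    by (simp_all add: Hausdorff_space_subtopology compact_imp_locally_compact_space
        compact_space_subtopology)
  have c: "continuous_map (prod_topology ?Z (fat_realisation X)) (fat_realisation Y)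
      (\<lambda>(z, c). \<Union>p\<in>c. fat_rel Y `` {?k z p})"
  proof (rule continuous_map_fat_realisation_family[OF Z])
    fix n
    let ?W = "prod_topology ?Z (prod_topology (level X n)
          (subtopology (powertop_real UNIV) (standard_simplex n)))"
    have "continuous_map ?W (fat_coproduct Y) (\<lambda>w. (n, f n (fst (snd w)), snd (snd w)))"
    proof (rule continuous_map_into_fat_coproduct)
      have "continuous_map ?W (level X n) (\<lambda>w. fst (snd w))"
        by (rule continuous_map_fst_of[unfolded o_def, OF continuous_map_snd])
      moreover have "continuous_map (level X n) (level Y n) (f n)"
        using f by (simp add: semisimplicial_map_def)
      ultimately show "continuous_map ?W (level Y n) (\<lambda>w. f n (fst (snd w)))"
        using continuous_map_compose by (fastforce simp: o_def)
      have "continuous_map ?W (subtopology (powertop_real UNIV) (standard_simplex n)) (\<lambda>w. snd (snd w))"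
        by (rule continuous_map_snd_of[unfolded o_def, OF continuous_map_snd])
      then have "continuous_map ?W (powertop_real UNIV) (\<lambda>w. snd (snd w))"
        by (simp add: continuous_map_in_subtopology)
      then show "continuous_map ?W euclideanreal (\<lambda>w. snd (snd w) i)" for i
        by (simp add: continuous_map_componentwise_UNIV)
    qed auto
    then show "continuous_map ?W (fat_coproduct Y) (\<lambda>(z, x, t). ?k z (n, x, t))"
      by (simp add: case_prod_unfold)
  next
    show "(?k z p, ?k z q) \<in> fat_rel Y" if "(p, q) \<in> face_glue X" for z p q
      using semisimplicial_map_glue[OF f that] by simp
  qed
  have i: "continuous_map (fat_realisation X) (prod_topology ?Z (fat_realisation X)) (\<lambda>c. (0, c))"
    by (simp add: continuous_map_paired)
  have "fat_map Y f = (\<lambda>(z, c). \<Union>p\<in>c. fat_rel Y `` {?k z p}) \<circ> (\<lambda>c. (0, c))"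
    unfolding fat_map_def by (auto simp: fun_eq_iff split: prod.splits)
  then show ?thesis
    using continuous_map_compose[OF i c] by simp
qed

lemma homotopic_fat_realisation:
  assumes cont: "\<And>n. continuous_map
        (prod_topology (top_of_set {0..1}) (prod_topology (level X n)
          (subtopology (powertop_real UNIV) (standard_simplex n))))
        (fat_coproduct Y) (\<lambda>(z, x, t). k z (n, x, t))"
    and glue: "\<And>z p q. z \<in> {0..1} \<Longrightarrow> (p, q) \<in> face_glue X \<Longrightarrow> (k z p, k z q) \<in> fat_rel Y"
    and ends: "\<And>n x t. x \<in> topspace (level X n) \<Longrightarrow> t \<in> standard_simplex n \<Longrightarrow>
        f (fat_rel X `` {(n, x, t)}) = fat_rel Y `` {k (0::real) (n, x, t)} \<and>
        g (fat_rel X `` {(n, x, t)}) = fat_rel Y `` {k 1 (n, x, t)}"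
  shows "homotopic_with (\<lambda>_. True) (fat_realisation X) (fat_realisation Y) f g"
proof -
  let ?I = "top_of_set {0..1::real}"
  let ?h = "\<lambda>(z, c). \<Union>p\<in>c. fat_rel Y `` {k z p}"
  have Z: "locally_compact_space ?I" "Hausdorff_space ?I"
    by (simp_all add: Hausdorff_space_subtopology compact_imp_locally_compact_space
        compact_space_subtopology)
  have h: "continuous_map (prod_topology ?I (fat_realisation X)) (fat_realisation Y) ?h"
    using glue by (intro continuous_map_fat_realisation_family[OF Z cont]) simp
  have "?h (0, c) = f c \<and> ?h (1, c) = g c" if "c \<in> topspace (fat_realisation X)" for c
  proof -
    note top = that
    obtain n x t where c: "c = fat_rel X `` {(n, x, t)}" "x \<in> topspace (level X n)" "t \<in> standard_simplex n"
      using topspace_fat_realisation_cases[OF top] by blast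
    show ?thesis
      using ends[OF c(2,3)] UN_fat_rel_class[of X "k 0" Y "(n, x, t)"]
        UN_fat_rel_class[of X "k 1" Y "(n, x, t)"] glue[of 0] glue[of 1]
      by (simp add: c(1))
  qed
  then have "\<exists>h. continuous_map (prod_topology ?I (fat_realisation X)) (fat_realisation Y) h \<and>
      (\<forall>c\<in>topspace (fat_realisation X). h (0, c) = f c) \<and>
      (\<forall>c\<in>topspace (fat_realisation X). h (1, c) = g c) \<and> (\<forall>t\<in>{0..1::real}. True)"
    using h by (intro exI[of _ ?h]) blast
  then show ?thesis
    by (subst homotopic_with) simp_all
qed

lemma continuous_map_cylinder:
  fixes L :: "'a topology" and S :: "(nat \<Rightarrow> real) set"
  defines "W \<equiv> prod_topology (top_of_set {0..1::real}) (prod_topology L (subtopology (powertop_real UNIV) S))"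
  shows "continuous_map W euclideanreal fst"
    and "continuous_map W L (\<lambda>w. fst (snd w))"
    and "continuous_map W euclideanreal (\<lambda>w. snd (snd w) i)"
proof -
  have "continuous_map W (top_of_set {0..1}) fst"
    unfolding W_def by (rule continuous_map_fst)
  then show "continuous_map W euclideanreal fst"
    by (simp add: continuous_map_in_subtopology)
  show "continuous_map W L (\<lambda>w. fst (snd w))"
    unfolding W_def by (rule continuous_map_fst_of[unfolded o_def, OF continuous_map_snd])
  have "continuous_map W (subtopology (powertop_real UNIV) S) (\<lambda>w. snd (snd w))"
    unfolding W_def by (rule continuous_map_snd_of[unfolded o_def, OF continuous_map_snd])
  then have "continuous_map W (powertop_real UNIV) (\<lambda>w. snd (snd w))"
    by (simp add: continuous_map_in_subtopology)
  then show "continuous_map W euclideanreal (\<lambda>w. snd (snd w) i)"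
    by (simp add: continuous_map_componentwise_UNIV)
qed

section \<open>Simplices of the Duskin nerve from labelled vertices\<close>

text \<open>
  A simplex of the Duskin nerve all of whose entries are read off from labels on its vertices. Faces
  then amount to restricting the labels, and vertices may carry equal labels.
\<close>

definition labelled_simplex ::
  "('l \<Rightarrow> 'l \<Rightarrow> 'g) \<Rightarrow> ('l \<Rightarrow> 'l \<Rightarrow> 'l \<Rightarrow> 'h) \<Rightarrow> nat \<Rightarrow> (nat \<Rightarrow> 'l) \<Rightarrow> ('g, 'h) duskin_simplex" where
  "labelled_simplex A U n v =
     (restrict (\<lambda>(i, j). A (v i) (v j)) (pairs n),
      restrict (\<lambda>(i, j, k). U (v i) (v j) (v k)) (triples n))"

lemma labelled_simplex_cong:
  assumes "\<And>i j. i < j \<Longrightarrow> j \<le> n \<Longrightarrow> A (v i) (v j) = A' (v' i) (v' j)"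
    and "\<And>i j k. i < j \<Longrightarrow> j < k \<Longrightarrow> k \<le> n \<Longrightarrow> U (v i) (v j) (v k) = U' (v' i) (v' j) (v' k)"
  shows "labelled_simplex A U n v = labelled_simplex A' U' n v'"
  unfolding labelled_simplex_def using assms
  by (auto intro!: restrict_ext simp: pairs_def triples_def)

lemma pull_duskin_nerve_labelled:
  assumes "strict_mono_on {..m} \<theta>" and "\<theta> ` {..m} \<subseteq> {..n}"
  shows "pull (duskin_nerve \<G>) m n \<theta> (labelled_simplex A U n v) = labelled_simplex A U m (v \<circ> \<theta>)"
proof -
  have lt: "\<theta> i < \<theta> j" if "i < j" "j \<le> m" for i j
    using assms(1) that by (auto intro: strict_mono_onD)
  have le: "\<theta> i \<le> n" if "i \<le> m" for i
    using assms(2) that by auto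
  show ?thesis
    unfolding labelled_simplex_def duskin_nerve_def
    using lt le by (auto intro!: restrict_ext simp: pairs_def triples_def)
qed

lemma topspace_level_duskin_nerve:
  "topspace (level (duskin_nerve \<G>) n) =
    (PiE (pairs n) (\<lambda>_. topspace (Gtop \<G>)) \<times> PiE (triples n) (\<lambda>_. topspace (Htop \<G>)))
      \<inter> duskin_simplices \<G> n"
  by (simp add: duskin_nerve_def)

text \<open>
  The conditions on a simplex of the Duskin nerve, stated once for all labels. The relation \<open>R\<close> says
  which labels may follow each other; for the join below it makes colours increase.
\<close>

definition crossed_labelling ::
  "('g, 'h) crossed_module \<Rightarrow> ('l \<Rightarrow> 'l \<Rightarrow> bool) \<Rightarrow> ('l \<Rightarrow> 'l \<Rightarrow> 'g) \<Rightarrow> ('l \<Rightarrow> 'l \<Rightarrow> 'l \<Rightarrow> 'h) \<Rightarrow> bool" where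
  "crossed_labelling \<G> R A U \<longleftrightarrow>
     (let G = Ggrp \<G>; H = Hgrp \<G> in
      (\<forall>p q. R p q \<longrightarrow> A p q \<in> carrier G) \<and>
      (\<forall>p q r. R p q \<and> R q r \<longrightarrow> U p q r \<in> carrier H \<and>
         A p q \<otimes>\<^bsub>G\<^esub> A q r = bd \<G> (U p q r) \<otimes>\<^bsub>G\<^esub> A p r) \<and>
      (\<forall>p q r s. R p q \<and> R q r \<and> R r s \<longrightarrow>
         act \<G> (A p q) (U q r s) \<otimes>\<^bsub>H\<^esub> U p q s = U p q r \<otimes>\<^bsub>H\<^esub> U p r s))"

lemma labelled_simplex_in_duskin_nerve:
  assumes cm: "topological_crossed_module \<G>"
    and lab: "crossed_labelling \<G> R A U"
    and v: "\<And>i j. i < j \<Longrightarrow> j \<le> n \<Longrightarrow> R (v i) (v j)"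
  shows "labelled_simplex A U n v \<in> topspace (level (duskin_nerve \<G>) n)"
proof -
  have "topspace (Gtop \<G>) = carrier (Ggrp \<G>)" "topspace (Htop \<G>) = carrier (Hgrp \<G>)"
    using cm by (auto simp: topological_crossed_module_def topological_group_def Let_def)
  moreover have "A (v i) (v j) \<in> carrier (Ggrp \<G>)" if "i < j" "j \<le> n" for i j
    using lab v that by (auto simp: crossed_labelling_def Let_def)
  moreover have "U (v i) (v j) (v k) \<in> carrier (Hgrp \<G>)"
    "A (v i) (v j) \<otimes>\<^bsub>Ggrp \<G>\<^esub> A (v j) (v k) = bd \<G> (U (v i) (v j) (v k)) \<otimes>\<^bsub>Ggrp \<G>\<^esub> A (v i) (v k)"
    if "i < j" "j < k" "k \<le> n" for i j k
    using lab v[of i j] v[of j k] that by (auto simp: crossed_labelling_def Let_def)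
  moreover have "act \<G> (A (v i) (v j)) (U (v j) (v k) (v l)) \<otimes>\<^bsub>Hgrp \<G>\<^esub> U (v i) (v j) (v l)
      = U (v i) (v j) (v k) \<otimes>\<^bsub>Hgrp \<G>\<^esub> U (v i) (v k) (v l)"
    if "i < j" "j < k" "k < l" "l \<le> n" for i j k l
    using lab v[of i j] v[of j k] v[of k l] that by (auto simp: crossed_labelling_def Let_def)
  ultimately show ?thesis
    unfolding topspace_level_duskin_nerve duskin_simplices_def labelled_simplex_def
    by (auto simp: Let_def pairs_def triples_def)
qed

lemma standard_simplex_skip:
  assumes s: "s \<in> standard_simplex (Suc n)" and i: "i \<le> Suc n" "s i = 0"
  shows "s \<circ> coface i \<in> standard_simplex n" "simplical_face i (s \<circ> coface i) = s"
proof -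
  have range: "coface i ` {..n} = {..Suc n} - {i}"
  proof -
    have "k \<in> coface i ` {..n}" if "k \<le> Suc n" "k \<noteq> i" for k
    proof (cases "k < i")
      case True
      then have "coface i k = k" "k \<in> {..n}" using i by (auto simp: coface_def)
      then show ?thesis by (metis imageI)
    next
      case False
      then have "coface i (k - 1) = k" "k - 1 \<in> {..n}" using that by (auto simp: coface_def)
      then show ?thesis by (metis imageI)
    qed
    then show ?thesis by (auto simp: coface_def split: if_splits)
  qed
  have inj: "inj_on (coface i) {..n}"
    by (auto simp: inj_on_def coface_def split: if_splits)
  have "sum (s \<circ> coface i) {..n} = sum s ({..Suc n} - {i})"
    by (simp add: range[symmetric] sum.reindex[OF inj])
  also have "\<dots> = sum s {..Suc n}"
    using i by (intro sum.mono_neutral_left) auto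
  finally show "s \<circ> coface i \<in> standard_simplex n"
    using s i unfolding standard_simplex_def by (auto simp: coface_def)
  show "simplical_face i (s \<circ> coface i) = s"
    using i by (auto simp: fun_eq_iff simplical_face_def coface_def)
qed

lemma strict_mono_on_atMost_self:
  fixes \<theta> :: "nat \<Rightarrow> nat"
  assumes "strict_mono_on {..n} \<theta>" "\<theta> ` {..n} \<subseteq> {..n}" "k \<le> n"
  shows "\<theta> k = k"
proof -
  have lt: "\<theta> i < \<theta> j" if "i < j" "j \<le> n" for i j
    using assms(1) that by (auto intro: strict_mono_onD)
  have lower: "k \<le> \<theta> k" if "k \<le> n" for k
    using that
  proof (induction k)
    case (Suc k)
    then show ?case using lt[of k "Suc k"] by simp
  qed simp
  have upper: "\<theta> (n - d) \<le> n - d" if "d \<le> n" for d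
    using that
  proof (induction d)
    case 0
    then show ?case using assms(2) by auto
  next
    case (Suc d)
    then have "\<theta> (n - Suc d) < \<theta> (n - d)" "\<theta> (n - d) \<le> n - d"
      by (auto intro: lt)
    then show ?case by linarith
  qed
  show ?thesis
    using lower[OF assms(3)] upper[of "n - k"] assms(3) by simp
qed

lemma labelled_point_reindex_self:
  assumes \<theta>: "strict_mono_on {..n} \<theta>" "\<theta> ` {..n} \<subseteq> {..n}"
    and s: "s \<in> standard_simplex n"
    and t: "\<And>k. k \<le> n \<Longrightarrow> t k = s (\<theta> k)" "\<And>k. n < k \<Longrightarrow> t k = 0"
  shows "(n, labelled_simplex A U n (v \<circ> \<theta>), t) = (n, labelled_simplex A U n v, s)"
proof -
  have id: "\<theta> k = k" if "k \<le> n" for k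
    by (rule strict_mono_on_atMost_self[OF \<theta> that])
  have "t k = s k" for k
    using s t(1)[of k] t(2)[of k] id[of k]
    by (cases "k \<le> n") (auto simp: standard_simplex_def)
  then have "t = s" by blast
  moreover have "labelled_simplex A U n (v \<circ> \<theta>) = labelled_simplex A U n v"
    using id by (intro labelled_simplex_cong) auto
  ultimately show ?thesis by (simp only:)
qed

text \<open>
  In the fat realisation, vertices of weight 0 can be dropped, any number at a time. This is the only
  form in which the gluing relation is used for homotopies. The induction removes the vertices
  outside the image of \<open>\<theta>\<close> one by one.
\<close>

lemma fat_rel_labelled_simplex:
  assumes cm: "topological_crossed_module \<G>"
    and lab: "crossed_labelling \<G> R A U"
    and v: "\<And>i j. i < j \<Longrightarrow> j \<le> n \<Longrightarrow> R (v i) (v j)"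
    and \<theta>: "strict_mono_on {..m} \<theta>" "\<theta> ` {..m} \<subseteq> {..n}"
    and s: "s \<in> standard_simplex n" "\<And>j. j \<le> n \<Longrightarrow> j \<notin> \<theta> ` {..m} \<Longrightarrow> s j = 0"
    and t: "\<And>k. k \<le> m \<Longrightarrow> t k = s (\<theta> k)" "\<And>k. m < k \<Longrightarrow> t k = 0"
    and \<sigma>: "\<sigma> = labelled_simplex A U m (v \<circ> \<theta>)"
  shows "((m, \<sigma>, t), (n, labelled_simplex A U n v, s)) \<in> fat_rel (duskin_nerve \<G>)"
  using v \<theta> s t \<sigma>
proof (induction n arbitrary: v \<theta> s)
  case n: (0 v \<theta> s)
  have "\<theta> k = 0" if "k \<le> m" for k
    using n(3) that by (force simp: image_subset_iff)
  then have "\<theta> 0 = \<theta> m"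
    by simp
  then have "m = 0"
    using strict_mono_onD[OF n(2), of 0 m] by auto
  then have "(m, labelled_simplex A U m (v \<circ> \<theta>), t) = (0, labelled_simplex A U 0 v, s)"
    using labelled_point_reindex_self[of 0 \<theta> s t A U v] n by simp
  then show ?case
    unfolding n(8) by (simp only: fat_rel_def rtrancl.rtrancl_refl)
next
  case n: (Suc n v \<theta> s)
  have lt: "\<theta> i < \<theta> j" if "i < j" "j \<le> m" for i j
    using n(3) that by (auto intro: strict_mono_onD)
  show ?case
  proof (cases "m = Suc n")
    case True
    have "(m, labelled_simplex A U m (v \<circ> \<theta>), t) = (Suc n, labelled_simplex A U (Suc n) v, s)"
      using labelled_point_reindex_self[of "Suc n" \<theta> s t A U v] n(3-8) unfolding True by blast
    then show ?thesis
      unfolding n(9) by (simp only: fat_rel_def rtrancl.rtrancl_refl)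
  next
    case False
    have inj: "inj_on \<theta> {..m}"
      using n(3) by (rule strict_mono_on_imp_inj_on)
    have "card {..m} \<le> card {..Suc n}"
      using card_inj_on_le[OF inj n(4)] by simp
    then have "m \<le> n" using False by simp
    have "\<theta> ` {..m} \<noteq> {..Suc n}"
      using card_image[OF inj] \<open>m \<le> n\<close> by (metis card_atMost le_imp_less_Suc less_irrefl nat.inject)
    then obtain i where i: "i \<le> Suc n" "i \<notin> \<theta> ` {..m}"
      using n(4) by auto
    have si: "s i = 0"
      using n(6) i by blast
    \<comment> \<open>\<open>\<theta>\<close> factored through the face that omits \<open>i\<close>\<close>
    define \<theta>' where "\<theta>' k = (if \<theta> k < i then \<theta> k else \<theta> k - 1)" for k
    have c: "coface i (\<theta>' k) = \<theta> k" if "k \<le> m" for k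
    proof -
      have "\<theta> k \<noteq> i" using i that by auto
      then show ?thesis by (auto simp: \<theta>'_def coface_def)
    qed
    have le: "\<theta> k \<le> Suc n" if "k \<le> m" for k
      using n(4) that by auto
    have ne: "\<theta> k \<noteq> i" if "k \<le> m" for k
      using i(2) that by auto
    have "((m, \<sigma>, t), (n, labelled_simplex A U n (v \<circ> coface i), s \<circ> coface i))
        \<in> fat_rel (duskin_nerve \<G>)"
    proof (rule n(1))
      show "R ((v \<circ> coface i) a) ((v \<circ> coface i) b)" if "a < b" "b \<le> n" for a b
        using n(2)[of "coface i a" "coface i b"] that by (auto simp: coface_def)
      show "strict_mono_on {..m} \<theta>'"
      proof (rule strict_mono_onI)
        fix a b assume "a \<in> {..m}" "b \<in> {..m}" "a < b"
        then show "\<theta>' a < \<theta>' b"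
          using lt[of a b] ne[of a] ne[of b] by (auto simp: \<theta>'_def)
      qed
      show "\<theta>' ` {..m} \<subseteq> {..n}"
        using le ne i(1) by (force simp: \<theta>'_def)
      show "s \<circ> coface i \<in> standard_simplex n"
        using standard_simplex_skip(1)[of s n i] n(5) i(1) si by simp
      show "(s \<circ> coface i) j = 0" if "j \<le> n" "j \<notin> \<theta>' ` {..m}" for j
      proof -
        have "coface i j \<notin> \<theta> ` {..m}"
        proof
          assume "coface i j \<in> \<theta> ` {..m}"
          then obtain k where k: "k \<le> m" "coface i j = \<theta> k" by auto
          then have "j = \<theta>' k"
            by (auto simp: coface_def \<theta>'_def split: if_splits)
          then show False using k that by auto
        qed
        then show ?thesis
          using n(6)[of "coface i j"] that by (simp add: coface_def split: if_splits)
      qed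
      show "t k = (s \<circ> coface i) (\<theta>' k)" if "k \<le> m" for k
        using n(7) c that by simp
      show "t k = 0" if "m < k" for k
        using n(8) that by simp
      show "\<sigma> = labelled_simplex A U m ((v \<circ> coface i) \<circ> \<theta>')"
        unfolding n(9) by (rule labelled_simplex_cong) (simp_all add: c)
    qed
    moreover have "((n, labelled_simplex A U n (v \<circ> coface i), s \<circ> coface i),
        (Suc n, labelled_simplex A U (Suc n) v, s)) \<in> face_glue (duskin_nerve \<G>)"
    proof -
      have "pull (duskin_nerve \<G>) n (Suc n) (coface i) (labelled_simplex A U (Suc n) v)
          = labelled_simplex A U n (v \<circ> coface i)"
        by (rule pull_duskin_nerve_labelled) (auto simp: strict_mono_on_def coface_def)
      moreover have "labelled_simplex A U (Suc n) v \<in> topspace (level (duskin_nerve \<G>) (Suc n))"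
        by (rule labelled_simplex_in_duskin_nerve[OF cm lab n(2)])
      ultimately show ?thesis
        using standard_simplex_skip[OF n(5) i(1) si] i(1)
        by (intro face_glueI[where i = i]) simp_all
    qed
    ultimately show ?thesis
      by (blast intro: fat_rel_trans face_glue_fat_rel)
  qed
qed

section \<open>The nerve of a group\<close>

lemma (in group) inv_mult_cancel [simp]:
  "x \<in> carrier G \<Longrightarrow> y \<in> carrier G \<Longrightarrow> inv x \<otimes> (x \<otimes> y) = y"
  "x \<in> carrier G \<Longrightarrow> y \<in> carrier G \<Longrightarrow> x \<otimes> (inv x \<otimes> y) = y"
  by (simp_all flip: m_assoc)

text \<open>
  The simplex \<open>[g\<^sub>1, \<dots>, g\<^sub>n]\<close> in homogeneous form: its vertices are \<open>p\<^sub>i = g\<^sub>1 \<cdots> g\<^sub>i\<close>, and the edge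
  from \<open>i\<close> to \<open>j\<close> is \<open>p\<^sub>i\<inverse>p\<^sub>j\<close>, which makes sense for \<open>i > j\<close> as well.
\<close>

definition vertex :: "'c monoid \<Rightarrow> 'c list \<Rightarrow> nat \<Rightarrow> 'c" where
  "vertex \<Gamma> gs i = seg_prod \<Gamma> gs 0 i"

locale nerve_group = group \<Gamma> for \<Gamma> :: "'c monoid" (structure)
begin

lemma foldr_mult_append:
  "set xs \<subseteq> carrier \<Gamma> \<Longrightarrow> set ys \<subseteq> carrier \<Gamma> \<Longrightarrow>
    foldr (\<otimes>) xs \<one> \<in> carrier \<Gamma> \<and>
    foldr (\<otimes>) (xs @ ys) \<one> = foldr (\<otimes>) xs \<one> \<otimes> foldr (\<otimes>) ys \<one>"
proof (induction xs)
  case Nil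
  have "foldr (\<otimes>) ys \<one> \<in> carrier \<Gamma>"
    using Nil(2) by (induction ys) auto
  then show ?case by simp
next
  case (Cons x xs)
  have "foldr (\<otimes>) ys \<one> \<in> carrier \<Gamma>"
    using Cons(3) by (induction ys) auto
  with Cons show ?case by (auto simp: m_assoc)
qed

lemma seg_prod_closed:
  assumes "set gs \<subseteq> carrier \<Gamma>"
  shows "seg_prod \<Gamma> gs i j \<in> carrier \<Gamma>"
proof -
  have "set (take (j - i) (drop i gs)) \<subseteq> carrier \<Gamma>"
    using assms by (meson order_trans set_drop_subset set_take_subset)
  then show ?thesis
    using foldr_mult_append[of _ "[]"] by (simp add: seg_prod_def)
qed

lemma seg_prod_self [simp]: "seg_prod \<Gamma> gs i i = \<one>"
  by (simp add: seg_prod_def)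

lemma seg_prod_mult:
  assumes gs: "set gs \<subseteq> carrier \<Gamma>" and ijk: "i \<le> j" "j \<le> k"
  shows "seg_prod \<Gamma> gs i j \<otimes> seg_prod \<Gamma> gs j k = seg_prod \<Gamma> gs i k"
proof -
  have sub: "set (take l (drop m gs)) \<subseteq> carrier \<Gamma>" for l m
    using gs by (meson order_trans set_drop_subset set_take_subset)
  have "take (k - i) (drop i gs) = take (j - i) (drop i gs) @ take (k - j) (drop j gs)"
    using ijk take_add[of "j - i" "k - j" "drop i gs"] by simp
  then show ?thesis
    using foldr_mult_append[OF sub sub] by (simp add: seg_prod_def)
qed

lemma seg_prod_pull:
  assumes gs: "set gs \<subseteq> carrier \<Gamma>" and \<theta>: "mono_on {..m} \<theta>" and rs: "r \<le> s" "s \<le> m"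
  shows "seg_prod \<Gamma> (pull (nerve \<Gamma>) m n \<theta> gs) r s = seg_prod \<Gamma> gs (\<theta> r) (\<theta> s)"
proof -
  let ?hs = "pull (nerve \<Gamma>) m n \<theta> gs"
  have hs: "?hs = map (\<lambda>k. seg_prod \<Gamma> gs (\<theta> k) (\<theta> (Suc k))) [0..<m]"
    by (simp add: nerve_def)
  then have sub: "set ?hs \<subseteq> carrier \<Gamma>"
    using seg_prod_closed[OF gs] by auto
  show ?thesis
    using rs
  proof (induction s rule: dec_induct)
    case base
    show ?case by simp
  next
    case (step s)
    have "take 1 (drop s ?hs) = [seg_prod \<Gamma> gs (\<theta> s) (\<theta> (Suc s))]"
      using step by (simp add: hs take_Suc_conv_app_nth flip: drop_map)
    then have "seg_prod \<Gamma> ?hs s (Suc s) = seg_prod \<Gamma> gs (\<theta> s) (\<theta> (Suc s))"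
      using seg_prod_closed[OF gs] by (simp add: seg_prod_def[of \<Gamma> ?hs])
    moreover have "\<theta> r \<le> \<theta> s" "\<theta> s \<le> \<theta> (Suc s)"
      using \<theta> step by (auto intro: mono_onD)
    ultimately show ?case
      using step seg_prod_mult[OF sub, of r s "Suc s"] seg_prod_mult[OF gs, of "\<theta> r" "\<theta> s" "\<theta> (Suc s)"]
      by simp
  qed
qed

lemma vertex_closed: "set gs \<subseteq> carrier \<Gamma> \<Longrightarrow> vertex \<Gamma> gs i \<in> carrier \<Gamma>"
  by (simp add: vertex_def seg_prod_closed)

lemma seg_prod_vertex:
  assumes gs: "set gs \<subseteq> carrier \<Gamma>" and "i \<le> j"
  shows "seg_prod \<Gamma> gs i j = inv (vertex \<Gamma> gs i) \<otimes> vertex \<Gamma> gs j"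
  using seg_prod_mult[OF gs, of 0 i j] assms seg_prod_closed[OF gs]
  unfolding vertex_def by (metis inv_mult_cancel(1) le0)

text \<open>
  The vertices of a face are those of the simplex up to a left translation, which arises because the
  first vertex is always the identity.
\<close>

lemma vertex_pull:
  assumes gs: "set gs \<subseteq> carrier \<Gamma>" and \<theta>: "mono_on {..m} \<theta>" and "k \<le> m"
  shows "vertex \<Gamma> (pull (nerve \<Gamma>) m n \<theta> gs) k = inv (vertex \<Gamma> gs (\<theta> 0)) \<otimes> vertex \<Gamma> gs (\<theta> k)"
proof -
  have "\<theta> 0 \<le> \<theta> k"
    using \<theta> assms(3) by (auto intro: mono_onD)
  then show ?thesis
    using seg_prod_pull[OF gs \<theta>, of 0 k] assms(3) seg_prod_vertex[OF gs]
    by (simp add: vertex_def[of \<Gamma> "pull (nerve \<Gamma>) m n \<theta> gs"])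
qed

lemma topspace_nerve:
  "topspace (level (nerve \<Gamma>) n) = {gs. length gs = n \<and> set gs \<subseteq> carrier \<Gamma>}"
  by (simp add: nerve_def)

lemma continuous_map_nerve_level:
  "continuous_map (level (nerve \<Gamma>) n) Y f \<longleftrightarrow> f \<in> topspace (level (nerve \<Gamma>) n) \<rightarrow> topspace Y"
  by (auto simp: nerve_def continuous_map_def)

end

lemma coface_strict_mono: "strict_mono_on {..n} (coface i)"
  by (auto simp: strict_mono_on_def coface_def)

lemma coface_mono: "mono_on {..n} (coface i)"
  by (auto simp: mono_on_def coface_def)

lemma order_preserving_coface: "i \<le> Suc n \<Longrightarrow> order_preserving n (Suc n) (coface i)"
  by (auto simp: order_preserving_def coface_mono) (auto simp: coface_def)

section \<open>Cocycles with values in a crossed module\<close>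

locale topological_crossed =
  fixes \<G> :: "('g, 'h) crossed_module" (structure)
  assumes cm: "topological_crossed_module \<G>"
begin

abbreviation "G \<equiv> Ggrp \<G>"
abbreviation "H \<equiv> Hgrp \<G>"
abbreviation "d \<equiv> bd \<G>"
abbreviation "a \<equiv> act \<G>"

sublocale G: group "Ggrp \<G>" + H: group "Hgrp \<G>"
  using cm by (auto simp: topological_crossed_module_def topological_group_def Let_def)

lemma bd_hom: "d \<in> hom H G"
  and act_hom: "\<alpha> \<in> carrier G \<Longrightarrow> a \<alpha> \<in> hom H H"
  and act_one [simp]: "u \<in> carrier H \<Longrightarrow> a \<one>\<^bsub>G\<^esub> u = u"
  and act_act: "\<alpha> \<in> carrier G \<Longrightarrow> \<beta> \<in> carrier G \<Longrightarrow> u \<in> carrier H \<Longrightarrow>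
    a (\<alpha> \<otimes>\<^bsub>G\<^esub> \<beta>) u = a \<alpha> (a \<beta> u)"
  and bd_act: "\<alpha> \<in> carrier G \<Longrightarrow> u \<in> carrier H \<Longrightarrow> d (a \<alpha> u) = \<alpha> \<otimes>\<^bsub>G\<^esub> d u \<otimes>\<^bsub>G\<^esub> inv\<^bsub>G\<^esub> \<alpha>"
  and peiffer: "u \<in> carrier H \<Longrightarrow> v \<in> carrier H \<Longrightarrow> a (d u) v = u \<otimes>\<^bsub>H\<^esub> v \<otimes>\<^bsub>H\<^esub> inv\<^bsub>H\<^esub> u"
  using cm by (auto simp: topological_crossed_module_def Let_def)

lemma weakly_Hausdorff_Gtop: "weakly_Hausdorff (Gtop \<G>)"
  and weakly_Hausdorff_Htop: "weakly_Hausdorff (Htop \<G>)"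
  using cm by (auto simp: topological_crossed_module_def topological_group_def cgwh_space_def Let_def)

lemma bd_closed [simp]: "u \<in> carrier H \<Longrightarrow> d u \<in> carrier G"
  using bd_hom by (auto simp: hom_def)

lemma bd_mult: "u \<in> carrier H \<Longrightarrow> v \<in> carrier H \<Longrightarrow> d (u \<otimes>\<^bsub>H\<^esub> v) = d u \<otimes>\<^bsub>G\<^esub> d v"
  using bd_hom by (auto simp: hom_def)

lemma bd_inv: "u \<in> carrier H \<Longrightarrow> d (inv\<^bsub>H\<^esub> u) = inv\<^bsub>G\<^esub> d u"
  using bd_hom by (intro group_hom.hom_inv) (auto simp: group_hom_def group_hom_axioms_def G.is_group H.is_group)

lemma bd_one: "d \<one>\<^bsub>H\<^esub> = \<one>\<^bsub>G\<^esub>"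
  using bd_hom by (intro group_hom.hom_one) (auto simp: group_hom_def group_hom_axioms_def G.is_group H.is_group)

lemma act_closed [simp]: "\<alpha> \<in> carrier G \<Longrightarrow> u \<in> carrier H \<Longrightarrow> a \<alpha> u \<in> carrier H"
  using act_hom by (auto simp: hom_def)

lemma act_mult: "\<alpha> \<in> carrier G \<Longrightarrow> u \<in> carrier H \<Longrightarrow> v \<in> carrier H \<Longrightarrow>
    a \<alpha> (u \<otimes>\<^bsub>H\<^esub> v) = a \<alpha> u \<otimes>\<^bsub>H\<^esub> a \<alpha> v"
  using act_hom by (auto simp: hom_def)

lemma act_group_hom: "\<alpha> \<in> carrier G \<Longrightarrow> group_hom H H (a \<alpha>)"
  using act_hom by (auto simp: group_hom_def group_hom_axioms_def H.is_group)

lemma act_inv: "\<alpha> \<in> carrier G \<Longrightarrow> u \<in> carrier H \<Longrightarrow> a \<alpha> (inv\<^bsub>H\<^esub> u) = inv\<^bsub>H\<^esub> a \<alpha> u"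
  using group_hom.hom_inv[OF act_group_hom] .

lemma act_H_one [simp]: "\<alpha> \<in> carrier G \<Longrightarrow> a \<alpha> \<one>\<^bsub>H\<^esub> = \<one>\<^bsub>H\<^esub>"
  using group_hom.hom_one[OF act_group_hom] .

end

locale crossed_cohomology = topological_crossed \<G> + \<Gamma>: nerve_group \<Gamma>
  for \<G> :: "('g, 'h) crossed_module" and \<Gamma> :: "'c monoid"
begin

lemma Z1_D:
  assumes "(\<alpha>, u) \<in> Z1 \<Gamma> \<G>"
  shows "g \<in> carrier \<Gamma> \<Longrightarrow> \<alpha> g \<in> carrier G"
    and "g \<in> carrier \<Gamma> \<Longrightarrow> h \<in> carrier \<Gamma> \<Longrightarrow> u (g, h) \<in> carrier H"
    and "g \<in> carrier \<Gamma> \<Longrightarrow> h \<in> carrier \<Gamma> \<Longrightarrow>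
      \<alpha> g \<otimes>\<^bsub>G\<^esub> \<alpha> h = d (u (g, h)) \<otimes>\<^bsub>G\<^esub> \<alpha> (g \<otimes>\<^bsub>\<Gamma>\<^esub> h)"
    and "g \<in> carrier \<Gamma> \<Longrightarrow> h \<in> carrier \<Gamma> \<Longrightarrow> k \<in> carrier \<Gamma> \<Longrightarrow>
      a (\<alpha> g) (u (h, k)) \<otimes>\<^bsub>H\<^esub> u (g, h \<otimes>\<^bsub>\<Gamma>\<^esub> k) = u (g, h) \<otimes>\<^bsub>H\<^esub> u (g \<otimes>\<^bsub>\<Gamma>\<^esub> h, k)"
  using assms by (auto simp: Z1_def Let_def)

text \<open>
  The Peiffer identity for \<open>\<alpha>\<^sub>g\<alpha>\<^sub>h = \<partial>(u\<^sub>g\<^sub>,\<^sub>h)\<alpha>\<^sub>g\<^sub>h\<close>: moving \<open>u\<^sub>g\<^sub>,\<^sub>h\<close> past an element acted on by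
  \<open>\<alpha>\<^sub>g\<alpha>\<^sub>h\<close> turns the action into that of \<open>\<alpha>\<^sub>g\<^sub>h\<close>.
\<close>

lemma Z1_act_exchange:
  assumes c: "(\<alpha>, u) \<in> Z1 \<Gamma> \<G>" and gh: "g \<in> carrier \<Gamma>" "h \<in> carrier \<Gamma>" and v: "v \<in> carrier H"
  shows "a (\<alpha> g) (a (\<alpha> h) v) \<otimes>\<^bsub>H\<^esub> u (g, h) = u (g, h) \<otimes>\<^bsub>H\<^esub> a (\<alpha> (g \<otimes>\<^bsub>\<Gamma>\<^esub> h)) v"
proof -
  note [simp] = Z1_D(1,2)[OF c] gh v
  have "a (\<alpha> g) (a (\<alpha> h) v) = a (d (u (g, h)) \<otimes>\<^bsub>G\<^esub> \<alpha> (g \<otimes>\<^bsub>\<Gamma>\<^esub> h)) v"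
    by (simp flip: act_act Z1_D(3)[OF c])
  also have "\<dots> = u (g, h) \<otimes>\<^bsub>H\<^esub> a (\<alpha> (g \<otimes>\<^bsub>\<Gamma>\<^esub> h)) v \<otimes>\<^bsub>H\<^esub> inv\<^bsub>H\<^esub> u (g, h)"
    by (simp add: act_act peiffer)
  finally show ?thesis
    by (simp add: H.m_assoc)
qed

text \<open>
  The relation of being cohomologous with its witnesses \<open>\<gamma>\<close> and \<open>w\<close> made explicit, since the
  homotopy is built from them.
\<close>

definition gauge ::
  "'g \<Rightarrow> ('c \<Rightarrow> 'h) \<Rightarrow> ('c, 'g, 'h) cochain \<Rightarrow> ('c, 'g, 'h) cochain \<Rightarrow> bool" where
  "gauge \<gamma> w c0 c1 \<longleftrightarrow>
     c0 \<in> Z1 \<Gamma> \<G> \<and> c1 \<in> Z1 \<Gamma> \<G> \<and> \<gamma> \<in> carrier G \<and> w \<in> carrier \<Gamma> \<rightarrow> carrier H \<and>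
     (\<forall>g\<in>carrier \<Gamma>. fst c1 g = d (w g) \<otimes>\<^bsub>G\<^esub> \<gamma> \<otimes>\<^bsub>G\<^esub> fst c0 g \<otimes>\<^bsub>G\<^esub> inv\<^bsub>G\<^esub> \<gamma>) \<and>
     (\<forall>g\<in>carrier \<Gamma>. \<forall>h\<in>carrier \<Gamma>.
        snd c1 (g, h) =
          w g \<otimes>\<^bsub>H\<^esub> a \<gamma> (a (fst c0 g) (a (inv\<^bsub>G\<^esub> \<gamma>) (w h)) \<otimes>\<^bsub>H\<^esub> snd c0 (g, h))
            \<otimes>\<^bsub>H\<^esub> inv\<^bsub>H\<^esub> w (g \<otimes>\<^bsub>\<Gamma>\<^esub> h))"

lemma cohomologous_iff_gauge: "(c0, c1) \<in> cohomologous \<Gamma> \<G> \<longleftrightarrow> (\<exists>\<gamma> w. gauge \<gamma> w c0 c1)"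
  by (cases c0; cases c1) (auto simp: cohomologous_def gauge_def Let_def)

lemma cohomologous_refl:
  assumes "c \<in> Z1 \<Gamma> \<G>"
  shows "(c, c) \<in> cohomologous \<Gamma> \<G>"
proof -
  obtain \<alpha> u where c: "c = (\<alpha>, u)" by force
  with assms have "(\<alpha>, u) \<in> Z1 \<Gamma> \<G>" by simp
  note [simp] = Z1_D(1,2)[OF this]
  have "gauge \<one>\<^bsub>G\<^esub> (\<lambda>_. \<one>\<^bsub>H\<^esub>) c c"
    using assms by (simp add: gauge_def c bd_one)
  then show ?thesis
    using cohomologous_iff_gauge by blast
qed

end

section \<open>Gluing cohomologous cocycles into one labelling\<close>

context crossed_cohomology
begin

text \<open>
  Labels are pairs of a colour and a group element. Colour-preserving entries come from the two
  cocycles; an edge from colour 0 to colour 1 is the edge of \<open>c\<^sub>0\<close> followed by \<open>\<gamma>\<inverse>\<close>.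
\<close>

definition join_edge ::
  "'g \<Rightarrow> ('c, 'g, 'h) cochain \<Rightarrow> ('c, 'g, 'h) cochain \<Rightarrow> bool \<times> 'c \<Rightarrow> bool \<times> 'c \<Rightarrow> 'g" where
  "join_edge \<gamma> c0 c1 = (\<lambda>(b, p) (b', q).
     let g = inv\<^bsub>\<Gamma>\<^esub> p \<otimes>\<^bsub>\<Gamma>\<^esub> q
     in if b then fst c1 g else if b' then fst c0 g \<otimes>\<^bsub>G\<^esub> inv\<^bsub>G\<^esub> \<gamma> else fst c0 g)"

definition join_triangle ::
  "'g \<Rightarrow> ('c \<Rightarrow> 'h) \<Rightarrow> ('c, 'g, 'h) cochain \<Rightarrow> ('c, 'g, 'h) cochain \<Rightarrow>
   bool \<times> 'c \<Rightarrow> bool \<times> 'c \<Rightarrow> bool \<times> 'c \<Rightarrow> 'h" where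
  "join_triangle \<gamma> w c0 c1 = (\<lambda>(b, p) (b', q) (b'', r).
     let g = inv\<^bsub>\<Gamma>\<^esub> p \<otimes>\<^bsub>\<Gamma>\<^esub> q; h = inv\<^bsub>\<Gamma>\<^esub> q \<otimes>\<^bsub>\<Gamma>\<^esub> r
     in if b then snd c1 (g, h)
        else if b' then a (fst c0 g) (a (inv\<^bsub>G\<^esub> \<gamma>) (w h)) \<otimes>\<^bsub>H\<^esub> snd c0 (g, h)
        else snd c0 (g, h))"

definition coloured_le :: "bool \<times> 'c \<Rightarrow> bool \<times> 'c \<Rightarrow> bool" where
  "coloured_le = (\<lambda>(b, p) (b', q). b \<le> b' \<and> p \<in> carrier \<Gamma> \<and> q \<in> carrier \<Gamma>)"

text \<open>
  Simplices of constant colour satisfy the cocycle conditions of \<open>c\<^sub>0\<close> or \<open>c\<^sub>1\<close>, and colours 001 and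
  0001 reduce to those of \<open>c\<^sub>0\<close>. The condition for colours 011 on the edges
  follows from the formula for \<open>\<alpha>\<^sup>1\<close>. For colours
  0011 the condition comes down to \<open>Z1_act_exchange\<close>, and for 0111 the formula for \<open>u\<^sup>1\<close> reduces it
  to the case 0011.
\<close>

lemma crossed_labelling_join:
  assumes gauge: "gauge \<gamma> w c0 c1"
  shows "crossed_labelling \<G> coloured_le (join_edge \<gamma> c0 c1) (join_triangle \<gamma> w c0 c1)"
proof -
  obtain \<alpha>0 u0 \<alpha>1 u1 where c: "c0 = (\<alpha>0, u0)" "c1 = (\<alpha>1, u1)" by force
  have Z0: "(\<alpha>0, u0) \<in> Z1 \<Gamma> \<G>" and Z1: "(\<alpha>1, u1) \<in> Z1 \<Gamma> \<G>"
    and \<gamma>: "\<gamma> \<in> carrier G" and w: "g \<in> carrier \<Gamma> \<Longrightarrow> w g \<in> carrier H" for g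
    using gauge by (auto simp: gauge_def c)
  have \<alpha>1: "\<alpha>1 g = d (w g) \<otimes>\<^bsub>G\<^esub> \<gamma> \<otimes>\<^bsub>G\<^esub> \<alpha>0 g \<otimes>\<^bsub>G\<^esub> inv\<^bsub>G\<^esub> \<gamma>" if "g \<in> carrier \<Gamma>" for g
    using gauge that by (auto simp: gauge_def c)
  have u1: "u1 (g, h) = w g \<otimes>\<^bsub>H\<^esub> a \<gamma> (a (\<alpha>0 g) (a (inv\<^bsub>G\<^esub> \<gamma>) (w h)) \<otimes>\<^bsub>H\<^esub> u0 (g, h))
            \<otimes>\<^bsub>H\<^esub> inv\<^bsub>H\<^esub> w (g \<otimes>\<^bsub>\<Gamma>\<^esub> h)" if "g \<in> carrier \<Gamma>" "h \<in> carrier \<Gamma>" for g h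
    using gauge that by (auto simp: gauge_def c)
  note [simp] = Z1_D(1,2)[OF Z0] Z1_D(1,2)[OF Z1] \<gamma> w
  have edge001: "\<alpha>0 g \<otimes>\<^bsub>G\<^esub> (\<alpha>0 h \<otimes>\<^bsub>G\<^esub> inv\<^bsub>G\<^esub> \<gamma>) = d (u0 (g, h)) \<otimes>\<^bsub>G\<^esub> (\<alpha>0 (g \<otimes>\<^bsub>\<Gamma>\<^esub> h) \<otimes>\<^bsub>G\<^esub> inv\<^bsub>G\<^esub> \<gamma>)"
    if "g \<in> carrier \<Gamma>" "h \<in> carrier \<Gamma>" for g h
    using Z1_D(3)[OF Z0 that] that by (simp flip: G.m_assoc)
  have edge011: "\<alpha>0 g \<otimes>\<^bsub>G\<^esub> inv\<^bsub>G\<^esub> \<gamma> \<otimes>\<^bsub>G\<^esub> \<alpha>1 h =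
      d (a (\<alpha>0 g) (a (inv\<^bsub>G\<^esub> \<gamma>) (w h)) \<otimes>\<^bsub>H\<^esub> u0 (g, h)) \<otimes>\<^bsub>G\<^esub> (\<alpha>0 (g \<otimes>\<^bsub>\<Gamma>\<^esub> h) \<otimes>\<^bsub>G\<^esub> inv\<^bsub>G\<^esub> \<gamma>)"
    if "g \<in> carrier \<Gamma>" "h \<in> carrier \<Gamma>" for g h
    using that by (simp add: \<alpha>1 bd_mult bd_act G.m_assoc flip: edge001)
  \<comment> \<open>the condition for colours 0011, with \<open>v\<close> in place of \<open>\<gamma>\<inverse>(w\<^sub>k)\<close>; colours 0111 reduce to it\<close>
  have face0011: "a (\<alpha>0 g) (a (\<alpha>0 h) v \<otimes>\<^bsub>H\<^esub> u0 (h, k)) \<otimes>\<^bsub>H\<^esub> u0 (g, h \<otimes>\<^bsub>\<Gamma>\<^esub> k) =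
      u0 (g, h) \<otimes>\<^bsub>H\<^esub> (a (\<alpha>0 (g \<otimes>\<^bsub>\<Gamma>\<^esub> h)) v \<otimes>\<^bsub>H\<^esub> u0 (g \<otimes>\<^bsub>\<Gamma>\<^esub> h, k))"
    if "g \<in> carrier \<Gamma>" "h \<in> carrier \<Gamma>" "k \<in> carrier \<Gamma>" "v \<in> carrier H" for g h k v
  proof -
    have "a (\<alpha>0 g) (a (\<alpha>0 h) v \<otimes>\<^bsub>H\<^esub> u0 (h, k)) \<otimes>\<^bsub>H\<^esub> u0 (g, h \<otimes>\<^bsub>\<Gamma>\<^esub> k)
        = a (\<alpha>0 g) (a (\<alpha>0 h) v) \<otimes>\<^bsub>H\<^esub> u0 (g, h) \<otimes>\<^bsub>H\<^esub> u0 (g \<otimes>\<^bsub>\<Gamma>\<^esub> h, k)"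
      using that by (simp add: act_mult H.m_assoc Z1_D(4)[OF Z0])
    then show ?thesis
      using that by (simp add: Z1_act_exchange[OF Z0] H.m_assoc)
  qed
  have face0111: "a (\<alpha>0 g \<otimes>\<^bsub>G\<^esub> inv\<^bsub>G\<^esub> \<gamma>) (u1 (h, k)) \<otimes>\<^bsub>H\<^esub>
        (a (\<alpha>0 g) (a (inv\<^bsub>G\<^esub> \<gamma>) (w (h \<otimes>\<^bsub>\<Gamma>\<^esub> k))) \<otimes>\<^bsub>H\<^esub> u0 (g, h \<otimes>\<^bsub>\<Gamma>\<^esub> k)) =
      a (\<alpha>0 g) (a (inv\<^bsub>G\<^esub> \<gamma>) (w h)) \<otimes>\<^bsub>H\<^esub> u0 (g, h) \<otimes>\<^bsub>H\<^esub>
        (a (\<alpha>0 (g \<otimes>\<^bsub>\<Gamma>\<^esub> h)) (a (inv\<^bsub>G\<^esub> \<gamma>) (w k)) \<otimes>\<^bsub>H\<^esub> u0 (g \<otimes>\<^bsub>\<Gamma>\<^esub> h, k))"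
    if "g \<in> carrier \<Gamma>" "h \<in> carrier \<Gamma>" "k \<in> carrier \<Gamma>" for g h k
  proof -
    let ?v = "a (inv\<^bsub>G\<^esub> \<gamma>) (w k)"
    have "a (inv\<^bsub>G\<^esub> \<gamma>) (a \<gamma> x) = x" if "x \<in> carrier H" for x
      using that by (simp flip: act_act)
    then have "a (\<alpha>0 g \<otimes>\<^bsub>G\<^esub> inv\<^bsub>G\<^esub> \<gamma>) (u1 (h, k)) =
        a (\<alpha>0 g) (a (inv\<^bsub>G\<^esub> \<gamma>) (w h)) \<otimes>\<^bsub>H\<^esub> a (\<alpha>0 g) (a (\<alpha>0 h) ?v \<otimes>\<^bsub>H\<^esub> u0 (h, k)) \<otimes>\<^bsub>H\<^esub>
        inv\<^bsub>H\<^esub> a (\<alpha>0 g) (a (inv\<^bsub>G\<^esub> \<gamma>) (w (h \<otimes>\<^bsub>\<Gamma>\<^esub> k)))"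
      using that by (simp add: act_act u1 act_mult[of "inv\<^bsub>G\<^esub> \<gamma>"] act_mult[of "\<alpha>0 g" "_ \<otimes>\<^bsub>H\<^esub> _"]
          act_mult[of "\<alpha>0 g" "a (inv\<^bsub>G\<^esub> \<gamma>) _"] act_inv)
    then have "a (\<alpha>0 g \<otimes>\<^bsub>G\<^esub> inv\<^bsub>G\<^esub> \<gamma>) (u1 (h, k)) \<otimes>\<^bsub>H\<^esub>
        (a (\<alpha>0 g) (a (inv\<^bsub>G\<^esub> \<gamma>) (w (h \<otimes>\<^bsub>\<Gamma>\<^esub> k))) \<otimes>\<^bsub>H\<^esub> u0 (g, h \<otimes>\<^bsub>\<Gamma>\<^esub> k)) =
        a (\<alpha>0 g) (a (inv\<^bsub>G\<^esub> \<gamma>) (w h)) \<otimes>\<^bsub>H\<^esub>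
          (a (\<alpha>0 g) (a (\<alpha>0 h) ?v \<otimes>\<^bsub>H\<^esub> u0 (h, k)) \<otimes>\<^bsub>H\<^esub> u0 (g, h \<otimes>\<^bsub>\<Gamma>\<^esub> k))"
      using that by (simp add: H.m_assoc)
    then show ?thesis
      using that by (simp add: face0011 H.m_assoc)
  qed
  have diff: "inv\<^bsub>\<Gamma>\<^esub> p \<otimes>\<^bsub>\<Gamma>\<^esub> r = (inv\<^bsub>\<Gamma>\<^esub> p \<otimes>\<^bsub>\<Gamma>\<^esub> q) \<otimes>\<^bsub>\<Gamma>\<^esub> (inv\<^bsub>\<Gamma>\<^esub> q \<otimes>\<^bsub>\<Gamma>\<^esub> r)"
    if "p \<in> carrier \<Gamma>" "q \<in> carrier \<Gamma>" "r \<in> carrier \<Gamma>" for p q r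
    using that by (simp add: \<Gamma>.m_assoc)
  show ?thesis
    unfolding crossed_labelling_def Let_def
  proof (intro conjI allI impI)
    fix p q assume "coloured_le p q"
    then show "join_edge \<gamma> c0 c1 p q \<in> carrier (Ggrp \<G>)"
      by (auto simp: coloured_le_def join_edge_def c Let_def split: prod.splits)
  next
    fix p q r assume R: "coloured_le p q \<and> coloured_le q r"
    obtain bp bq br xp xq xr where x: "p = (bp, xp)" "q = (bq, xq)" "r = (br, xr)"
      by (metis surj_pair)
    have xc: "xp \<in> carrier \<Gamma>" "xq \<in> carrier \<Gamma>" "xr \<in> carrier \<Gamma>" and b: "bp \<le> bq" "bq \<le> br"
      using R by (auto simp: coloured_le_def x)
    show "join_triangle \<gamma> w c0 c1 p q r \<in> carrier (Hgrp \<G>)"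
      using xc by (simp add: x join_triangle_def c Let_def)
    show "join_edge \<gamma> c0 c1 p q \<otimes>\<^bsub>Ggrp \<G>\<^esub> join_edge \<gamma> c0 c1 q r =
        bd \<G> (join_triangle \<gamma> w c0 c1 p q r) \<otimes>\<^bsub>Ggrp \<G>\<^esub> join_edge \<gamma> c0 c1 p r"
      unfolding x join_edge_def join_triangle_def c Let_def case_prod_conv fst_conv snd_conv diff[OF xc]
      using xc b edge001 edge011 Z1_D(3)[OF Z0] Z1_D(3)[OF Z1]
      by (cases bp; cases bq; cases br) simp_all
  next
    fix p q r s assume R: "coloured_le p q \<and> coloured_le q r \<and> coloured_le r s"
    obtain bp bq br bs xp xq xr xs where
      x: "p = (bp, xp)" "q = (bq, xq)" "r = (br, xr)" "s = (bs, xs)"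
      by (metis surj_pair)
    have xc: "xp \<in> carrier \<Gamma>" "xq \<in> carrier \<Gamma>" "xr \<in> carrier \<Gamma>" "xs \<in> carrier \<Gamma>"
      and b: "bp \<le> bq" "bq \<le> br" "br \<le> bs"
      using R by (auto simp: coloured_le_def x)
    show "act \<G> (join_edge \<gamma> c0 c1 p q) (join_triangle \<gamma> w c0 c1 q r s) \<otimes>\<^bsub>Hgrp \<G>\<^esub>
          join_triangle \<gamma> w c0 c1 p q s =
        join_triangle \<gamma> w c0 c1 p q r \<otimes>\<^bsub>Hgrp \<G>\<^esub> join_triangle \<gamma> w c0 c1 p r s"
      unfolding x join_edge_def join_triangle_def c Let_def case_prod_conv fst_conv snd_conv
        diff[OF xc(1,2,3)] diff[OF xc(2,3,4)]
      using xc b Z1_D(4)[OF Z0] Z1_D(4)[OF Z1] face0011 face0111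
      by (cases bp; cases bq; cases br; cases bs) simp_all
  qed
qed

end

section \<open>The homotopy between cohomologous cocycles\<close>

text \<open>
  The coordinates \<open>((1 - s) t, s t)\<close> on the join of two copies of an \<open>n\<close>-simplex.
\<close>

definition join_weights :: "nat \<Rightarrow> real \<Rightarrow> (nat \<Rightarrow> real) \<Rightarrow> nat \<Rightarrow> real" where
  "join_weights n s t i = (if i \<le> n then (1 - s) * t i else s * t (i - Suc n))"

text \<open>
  The coordinates \<open>((1 - s) t, s)\<close> on the cone over an \<open>n\<close>-simplex.
\<close>

definition cone_weights :: "nat \<Rightarrow> real \<Rightarrow> (nat \<Rightarrow> real) \<Rightarrow> nat \<Rightarrow> real" where
  "cone_weights n s t i = (if i \<le> n then (1 - s) * t i else if i = Suc n then s else 0)"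

lemma join_weights_in_simplex:
  assumes s: "s \<in> {0..1}" and t: "t \<in> standard_simplex n"
  shows "join_weights n s t \<in> standard_simplex (2 * n + 1)"
proof -
  have t01: "0 \<le> t i" "t i \<le> 1" and t0: "n < i \<Longrightarrow> t i = 0" and t1: "sum t {..n} = 1" for i
    using t by (auto simp: standard_simplex_def)
  have "{..2 * n + 1} = {..n} \<union> (\<lambda>i. i + Suc n) ` {..n}"
  proof -
    have "i \<in> {..n} \<union> (\<lambda>i. i + Suc n) ` {..n}" if "i \<le> 2 * n + 1" for i
    proof (cases "i \<le> n")
      case False
      then have "i = i - Suc n + Suc n" "i - Suc n \<in> {..n}"
        using that by auto
      then show ?thesis by blast
    qed simp
    then show ?thesis by auto
  qed
  then have "sum (join_weights n s t) {..2 * n + 1}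
      = sum (join_weights n s t) {..n} + sum (join_weights n s t) ((\<lambda>i. i + Suc n) ` {..n})"
    by (simp only:) (rule sum.union_disjoint; auto)
  also have "sum (join_weights n s t) ((\<lambda>i. i + Suc n) ` {..n}) = sum (\<lambda>i. s * t i) {..n}"
    by (subst sum.reindex) (auto simp: join_weights_def inj_on_def)
  also have "sum (join_weights n s t) {..n} = sum (\<lambda>i. (1 - s) * t i) {..n}"
    by (intro sum.cong) (auto simp: join_weights_def)
  finally have "sum (join_weights n s t) {..2 * n + 1} = 1"
    by (simp add: t1 flip: sum_distrib_left)
  moreover have "join_weights n s t i = 0" if "2 * n + 1 < i" for i
    using that t0 by (simp add: join_weights_def)
  moreover have "0 \<le> join_weights n s t i \<and> join_weights n s t i \<le> 1" for i
    using s t01 by (auto simp: join_weights_def intro!: mult_le_one)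
  ultimately show ?thesis
    by (simp add: standard_simplex_def)
qed

lemma cone_weights_in_simplex:
  assumes s: "s \<in> {0..1}" and t: "t \<in> standard_simplex n"
  shows "cone_weights n s t \<in> standard_simplex (Suc n)"
proof -
  have t01: "0 \<le> t i" "t i \<le> 1" and t1: "sum t {..n} = 1" for i
    using t by (auto simp: standard_simplex_def)
  have "sum (cone_weights n s t) {..n} = sum (\<lambda>i. (1 - s) * t i) {..n}"
    by (intro sum.cong) (auto simp: cone_weights_def)
  then have "sum (cone_weights n s t) {..Suc n} = 1"
    by (simp add: t1 cone_weights_def flip: sum_distrib_left)
  moreover have "0 \<le> cone_weights n s t i \<and> cone_weights n s t i \<le> 1" for i
    using s t01 by (auto simp: cone_weights_def intro!: mult_le_one)
  ultimately show ?thesis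
    by (simp add: standard_simplex_def cone_weights_def)
qed

context crossed_cohomology
begin

lemma cocycle_map_eq_join:
  assumes gs: "gs \<in> topspace (level (nerve \<Gamma>) n)"
  shows "(\<And>i. i \<le> n \<Longrightarrow> v i = (False, vertex \<Gamma> gs i)) \<Longrightarrow>
      labelled_simplex (join_edge \<gamma> c0 c1) (join_triangle \<gamma> w c0 c1) n v = cocycle_map \<Gamma> c0 n gs"
    and "(\<And>i. i \<le> n \<Longrightarrow> v i = (True, vertex \<Gamma> gs i)) \<Longrightarrow>
      labelled_simplex (join_edge \<gamma> c0 c1) (join_triangle \<gamma> w c0 c1) n v = cocycle_map \<Gamma> c1 n gs"
proof -
  have sub: "set gs \<subseteq> carrier \<Gamma>"
    using gs by (simp add: \<Gamma>.topspace_nerve)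
  show "labelled_simplex (join_edge \<gamma> c0 c1) (join_triangle \<gamma> w c0 c1) n v = cocycle_map \<Gamma> c0 n gs"
    if "\<And>i. i \<le> n \<Longrightarrow> v i = (False, vertex \<Gamma> gs i)"
    unfolding labelled_simplex_def cocycle_map_def
    by (auto intro!: restrict_ext simp: pairs_def triples_def that join_edge_def join_triangle_def
        Let_def \<Gamma>.seg_prod_vertex[OF sub])
  show "labelled_simplex (join_edge \<gamma> c0 c1) (join_triangle \<gamma> w c0 c1) n v = cocycle_map \<Gamma> c1 n gs"
    if "\<And>i. i \<le> n \<Longrightarrow> v i = (True, vertex \<Gamma> gs i)"
    unfolding labelled_simplex_def cocycle_map_def
    by (auto intro!: restrict_ext simp: pairs_def triples_def that join_edge_def join_triangle_def
        Let_def \<Gamma>.seg_prod_vertex[OF sub])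
qed

lemma cocycle_map_in_duskin_nerve:
  assumes c: "c \<in> Z1 \<Gamma> \<G>" and gs: "gs \<in> topspace (level (nerve \<Gamma>) n)"
  shows "cocycle_map \<Gamma> c n gs \<in> topspace (level (duskin_nerve \<G>) n)"
proof -
  obtain \<gamma> w where "gauge \<gamma> w c c"
    using cohomologous_refl[OF c] cohomologous_iff_gauge by blast
  then have lab: "crossed_labelling \<G> coloured_le (join_edge \<gamma> c c) (join_triangle \<gamma> w c c)"
    by (rule crossed_labelling_join)
  have sub: "set gs \<subseteq> carrier \<Gamma>"
    using gs by (simp add: \<Gamma>.topspace_nerve)
  let ?v = "\<lambda>i. (False, vertex \<Gamma> gs i)"
  have "labelled_simplex (join_edge \<gamma> c c) (join_triangle \<gamma> w c c) n ?v
      \<in> topspace (level (duskin_nerve \<G>) n)"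
    by (rule labelled_simplex_in_duskin_nerve[OF cm lab])
      (simp add: coloured_le_def \<Gamma>.vertex_closed[OF sub])
  then show ?thesis
    using cocycle_map_eq_join(1)[OF gs, of ?v \<gamma> c c w] by simp
qed

text \<open>
  A degeneracy creates edges labelled by the identity of \<open>\<Gamma>\<close>. The nerve of \<open>\<G>\<close> has 1 there, and this
  is where normalisation enters; for injective \<open>\<theta>\<close> no such edges occur.
\<close>

lemma cocycle_map_pull:
  assumes \<theta>: "order_preserving m n \<theta>"
    and deg: "strict_mono_on {..m} \<theta> \<or> c \<in> normalised_Z1 \<Gamma> \<G>"
    and gs: "gs \<in> topspace (level (nerve \<Gamma>) n)"
  shows "cocycle_map \<Gamma> c m (pull (nerve \<Gamma>) m n \<theta> gs) = pull (duskin_nerve \<G>) m n \<theta> (cocycle_map \<Gamma> c n gs)"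
proof -
  have sub: "set gs \<subseteq> carrier \<Gamma>"
    using gs by (simp add: \<Gamma>.topspace_nerve)
  have mono: "mono_on {..m} \<theta>" and le: "i \<le> m \<Longrightarrow> \<theta> i \<le> n" for i
    using \<theta> by (auto simp: order_preserving_def)
  have seg: "seg_prod \<Gamma> (pull (nerve \<Gamma>) m n \<theta> gs) r s = seg_prod \<Gamma> gs (\<theta> r) (\<theta> s)"
    if "r < s" "s \<le> m" for r s
    using \<Gamma>.seg_prod_pull[OF sub mono] that by simp
  have eq: "fst c \<one>\<^bsub>\<Gamma>\<^esub> = \<one>\<^bsub>G\<^esub> \<and> (\<forall>g\<in>carrier \<Gamma>. snd c (g, \<one>\<^bsub>\<Gamma>\<^esub>) = \<one>\<^bsub>H\<^esub> \<and> snd c (\<one>\<^bsub>\<Gamma>\<^esub>, g) = \<one>\<^bsub>H\<^esub>)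
      \<and> \<theta> r = \<theta> s" if "r < s" "s \<le> m" "\<not> \<theta> r < \<theta> s" for r s
  proof -
    have "\<theta> r \<le> \<theta> s"
      using mono_onD[OF mono, of r s] that by simp
    moreover have "c \<in> normalised_Z1 \<Gamma> \<G>"
      using deg that strict_mono_onD[of "{..m}" \<theta> r s] by auto
    ultimately show ?thesis
      using that by (auto simp: normalised_Z1_def)
  qed
  note closed [simp] = \<Gamma>.seg_prod_closed[OF sub]
  have edge: "fst c (seg_prod \<Gamma> gs (\<theta> r) (\<theta> s)) = \<one>\<^bsub>G\<^esub>"
    if "r < s" "s \<le> m" "\<not> \<theta> r < \<theta> s" for r s
    using eq[OF that] by auto
  have triangle: "snd c (seg_prod \<Gamma> gs (\<theta> r) (\<theta> s), seg_prod \<Gamma> gs (\<theta> s) (\<theta> t)) = \<one>\<^bsub>H\<^esub>"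
    if "r < s" "s < t" "t \<le> m" "\<not> (\<theta> r < \<theta> s \<and> \<theta> s < \<theta> t)" for r s t
    using eq[of r s] eq[of s t] that by (cases "\<theta> r < \<theta> s") auto
  have "pull (duskin_nerve \<G>) m n \<theta> (\<alpha>, u) =
         (restrict (\<lambda>(r, s). if \<theta> r < \<theta> s then \<alpha> (\<theta> r, \<theta> s) else \<one>\<^bsub>G\<^esub>) (pairs m),
          restrict (\<lambda>(r, s, t). if \<theta> r < \<theta> s \<and> \<theta> s < \<theta> t then u (\<theta> r, \<theta> s, \<theta> t)
                               else \<one>\<^bsub>H\<^esub>) (triples m))" for \<alpha> u
    by (simp add: duskin_nerve_def)
  then show ?thesis
    unfolding cocycle_map_def
    using le edge triangle
    by (auto intro!: restrict_ext simp: pairs_def triples_def seg)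
qed

lemma simplicial_map_cocycle_map:
  assumes c: "c \<in> normalised_Z1 \<Gamma> \<G>"
  shows "simplicial_map (nerve \<Gamma>) (duskin_nerve \<G>) (cocycle_map \<Gamma> c)"
proof -
  have "c \<in> Z1 \<Gamma> \<G>"
    using c by (auto simp: normalised_Z1_def)
  then show ?thesis
    unfolding simplicial_map_def \<Gamma>.continuous_map_nerve_level
    using cocycle_map_in_duskin_nerve cocycle_map_pull c by blast
qed

lemma semisimplicial_map_cocycle_map:
  assumes "c \<in> Z1 \<Gamma> \<G>"
  shows "semisimplicial_map (nerve \<Gamma>) (duskin_nerve \<G>) (cocycle_map \<Gamma> c)"
  unfolding semisimplicial_map_def \<Gamma>.continuous_map_nerve_level
  using assms cocycle_map_in_duskin_nerve cocycle_map_pull order_preserving_coface coface_strict_mono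
  by blast

abbreviation cocycle_realisation ::
  "('c, 'g, 'h) cochain \<Rightarrow> 'c list fat_pt set \<Rightarrow> ('g, 'h) duskin_simplex fat_pt set" where
  "cocycle_realisation c \<equiv> fat_map (duskin_nerve \<G>) (cocycle_map \<Gamma> c)"

definition join_vertices :: "nat \<Rightarrow> 'c list \<Rightarrow> nat \<Rightarrow> bool \<times> 'c" where
  "join_vertices n gs i = (n < i, vertex \<Gamma> gs (if i \<le> n then i else i - Suc n))"

lemma coloured_le_join_vertices:
  "set gs \<subseteq> carrier \<Gamma> \<Longrightarrow> i < j \<Longrightarrow> coloured_le (join_vertices n gs i) (join_vertices n gs j)"
  by (auto simp: coloured_le_def join_vertices_def \<Gamma>.vertex_closed)

text \<open>
  The entries of the join depend on quotients \<open>p\<inverse>q\<close> only. This absorbs the translation in \<open>vertex_pull\<close>.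
\<close>

lemma join_translate:
  assumes "x \<in> carrier \<Gamma>" "snd p \<in> carrier \<Gamma>" "snd q \<in> carrier \<Gamma>" "snd r \<in> carrier \<Gamma>"
  shows "join_edge \<gamma> c0 c1 (fst p, x \<otimes>\<^bsub>\<Gamma>\<^esub> snd p) (fst q, x \<otimes>\<^bsub>\<Gamma>\<^esub> snd q) = join_edge \<gamma> c0 c1 p q"
    and "join_triangle \<gamma> w c0 c1 (fst p, x \<otimes>\<^bsub>\<Gamma>\<^esub> snd p) (fst q, x \<otimes>\<^bsub>\<Gamma>\<^esub> snd q) (fst r, x \<otimes>\<^bsub>\<Gamma>\<^esub> snd r)
      = join_triangle \<gamma> w c0 c1 p q r"
proof -
  have "inv\<^bsub>\<Gamma>\<^esub> (x \<otimes>\<^bsub>\<Gamma>\<^esub> a) \<otimes>\<^bsub>\<Gamma>\<^esub> (x \<otimes>\<^bsub>\<Gamma>\<^esub> b) = inv\<^bsub>\<Gamma>\<^esub> a \<otimes>\<^bsub>\<Gamma>\<^esub> b" if "a \<in> carrier \<Gamma>" "b \<in> carrier \<Gamma>" for a b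
    using assms(1) that by (simp add: \<Gamma>.inv_mult_group \<Gamma>.m_assoc)
  then show "join_edge \<gamma> c0 c1 (fst p, x \<otimes>\<^bsub>\<Gamma>\<^esub> snd p) (fst q, x \<otimes>\<^bsub>\<Gamma>\<^esub> snd q) = join_edge \<gamma> c0 c1 p q"
    "join_triangle \<gamma> w c0 c1 (fst p, x \<otimes>\<^bsub>\<Gamma>\<^esub> snd p) (fst q, x \<otimes>\<^bsub>\<Gamma>\<^esub> snd q) (fst r, x \<otimes>\<^bsub>\<Gamma>\<^esub> snd r)
      = join_triangle \<gamma> w c0 c1 p q r"
    using assms by (auto simp: join_edge_def join_triangle_def Let_def split: prod.splits)
qed

text \<open>
  The injection \<open>[2n+1] \<rightarrow> [2n+3]\<close> that omits both copies of the vertex \<open>i\<close>.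
\<close>

definition join_coface :: "nat \<Rightarrow> nat \<Rightarrow> nat \<Rightarrow> nat" where
  "join_coface n i k = (if k \<le> n then coface i k else Suc (Suc n) + coface i (k - Suc n))"

lemma join_simplex_face:
  assumes gs: "gs \<in> topspace (level (nerve \<Gamma>) (Suc n))" and i: "i \<le> Suc n"
  shows "labelled_simplex (join_edge \<gamma> c0 c1) (join_triangle \<gamma> w c0 c1) (2 * n + 1)
        (join_vertices n (pull (nerve \<Gamma>) n (Suc n) (coface i) gs))
      = labelled_simplex (join_edge \<gamma> c0 c1) (join_triangle \<gamma> w c0 c1) (2 * n + 1)
        (join_vertices (Suc n) gs \<circ> join_coface n i)"
proof -
  have sub: "set gs \<subseteq> carrier \<Gamma>"
    using gs by (simp add: \<Gamma>.topspace_nerve)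
  let ?x = "inv\<^bsub>\<Gamma>\<^esub> vertex \<Gamma> gs (coface i 0)"
  let ?v = "join_vertices (Suc n) gs \<circ> join_coface n i"
  have lab: "join_vertices n (pull (nerve \<Gamma>) n (Suc n) (coface i) gs) k = (fst (?v k), ?x \<otimes>\<^bsub>\<Gamma>\<^esub> snd (?v k))"
    if "k \<le> 2 * n + 1" for k
  proof -
    have "(if k \<le> n then k else k - Suc n) \<le> n"
      using that by auto
    note vertex = \<Gamma>.vertex_pull[OF sub coface_mono this, where n = "Suc n"]
    show ?thesis
      unfolding join_vertices_def[of n] vertex
      using that by (auto simp: join_vertices_def join_coface_def coface_def)
  qed
  have closed: "snd (?v k) \<in> carrier \<Gamma>" "?x \<in> carrier \<Gamma>" for k
    using \<Gamma>.vertex_closed[OF sub] by (auto simp: join_vertices_def)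
  show ?thesis
  proof (rule labelled_simplex_cong)
    fix a b assume "a < b" "b \<le> 2 * n + 1"
    then have "a \<le> 2 * n + 1" by simp
    note ab = lab[OF this] lab[OF \<open>b \<le> 2 * n + 1\<close>]
    show "join_edge \<gamma> c0 c1 (join_vertices n (pull (nerve \<Gamma>) n (Suc n) (coface i) gs) a)
        (join_vertices n (pull (nerve \<Gamma>) n (Suc n) (coface i) gs) b) = join_edge \<gamma> c0 c1 (?v a) (?v b)"
      unfolding ab by (rule join_translate(1)[OF closed(2,1,1,1)])
  next
    fix a b e assume "a < b" "b < e" "e \<le> 2 * n + 1"
    then have "a \<le> 2 * n + 1" "b \<le> 2 * n + 1" by simp_all
    note abe = lab[OF this(1)] lab[OF this(2)] lab[OF \<open>e \<le> 2 * n + 1\<close>]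
    show "join_triangle \<gamma> w c0 c1 (join_vertices n (pull (nerve \<Gamma>) n (Suc n) (coface i) gs) a)
        (join_vertices n (pull (nerve \<Gamma>) n (Suc n) (coface i) gs) b)
        (join_vertices n (pull (nerve \<Gamma>) n (Suc n) (coface i) gs) e)
        = join_triangle \<gamma> w c0 c1 (?v a) (?v b) (?v e)"
      unfolding abe by (rule join_translate(2)[OF closed(2,1,1,1)])
  qed
qed

text \<open>
  At time \<open>s\<close> the point \<open>t\<close> of a simplex sits at \<open>((1 - s) t, s t)\<close> in the join. Wherever a
  coordinate of \<open>t\<close> vanishes, so do both of its copies, which gives compatibility with faces. At
  \<open>s = 0\<close> the weights of colour 1 vanish, and dropping these vertices leaves the simplex of \<open>c\<^sub>0\<close>;
  at \<open>s = 1\<close> the same happens with the colours exchanged.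
\<close>

lemma cohomologous_imp_homotopic:
  assumes coh: "(c0, c1) \<in> cohomologous \<Gamma> \<G>"
  shows "homotopic_with (\<lambda>_. True) (B \<Gamma>) (BD \<G>) (cocycle_realisation c0) (cocycle_realisation c1)"
proof -
  obtain \<gamma> w where g: "gauge \<gamma> w c0 c1"
    using coh cohomologous_iff_gauge by blast
  have Z: "c0 \<in> Z1 \<Gamma> \<G>" "c1 \<in> Z1 \<Gamma> \<G>"
    using g by (auto simp: gauge_def)
  note lab = crossed_labelling_join[OF g]
  define J where "J = labelled_simplex (join_edge \<gamma> c0 c1) (join_triangle \<gamma> w c0 c1)"
  define k where "k s = (\<lambda>(n, gs, t). (2 * n + 1, J (2 * n + 1) (join_vertices n gs), join_weights n s t))"
    for s :: real
  have sub: "set gs \<subseteq> carrier \<Gamma>" if "gs \<in> topspace (level (nerve \<Gamma>) n)" for n gs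
    using that by (simp add: \<Gamma>.topspace_nerve)
  have Jtop: "J (2 * n + 1) (join_vertices n gs) \<in> topspace (level (duskin_nerve \<G>) (2 * n + 1))"
    if "gs \<in> topspace (level (nerve \<Gamma>) n)" for n gs
    unfolding J_def
    by (rule labelled_simplex_in_duskin_nerve[OF cm lab]) (rule coloured_le_join_vertices[OF sub[OF that]])
  have reindex: "((m, \<sigma>, t'), k s (n, gs, t)) \<in> fat_rel (duskin_nerve \<G>)"
    if "gs \<in> topspace (level (nerve \<Gamma>) n)" "s \<in> {0..1}" "t \<in> standard_simplex n"
      "strict_mono_on {..m} \<theta>" "\<theta> ` {..m} \<subseteq> {..2 * n + 1}"
      "\<And>j. j \<le> 2 * n + 1 \<Longrightarrow> j \<notin> \<theta> ` {..m} \<Longrightarrow> join_weights n s t j = 0"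
      "\<And>k. k \<le> m \<Longrightarrow> t' k = join_weights n s t (\<theta> k)" "\<And>k. m < k \<Longrightarrow> t' k = 0"
      "\<sigma> = J m (join_vertices n gs \<circ> \<theta>)" for m \<sigma> t' s n gs t \<theta>
    unfolding k_def prod.case J_def
    by (rule fat_rel_labelled_simplex[OF cm lab coloured_le_join_vertices[OF sub[OF that(1)]]
          that(4,5) join_weights_in_simplex[OF that(2,3)] that(6,7,8) that(9)[unfolded J_def]])
  show ?thesis
  proof (rule homotopic_fat_realisation)
    fix n
    let ?W = "prod_topology (top_of_set {0..1::real}) (prod_topology (level (nerve \<Gamma>) n)
          (subtopology (powertop_real UNIV) (standard_simplex n)))"
    have "continuous_map ?W (fat_coproduct (duskin_nerve \<G>))
        (\<lambda>y. (2 * n + 1, J (2 * n + 1) (join_vertices n (fst (snd y))), join_weights n (fst y) (snd (snd y))))"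
    proof (rule continuous_map_into_fat_coproduct)
      have "continuous_map (level (nerve \<Gamma>) n) (level (duskin_nerve \<G>) (2 * n + 1))
          (\<lambda>gs. J (2 * n + 1) (join_vertices n gs))"
        unfolding \<Gamma>.continuous_map_nerve_level using Jtop by blast
      then show "continuous_map ?W (level (duskin_nerve \<G>) (2 * n + 1))
          (\<lambda>y. J (2 * n + 1) (join_vertices n (fst (snd y))))"
        by (rule continuous_map_compose[OF continuous_map_cylinder(2), unfolded o_def])
      show "continuous_map ?W euclideanreal (\<lambda>y. join_weights n (fst y) (snd (snd y)) i)" for i
        by (cases "i \<le> n") (simp_all add: join_weights_def continuous_map_real_mult
            continuous_map_diff continuous_map_cylinder)
      show "join_weights n (fst y) (snd (snd y)) \<in> standard_simplex (2 * n + 1)" if "y \<in> topspace ?W" for y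
        using that by (intro join_weights_in_simplex) auto
    qed
    then show "continuous_map ?W (fat_coproduct (duskin_nerve \<G>)) (\<lambda>(z, x, t). k z (n, x, t))"
      by (simp add: k_def case_prod_unfold)
  next
    fix s :: real and p q assume s: "s \<in> {0..1}" and pq: "(p, q) \<in> face_glue (nerve \<Gamma>)"
    obtain n i gs t where p: "p = (n, pull (nerve \<Gamma>) n (Suc n) (coface i) gs, t)"
      and q: "q = (Suc n, gs, simplical_face i t)"
      and i: "i \<le> Suc n" and gs: "gs \<in> topspace (level (nerve \<Gamma>) (Suc n))" and t: "t \<in> standard_simplex n"
      using pq unfolding face_glue_def by blast
    have t': "simplical_face i t \<in> standard_simplex (Suc n)"
      using simplical_face_in_standard_simplex[of "Suc n" i t] i t by simp
    have surj: "j \<in> join_coface n i ` {..2 * n + 1}"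
      if "j \<le> 2 * Suc n + 1" "j \<noteq> i" "j \<noteq> Suc (Suc n) + i" for j
    proof -
      \<comment> \<open>the preimage of \<open>j\<close>, counted down past the omitted copies below it\<close>
    define l where "l = (if j \<le> Suc n then if j < i then j else j - 1 else if j < Suc (Suc n) + i then j - 1 else j - 2)"
      have "l \<le> 2 * n + 1" "join_coface n i l = j"
        using that i by (auto simp: l_def join_coface_def coface_def split: if_splits)
      then show ?thesis by (metis atMost_iff imageI)
    qed
    show "(k s p, k s q) \<in> fat_rel (duskin_nerve \<G>)"
      unfolding p q k_def[of s] prod.case
    proof (rule reindex[where \<theta> = "join_coface n i", OF gs s t', unfolded k_def prod.case])
      show "strict_mono_on {..2 * n + 1} (join_coface n i)"
        using i by (auto simp: strict_mono_on_def join_coface_def coface_def)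
      show "join_coface n i ` {..2 * n + 1} \<subseteq> {..2 * Suc n + 1}"
        by (auto simp: join_coface_def coface_def)
      show "join_weights (Suc n) s (simplical_face i t) j = 0"
        if "j \<le> 2 * Suc n + 1" "j \<notin> join_coface n i ` {..2 * n + 1}" for j
      proof -
        have "j = i \<or> j = Suc (Suc n) + i"
          using surj that by blast
        then show ?thesis
          using i by (auto simp: join_weights_def simplical_face_def)
      qed
      show "join_weights n s t l = join_weights (Suc n) s (simplical_face i t) (join_coface n i l)" for l
        by (auto simp: join_weights_def join_coface_def simplical_face_def coface_def)
      show "join_weights n s t l = 0" if "2 * n + 1 < l" for l
        using join_weights_in_simplex[OF s t] that by (auto simp: standard_simplex_def)
      show "J (2 * n + 1) (join_vertices n (pull (nerve \<Gamma>) n (Suc n) (coface i) gs))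
          = J (2 * n + 1) (join_vertices (Suc n) gs \<circ> join_coface n i)"
        unfolding J_def by (rule join_simplex_face[OF gs i])
    qed
  next
    fix n gs t assume gs: "gs \<in> topspace (level (nerve \<Gamma>) n)" and t: "t \<in> standard_simplex n"
    have t0: "t i = 0" if "n < i" for i
      using t that by (simp add: standard_simplex_def)
    have "((n, cocycle_map \<Gamma> c0 n gs, t), k 0 (n, gs, t)) \<in> fat_rel (duskin_nerve \<G>)"
    proof (rule reindex[where \<theta> = id, OF gs _ t])
      show "cocycle_map \<Gamma> c0 n gs = J n (join_vertices n gs \<circ> id)"
        unfolding J_def by (rule cocycle_map_eq_join(1)[OF gs, symmetric]) (simp add: join_vertices_def)
    qed (auto simp: join_weights_def t0 strict_mono_on_def)
    moreover have "((n, cocycle_map \<Gamma> c1 n gs, t), k 1 (n, gs, t)) \<in> fat_rel (duskin_nerve \<G>)"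
    proof (rule reindex[where \<theta> = "\<lambda>i. Suc n + i", OF gs _ t])
      show "cocycle_map \<Gamma> c1 n gs = J n (join_vertices n gs \<circ> (\<lambda>i. Suc n + i))"
        unfolding J_def by (rule cocycle_map_eq_join(2)[OF gs, symmetric]) (simp add: join_vertices_def)
      show "join_weights n 1 t j = 0" if "j \<le> 2 * n + 1" "j \<notin> (\<lambda>i. Suc n + i) ` {..n}" for j
      proof (cases "j \<le> n")
        case False
        then have "j = Suc n + (j - Suc n)" "j - Suc n \<in> {..n}"
          using that(1) by auto
        then show ?thesis using that(2) by blast
      qed (simp add: join_weights_def)
    qed (auto simp: join_weights_def t0 strict_mono_on_def)
    ultimately show "cocycle_realisation c0 (fat_rel (nerve \<Gamma>) `` {(n, gs, t)}) =
          fat_rel (duskin_nerve \<G>) `` {k 0 (n, gs, t)} \<and>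
        cocycle_realisation c1 (fat_rel (nerve \<Gamma>) `` {(n, gs, t)}) =
          fat_rel (duskin_nerve \<G>) `` {k 1 (n, gs, t)}"
      using fat_map_class[OF semisimplicial_map_cocycle_map] Z fat_rel_class_eq by metis
  qed
qed

end

section \<open>The trivial cocycle\<close>

context crossed_cohomology
begin

definition unit_simplex :: "nat \<Rightarrow> ('g, 'h) duskin_simplex" where
  "unit_simplex n = labelled_simplex (\<lambda>_ _. \<one>\<^bsub>G\<^esub>) (\<lambda>_ _ _. \<one>\<^bsub>H\<^esub>) n (\<lambda>_. ())"

lemma trivial_cocycle_normalised: "trivial_cocycle \<Gamma> \<G> \<in> normalised_Z1 \<Gamma> \<G>"
  by (auto simp: normalised_Z1_def Z1_def trivial_cocycle_def Let_def bd_one)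

lemma cocycle_map_trivial:
  assumes "gs \<in> topspace (level (nerve \<Gamma>) n)"
  shows "cocycle_map \<Gamma> (trivial_cocycle \<Gamma> \<G>) n gs = unit_simplex n"
proof -
  have "seg_prod \<Gamma> gs i j \<in> carrier \<Gamma>" for i j
    using assms by (intro \<Gamma>.seg_prod_closed) (simp add: \<Gamma>.topspace_nerve)
  then show ?thesis
    unfolding cocycle_map_def unit_simplex_def labelled_simplex_def trivial_cocycle_def
    by (auto intro!: restrict_ext)
qed

text \<open>
  The map is not constant on the nose, as the fat realisation does not collapse degenerate simplices.
  Every \<open>n\<close>-simplex goes to the unit simplex of dimension \<open>n\<close>; the homotopy adds one more vertex and
  slides towards it.
\<close>

lemma homotopic_trivial_constant:
  "homotopic_with (\<lambda>_. True) (B \<Gamma>) (BD \<G>) (cocycle_realisation (trivial_cocycle \<Gamma> \<G>)) (\<lambda>_. BD_vertex \<G>)"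
proof -
  have Z: "trivial_cocycle \<Gamma> \<G> \<in> Z1 \<Gamma> \<G>"
    using trivial_cocycle_normalised by (auto simp: normalised_Z1_def)
  have lab: "crossed_labelling \<G> (\<lambda>_ _. True) (\<lambda>_ _. \<one>\<^bsub>G\<^esub>) (\<lambda>_ _ _. \<one>\<^bsub>H\<^esub>)"
    by (simp add: crossed_labelling_def Let_def bd_one)
  define k where "k s = (\<lambda>(n, gs::'c list, t). (Suc n, unit_simplex (Suc n), cone_weights n s t))"
    for s :: real
  have unit_top: "unit_simplex n \<in> topspace (level (duskin_nerve \<G>) n)" for n
    unfolding unit_simplex_def by (rule labelled_simplex_in_duskin_nerve[OF cm lab]) simp
  have reindex: "((m, unit_simplex m, t'), k s (n, gs, t)) \<in> fat_rel (duskin_nerve \<G>)"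
    if "s \<in> {0..1}" "t \<in> standard_simplex n"
      "strict_mono_on {..m} \<theta>" "\<theta> ` {..m} \<subseteq> {..Suc n}"
      "\<And>j. j \<le> Suc n \<Longrightarrow> j \<notin> \<theta> ` {..m} \<Longrightarrow> cone_weights n s t j = 0"
      "\<And>k. k \<le> m \<Longrightarrow> t' k = cone_weights n s t (\<theta> k)" "\<And>k. m < k \<Longrightarrow> t' k = 0" for m t' s n gs t \<theta>
    unfolding k_def prod.case unit_simplex_def[of "Suc n"]
    by (rule fat_rel_labelled_simplex[OF cm lab TrueI
          that(3,4) cone_weights_in_simplex[OF that(1,2)] that(5,6,7)]) (simp_all add: unit_simplex_def o_def)
  show ?thesis
  proof (rule homotopic_fat_realisation)
    fix n
    let ?W = "prod_topology (top_of_set {0..1::real}) (prod_topology (level (nerve \<Gamma>) n)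
          (subtopology (powertop_real UNIV) (standard_simplex n)))"
    have "continuous_map ?W (fat_coproduct (duskin_nerve \<G>))
        (\<lambda>y. (Suc n, unit_simplex (Suc n), cone_weights n (fst y) (snd (snd y))))"
    proof (rule continuous_map_into_fat_coproduct)
      show "continuous_map ?W (level (duskin_nerve \<G>) (Suc n)) (\<lambda>y. unit_simplex (Suc n))"
        using unit_top by simp
      show "continuous_map ?W euclideanreal (\<lambda>y. cone_weights n (fst y) (snd (snd y)) i)" for i
        by (cases "i \<le> n"; cases "i = Suc n") (simp_all add: cone_weights_def continuous_map_real_mult
            continuous_map_diff continuous_map_cylinder)
      show "cone_weights n (fst y) (snd (snd y)) \<in> standard_simplex (Suc n)" if "y \<in> topspace ?W" for y
        using that by (intro cone_weights_in_simplex) auto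
    qed
    then show "continuous_map ?W (fat_coproduct (duskin_nerve \<G>)) (\<lambda>(z, x, t). k z (n, x, t))"
      by (simp add: k_def case_prod_unfold)
  next
    fix s :: real and p q assume s: "s \<in> {0..1}" and pq: "(p, q) \<in> face_glue (nerve \<Gamma>)"
    obtain n i gs t where p: "p = (n, pull (nerve \<Gamma>) n (Suc n) (coface i) gs, t)"
      and q: "q = (Suc n, gs, simplical_face i t)"
      and i: "i \<le> Suc n" and t: "t \<in> standard_simplex n"
      using pq unfolding face_glue_def by blast
    have t': "simplical_face i t \<in> standard_simplex (Suc n)"
      using simplical_face_in_standard_simplex[of "Suc n" i t] i t by simp
    show "(k s p, k s q) \<in> fat_rel (duskin_nerve \<G>)"
      unfolding p q k_def[of s] prod.case
    proof (rule reindex[of s "simplical_face i t" "Suc n" _ "coface i", OF s t', unfolded k_def prod.case])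
      show "strict_mono_on {..Suc n} (coface i)"
        by (rule coface_strict_mono)
      show "coface i ` {..Suc n} \<subseteq> {..Suc (Suc n)}"
        by (auto simp: coface_def)
      show "cone_weights (Suc n) s (simplical_face i t) j = 0"
        if "j \<le> Suc (Suc n)" "j \<notin> coface i ` {..Suc n}" for j
      proof -
        have "coface i (if j < i then j else j - 1) = j" "(if j < i then j else j - 1) \<in> {..Suc n}" if "j \<noteq> i"
          using that \<open>j \<le> Suc (Suc n)\<close> i by (auto simp: coface_def)
        then have "j = i"
          using that(2) by (metis imageI)
        then show ?thesis
          using i by (simp add: cone_weights_def simplical_face_def)
      qed
      show "cone_weights n s t l = cone_weights (Suc n) s (simplical_face i t) (coface i l)" for l
        using i by (auto simp: cone_weights_def simplical_face_def coface_def)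
      show "cone_weights n s t l = 0" if "Suc n < l" for l
        using that by (simp add: cone_weights_def)
    qed
  next
    fix n gs t assume gs: "gs \<in> topspace (level (nerve \<Gamma>) n)" and t: "t \<in> standard_simplex n"
    have t0: "t i = 0" if "n < i" for i
      using t that by (simp add: standard_simplex_def)
    have start: "((n, unit_simplex n, t), k 0 (n, gs, t)) \<in> fat_rel (duskin_nerve \<G>)"
      by (rule reindex[of 0 t n n id t gs, OF _ t]) (auto simp: cone_weights_def t0 strict_mono_on_def)
    have finish: "((0, unit_simplex 0, \<lambda>i. if i = 0 then 1 else 0), k 1 (n, gs, t)) \<in> fat_rel (duskin_nerve \<G>)"
      by (rule reindex[of 1 t n 0 "\<lambda>_. Suc n" "\<lambda>i. if i = 0 then 1 else 0" gs, OF _ t]) (auto simp: cone_weights_def strict_mono_on_def)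
    have vertex: "unit_simplex 0 = (\<lambda>_. undefined, \<lambda>_. undefined)"
      by (auto simp: unit_simplex_def labelled_simplex_def pairs_def triples_def fun_eq_iff)
    show "cocycle_realisation (trivial_cocycle \<Gamma> \<G>) (fat_rel (nerve \<Gamma>) `` {(n, gs, t)}) =
          fat_rel (duskin_nerve \<G>) `` {k 0 (n, gs, t)} \<and>
        BD_vertex \<G> = fat_rel (duskin_nerve \<G>) `` {k 1 (n, gs, t)}"
      unfolding BD_vertex_def fat_map_class[OF semisimplicial_map_cocycle_map[OF Z]] cocycle_map_trivial[OF gs]
      using fat_rel_class_eq[OF start] fat_rel_class_eq[OF finish[unfolded vertex]] by (rule conjI)
  qed
qed

end

section \<open>Normalisation and the map on classes\<close>

lemma htpy_class_eq:
  "homotopic_with (\<lambda>_. True) X Y f g \<Longrightarrow> htpy_class X Y f = htpy_class X Y g"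
  unfolding htpy_class_def homotopy_rel_def
  by (auto intro: homotopic_with_trans homotopic_with_symD)

lemma htpy_class_self: "continuous_map X Y f \<Longrightarrow> f \<in> htpy_class X Y f"
  by (simp add: htpy_class_def homotopy_rel_def)

context crossed_cohomology
begin

text \<open>
  With \<open>e = u(1, 1)\<close>, the cocycle conditions at the identity force \<open>\<alpha>(1) = \<partial>(e)\<close>, \<open>u(1, k) = e\<close>,
  and that \<open>u(g, 1)\<close> is \<open>\<alpha>(g)\<close> acting on \<open>e\<close>.
  Changing the cocycle by \<open>\<gamma> = 1\<close> and the constant function \<open>w = e\<inverse>\<close> therefore
  normalises it.
\<close>

lemma ex_normalised_cohomologous:
  assumes c: "c \<in> Z1 \<Gamma> \<G>"
  shows "\<exists>c' \<in> normalised_Z1 \<Gamma> \<G>. (c, c') \<in> cohomologous \<Gamma> \<G>"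
proof -
  obtain \<alpha> u where \<alpha>u: "c = (\<alpha>, u)" by force
  have Z: "(\<alpha>, u) \<in> Z1 \<Gamma> \<G>" using c \<alpha>u by simp
  note [simp] = Z1_D(1,2)[OF Z]
  define e where "e = u (\<one>\<^bsub>\<Gamma>\<^esub>, \<one>\<^bsub>\<Gamma>\<^esub>)"
  have e [simp]: "e \<in> carrier H" by (simp add: e_def)
  define \<alpha>' where "\<alpha>' = restrict (\<lambda>g. inv\<^bsub>G\<^esub> d e \<otimes>\<^bsub>G\<^esub> \<alpha> g) (carrier \<Gamma>)"
  define u' where "u' = restrict (\<lambda>(g, h). inv\<^bsub>H\<^esub> e \<otimes>\<^bsub>H\<^esub> (a (\<alpha> g) (inv\<^bsub>H\<^esub> e) \<otimes>\<^bsub>H\<^esub> (u (g, h) \<otimes>\<^bsub>H\<^esub> e)))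
    (carrier \<Gamma> \<times> carrier \<Gamma>)"
  have alpha_one: "\<alpha> \<one>\<^bsub>\<Gamma>\<^esub> = d e"
  proof -
    have "\<alpha> \<one>\<^bsub>\<Gamma>\<^esub> \<otimes>\<^bsub>G\<^esub> \<alpha> \<one>\<^bsub>\<Gamma>\<^esub> = d e \<otimes>\<^bsub>G\<^esub> \<alpha> \<one>\<^bsub>\<Gamma>\<^esub>"
      using Z1_D(3)[OF Z, of "\<one>\<^bsub>\<Gamma>\<^esub>" "\<one>\<^bsub>\<Gamma>\<^esub>"] by (simp add: e_def)
    then show ?thesis by simp
  qed
  have u_left: "u (\<one>\<^bsub>\<Gamma>\<^esub>, k) = e" if "k \<in> carrier \<Gamma>" for k
  proof -
    have "a (d e) (u (\<one>\<^bsub>\<Gamma>\<^esub>, k)) \<otimes>\<^bsub>H\<^esub> u (\<one>\<^bsub>\<Gamma>\<^esub>, k) = e \<otimes>\<^bsub>H\<^esub> u (\<one>\<^bsub>\<Gamma>\<^esub>, k)"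
      using Z1_D(4)[OF Z, of "\<one>\<^bsub>\<Gamma>\<^esub>" "\<one>\<^bsub>\<Gamma>\<^esub>" k] that by (simp add: alpha_one e_def)
    then have "e \<otimes>\<^bsub>H\<^esub> u (\<one>\<^bsub>\<Gamma>\<^esub>, k) \<otimes>\<^bsub>H\<^esub> inv\<^bsub>H\<^esub> e = e"
      using that by (simp add: peiffer)
    then have "e \<otimes>\<^bsub>H\<^esub> u (\<one>\<^bsub>\<Gamma>\<^esub>, k) = e \<otimes>\<^bsub>H\<^esub> e"
      using that by (metis H.inv_solve_right' H.m_closed Z1_D(2)[OF Z] \<Gamma>.one_closed e)
    then show ?thesis
      using that by simp
  qed
  have u_right: "u (g, \<one>\<^bsub>\<Gamma>\<^esub>) = a (\<alpha> g) e" if "g \<in> carrier \<Gamma>" for g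
    using Z1_D(4)[OF Z, of g "\<one>\<^bsub>\<Gamma>\<^esub>" "\<one>\<^bsub>\<Gamma>\<^esub>"] that by (simp add: e_def)
  have Z': "(\<alpha>', u') \<in> Z1 \<Gamma> \<G>"
  proof -
    have edge: "\<alpha>' g \<otimes>\<^bsub>G\<^esub> \<alpha>' h = d (u' (g, h)) \<otimes>\<^bsub>G\<^esub> \<alpha>' (g \<otimes>\<^bsub>\<Gamma>\<^esub> h)"
      if "g \<in> carrier \<Gamma>" "h \<in> carrier \<Gamma>" for g h
      using that by (simp add: \<alpha>'_def u'_def bd_mult bd_inv bd_act G.m_assoc flip: Z1_D(3)[OF Z])
    have triangle: "a (\<alpha>' g) (u' (h, k)) \<otimes>\<^bsub>H\<^esub> u' (g, h \<otimes>\<^bsub>\<Gamma>\<^esub> k) = u' (g, h) \<otimes>\<^bsub>H\<^esub> u' (g \<otimes>\<^bsub>\<Gamma>\<^esub> h, k)"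
      if g: "g \<in> carrier \<Gamma>" and h: "h \<in> carrier \<Gamma>" and k: "k \<in> carrier \<Gamma>" for g h k
    proof -
      have conj: "a (\<alpha>' g) x = inv\<^bsub>H\<^esub> e \<otimes>\<^bsub>H\<^esub> (a (\<alpha> g) x \<otimes>\<^bsub>H\<^esub> e)" if "x \<in> carrier H" for x
        using that g peiffer[of "inv\<^bsub>H\<^esub> e" "a (\<alpha> g) x"]
        by (simp add: \<alpha>'_def act_act H.m_assoc flip: bd_inv)
      have "a (\<alpha>' g) (u' (h, k)) \<otimes>\<^bsub>H\<^esub> u' (g, h \<otimes>\<^bsub>\<Gamma>\<^esub> k) =
          inv\<^bsub>H\<^esub> e \<otimes>\<^bsub>H\<^esub> (a (\<alpha> g) (inv\<^bsub>H\<^esub> e) \<otimes>\<^bsub>H\<^esub> (a (\<alpha> g) (a (\<alpha> h) (inv\<^bsub>H\<^esub> e)) \<otimes>\<^bsub>H\<^esub>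
          (a (\<alpha> g) (u (h, k)) \<otimes>\<^bsub>H\<^esub> u (g, h \<otimes>\<^bsub>\<Gamma>\<^esub> k) \<otimes>\<^bsub>H\<^esub> e)))"
        using g h k by (simp add: conj u'_def act_mult act_inv H.m_assoc)
      also have "\<dots> = inv\<^bsub>H\<^esub> e \<otimes>\<^bsub>H\<^esub> (a (\<alpha> g) (inv\<^bsub>H\<^esub> e) \<otimes>\<^bsub>H\<^esub>
          (a (\<alpha> g) (a (\<alpha> h) (inv\<^bsub>H\<^esub> e)) \<otimes>\<^bsub>H\<^esub> u (g, h) \<otimes>\<^bsub>H\<^esub> (u (g \<otimes>\<^bsub>\<Gamma>\<^esub> h, k) \<otimes>\<^bsub>H\<^esub> e)))"
        using g h k by (simp add: Z1_D(4)[OF Z] H.m_assoc)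
      also have "\<dots> = u' (g, h) \<otimes>\<^bsub>H\<^esub> u' (g \<otimes>\<^bsub>\<Gamma>\<^esub> h, k)"
        using g h k by (simp add: Z1_act_exchange[OF Z] u'_def H.m_assoc)
      finally show ?thesis .
    qed
    have "\<alpha>' \<in> carrier \<Gamma> \<rightarrow>\<^sub>E carrier G" "u' \<in> carrier \<Gamma> \<times> carrier \<Gamma> \<rightarrow>\<^sub>E carrier H"
      by (auto simp: \<alpha>'_def u'_def)
    then show ?thesis
      unfolding Z1_def Let_def using edge triangle by blast
  qed
  have "(\<alpha>', u') \<in> normalised_Z1 \<Gamma> \<G>"
    using Z' by (simp add: normalised_Z1_def \<alpha>'_def u'_def alpha_one u_left u_right act_inv peiffer H.m_assoc)
  moreover have "gauge \<one>\<^bsub>G\<^esub> (\<lambda>_. inv\<^bsub>H\<^esub> e) c (\<alpha>', u')"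
    using Z Z' unfolding gauge_def \<alpha>u by (simp add: \<alpha>'_def u'_def bd_inv H.m_assoc)
  ultimately show ?thesis
    using cohomologous_iff_gauge by blast
qed

lemma coh_class_subset: "c' \<in> coh_class \<Gamma> \<G> c \<Longrightarrow> c' \<in> Z1 \<Gamma> \<G>"
  by (auto simp: coh_class_def cohomologous_def Let_def)

text \<open>
  The sets occurring in the pullback and pushforward of classes are unions of this form, indexed by
  images of a whole class. It is enough to compare the realisation of each index with one map: normalised
  members of the union are then taken care of by \<open>cohomologous_imp_homotopic\<close>.
\<close>

lemma classifying_map_eqI:
  assumes "\<exists>c\<in>I. c \<in> Z1 \<Gamma> \<G>"
    and hom: "\<And>c. c \<in> I \<Longrightarrow> homotopic_with (\<lambda>_. True) (B \<Gamma>) (BD \<G>) (cocycle_realisation c) f"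
  shows "classifying_map \<Gamma> \<G> (\<Union>c\<in>I. coh_class \<Gamma> \<G> c) = htpy_class (B \<Gamma>) (BD \<G>) f"
  unfolding classifying_map_def
proof -
  obtain c1 where c1: "c1 \<in> (\<Union>c\<in>I. coh_class \<Gamma> \<G> c) \<inter> normalised_Z1 \<Gamma> \<G>"
    using assms(1) ex_normalised_cohomologous unfolding coh_class_def by blast
  show "(\<Union>c\<in>(\<Union>c\<in>I. coh_class \<Gamma> \<G> c) \<inter> normalised_Z1 \<Gamma> \<G>.
      htpy_class (B \<Gamma>) (BD \<G>) (cocycle_realisation c)) = htpy_class (B \<Gamma>) (BD \<G>) f"
  proof (rule UN_constant_eq[OF c1 ballI])
    fix c' assume "c' \<in> (\<Union>c\<in>I. coh_class \<Gamma> \<G> c) \<inter> normalised_Z1 \<Gamma> \<G>"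
    then obtain c where c: "c \<in> I" "(c, c') \<in> cohomologous \<Gamma> \<G>"
      by (auto simp: coh_class_def)
    show "htpy_class (B \<Gamma>) (BD \<G>) (cocycle_realisation c') = htpy_class (B \<Gamma>) (BD \<G>) f"
      using cohomologous_imp_homotopic[OF c(2)] hom[OF c(1)]
      by (metis htpy_class_eq)
  qed
qed

lemma continuous_map_cocycle_realisation:
  "c \<in> Z1 \<Gamma> \<G> \<Longrightarrow> continuous_map (B \<Gamma>) (BD \<G>) (cocycle_realisation c)"
  by (rule continuous_map_fat_map[OF semisimplicial_map_cocycle_map])

lemma classifying_map_coh_class:
  assumes "c \<in> Z1 \<Gamma> \<G>"
  shows "classifying_map \<Gamma> \<G> (coh_class \<Gamma> \<G> c) = htpy_class (B \<Gamma>) (BD \<G>) (cocycle_realisation c)"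
  using classifying_map_eqI[of "{c}" "cocycle_realisation c"] assms continuous_map_cocycle_realisation
  by simp

lemma H1_cases:
  assumes "x \<in> H1 \<Gamma> \<G>"
  obtains c where "c \<in> Z1 \<Gamma> \<G>" "x = coh_class \<Gamma> \<G> c"
  using assms by (auto simp: H1_def quotient_def coh_class_def)

end

section \<open>Naturality in the group\<close>

lemma seg_prod_hom:
  assumes \<psi>: "\<psi> \<in> hom \<Gamma>' \<Gamma>" and "group \<Gamma>'" "group \<Gamma>" and gs: "set gs \<subseteq> carrier \<Gamma>'"
  shows "seg_prod \<Gamma> (map \<psi> gs) i j = \<psi> (seg_prod \<Gamma>' gs i j)"
proof -
  interpret A: nerve_group \<Gamma>' using assms by (simp add: nerve_group_def)
  interpret B: nerve_group \<Gamma> using assms by (simp add: nerve_group_def)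
  interpret h: group_hom \<Gamma>' \<Gamma> \<psi>
    using \<psi> A.is_group B.is_group by (simp add: group_hom_def group_hom_axioms_def)
  have "foldr (\<otimes>\<^bsub>\<Gamma>\<^esub>) (map \<psi> hs) \<one>\<^bsub>\<Gamma>\<^esub> = \<psi> (foldr (\<otimes>\<^bsub>\<Gamma>'\<^esub>) hs \<one>\<^bsub>\<Gamma>'\<^esub>)
      \<and> foldr (\<otimes>\<^bsub>\<Gamma>'\<^esub>) hs \<one>\<^bsub>\<Gamma>'\<^esub> \<in> carrier \<Gamma>'" if "set hs \<subseteq> carrier \<Gamma>'" for hs
    using that by (induction hs) auto
  moreover have "set (take (j - i) (drop i gs)) \<subseteq> carrier \<Gamma>'"
    using gs by (meson order_trans set_drop_subset set_take_subset)
  ultimately show ?thesis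
    by (simp add: seg_prod_def take_map drop_map)
qed

lemma semisimplicial_map_nerve_map:
  assumes \<psi>: "\<psi> \<in> hom \<Gamma>' \<Gamma>" and "group \<Gamma>'" "group \<Gamma>"
  shows "semisimplicial_map (nerve \<Gamma>') (nerve \<Gamma>) (nerve_map \<psi>)"
proof -
  interpret A: nerve_group \<Gamma>' using assms by (simp add: nerve_group_def)
  interpret B: nerve_group \<Gamma> using assms by (simp add: nerve_group_def)
  have "nerve_map \<psi> n gs \<in> topspace (level (nerve \<Gamma>) n)" if "gs \<in> topspace (level (nerve \<Gamma>') n)" for n gs
    using that \<psi> by (auto simp: A.topspace_nerve B.topspace_nerve nerve_map_def hom_def)
  moreover have "nerve_map \<psi> n (pull (nerve \<Gamma>') n (Suc n) (coface i) gs)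
      = pull (nerve \<Gamma>) n (Suc n) (coface i) (nerve_map \<psi> (Suc n) gs)"
    if "gs \<in> topspace (level (nerve \<Gamma>') (Suc n))" for n i gs
  proof -
    have "set gs \<subseteq> carrier \<Gamma>'"
      using that by (simp add: A.topspace_nerve)
    then show ?thesis
      by (simp add: nerve_map_def nerve_def seg_prod_hom[OF assms])
  qed
  ultimately show ?thesis
    unfolding semisimplicial_map_def A.continuous_map_nerve_level by blast
qed

definition pull_cochain :: "'d monoid \<Rightarrow> ('d \<Rightarrow> 'c) \<Rightarrow> ('c, 'g, 'h) cochain \<Rightarrow> ('d, 'g, 'h) cochain" where
  "pull_cochain \<Gamma>' \<psi> = (\<lambda>(\<alpha>, u).
     (restrict (\<lambda>g. \<alpha> (\<psi> g)) (carrier \<Gamma>'),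
      restrict (\<lambda>(g, h). u (\<psi> g, \<psi> h)) (carrier \<Gamma>' \<times> carrier \<Gamma>')))"

text \<open>
  The form of the definition to which \<open>classifying_map_eqI\<close> applies.
\<close>

lemma H1_pull_eq: "H1_pull \<Gamma>' \<G> \<psi> x = (\<Union>c\<in>pull_cochain \<Gamma>' \<psi> ` x. coh_class \<Gamma>' \<G> c)"
  by (auto simp: H1_pull_def pull_cochain_def split: prod.splits)

lemma pull_cochain_Z1:
  assumes \<psi>: "\<psi> \<in> hom \<Gamma>' \<Gamma>" and "group \<Gamma>'" and c: "c \<in> Z1 \<Gamma> \<G>"
  shows "pull_cochain \<Gamma>' \<psi> c \<in> Z1 \<Gamma>' \<G>"
proof -
  interpret A: group \<Gamma>' by fact
  obtain \<alpha> u where \<alpha>u: "c = (\<alpha>, u)" by force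
  have "\<psi> g \<in> carrier \<Gamma>" if "g \<in> carrier \<Gamma>'" for g
    using \<psi> that by (auto simp: hom_def)
  moreover have "\<psi> (g \<otimes>\<^bsub>\<Gamma>'\<^esub> h) = \<psi> g \<otimes>\<^bsub>\<Gamma>\<^esub> \<psi> h" if "g \<in> carrier \<Gamma>'" "h \<in> carrier \<Gamma>'" for g h
    using \<psi> that by (auto simp: hom_def)
  ultimately show ?thesis
    using c unfolding Z1_def Let_def \<alpha>u pull_cochain_def by auto
qed

lemma cocycle_map_pull_cochain:
  assumes \<psi>: "\<psi> \<in> hom \<Gamma>' \<Gamma>" and "group \<Gamma>'" "group \<Gamma>"
    and gs: "gs \<in> topspace (level (nerve \<Gamma>') n)"
  shows "cocycle_map \<Gamma>' (pull_cochain \<Gamma>' \<psi> c) n gs = cocycle_map \<Gamma> c n (nerve_map \<psi> n gs)"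
proof -
  interpret A: nerve_group \<Gamma>' using assms by (simp add: nerve_group_def)
  have sub: "set gs \<subseteq> carrier \<Gamma>'"
    using gs by (simp add: A.topspace_nerve)
  show ?thesis
    using A.seg_prod_closed[OF sub]
    by (auto simp: cocycle_map_def nerve_map_def pull_cochain_def seg_prod_hom[OF assms(1-3) sub]
        intro!: restrict_ext split: prod.splits)
qed

text \<open>
  On cocycles, pulling back along \<open>\<psi>\<close> is precomposition with the map of nerves, already before
  realisation. Passing to classes only uses that homotopies can be precomposed.
\<close>

lemma classifying_map_H1_pull:
  assumes cm: "topological_crossed_module \<G>" and grp: "group \<Gamma>" "group \<Gamma>'"
    and \<psi>: "\<psi> \<in> hom \<Gamma>' \<Gamma>" and x: "x \<in> H1 \<Gamma> \<G>"
  shows "classifying_map \<Gamma>' \<G> (H1_pull \<Gamma>' \<G> \<psi> x) =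
    htpy_precompose (B \<Gamma>') (BD \<G>) (fat_map (nerve \<Gamma>) (nerve_map \<psi>)) (classifying_map \<Gamma> \<G> x)"
proof -
  interpret A: crossed_cohomology \<G> \<Gamma>'
    using cm grp by (simp add: crossed_cohomology_def topological_crossed_def nerve_group_def)
  interpret B: crossed_cohomology \<G> \<Gamma>
    using cm grp by (simp add: crossed_cohomology_def topological_crossed_def nerve_group_def)
  let ?p = "fat_map (nerve \<Gamma>) (nerve_map \<psi>)"
  have p: "continuous_map (B \<Gamma>') (B \<Gamma>) ?p"
    by (rule continuous_map_fat_map[OF semisimplicial_map_nerve_map[OF \<psi> grp(2,1)]])
  obtain c0 where c0: "c0 \<in> Z1 \<Gamma> \<G>" "x = coh_class \<Gamma> \<G> c0"
    using B.H1_cases[OF x] .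
  let ?f = "B.cocycle_realisation c0"
  have pulled: "homotopic_with (\<lambda>_. True) (B \<Gamma>') (BD \<G>)
      (A.cocycle_realisation (pull_cochain \<Gamma>' \<psi> c)) (B.cocycle_realisation c \<circ> ?p)" if c: "c \<in> Z1 \<Gamma> \<G>" for c
  proof (rule homotopic_with_equal)
    show "continuous_map (B \<Gamma>') (BD \<G>) (A.cocycle_realisation (pull_cochain \<Gamma>' \<psi> c))"
      by (rule A.continuous_map_cocycle_realisation[OF pull_cochain_Z1[OF \<psi> grp(2) c]])
    fix q assume q_top: "q \<in> topspace (B \<Gamma>')"
    obtain n gs t where q: "q = fat_rel (nerve \<Gamma>') `` {(n, gs, t)}"
      and gs: "gs \<in> topspace (level (nerve \<Gamma>') n)"
      using topspace_fat_realisation_cases[OF q_top] by blast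
    show "A.cocycle_realisation (pull_cochain \<Gamma>' \<psi> c) q = (B.cocycle_realisation c \<circ> ?p) q"
      unfolding q o_def fat_map_class[OF A.semisimplicial_map_cocycle_map[OF pull_cochain_Z1[OF \<psi> grp(2) c]]]
        fat_map_class[OF semisimplicial_map_nerve_map[OF \<psi> grp(2,1)]] fat_map_class[OF B.semisimplicial_map_cocycle_map[OF c]]
        cocycle_map_pull_cochain[OF \<psi> grp(2,1) gs] ..
  qed auto
  have "classifying_map \<Gamma>' \<G> (H1_pull \<Gamma>' \<G> \<psi> x) = htpy_class (B \<Gamma>') (BD \<G>) (?f \<circ> ?p)"
    unfolding H1_pull_eq
  proof (rule A.classifying_map_eqI)
    have "c0 \<in> x"
      using B.cohomologous_refl c0 by (simp add: coh_class_def)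
    then show "\<exists>c\<in>pull_cochain \<Gamma>' \<psi> ` x. c \<in> Z1 \<Gamma>' \<G>"
      using pull_cochain_Z1[OF \<psi> grp(2) c0(1)] by blast
    fix c' assume "c' \<in> pull_cochain \<Gamma>' \<psi> ` x"
    then obtain c where c: "c' = pull_cochain \<Gamma>' \<psi> c" "(c0, c) \<in> cohomologous \<Gamma> \<G>"
      using c0(2) by (auto simp: coh_class_def)
    have "c \<in> Z1 \<Gamma> \<G>"
      using c c0(2) B.coh_class_subset[of c c0] by (simp add: coh_class_def)
    then have "homotopic_with (\<lambda>_. True) (B \<Gamma>') (BD \<G>) (A.cocycle_realisation c') (B.cocycle_realisation c \<circ> ?p)"
      unfolding c(1) by (rule pulled)
    moreover have "homotopic_with (\<lambda>_. True) (B \<Gamma>') (BD \<G>) (B.cocycle_realisation c \<circ> ?p) (?f \<circ> ?p)"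
      using B.cohomologous_imp_homotopic[OF c(2)] p
      by (intro homotopic_with_compose_continuous_map_right[where p = "\<lambda>_. True"]) (auto simp: homotopic_with_sym)
    ultimately show "homotopic_with (\<lambda>_. True) (B \<Gamma>') (BD \<G>) (A.cocycle_realisation c') (?f \<circ> ?p)"
      by (rule homotopic_with_trans)
  qed
  also have "\<dots> = htpy_precompose (B \<Gamma>') (BD \<G>) ?p (htpy_class (B \<Gamma>) (BD \<G>) ?f)"
    unfolding htpy_precompose_def
  proof (rule UN_constant_eq[symmetric, OF _ ballI])
    show "?f \<in> htpy_class (B \<Gamma>) (BD \<G>) ?f"
      by (rule htpy_class_self[OF B.continuous_map_cocycle_realisation[OF c0(1)]])
    fix f assume "f \<in> htpy_class (B \<Gamma>) (BD \<G>) ?f"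
    then have "homotopic_with (\<lambda>_. True) (B \<Gamma>) (BD \<G>) f ?f"
      by (simp add: htpy_class_def homotopy_rel_def homotopic_with_sym)
    then have "homotopic_with (\<lambda>_. True) (B \<Gamma>') (BD \<G>) (f \<circ> ?p) (?f \<circ> ?p)"
      using p by (intro homotopic_with_compose_continuous_map_right[where p = "\<lambda>_. True"]) auto
    then show "htpy_class (B \<Gamma>') (BD \<G>) (f \<circ> ?p) = htpy_class (B \<Gamma>') (BD \<G>) (?f \<circ> ?p)"
      by (rule htpy_class_eq)
  qed
  also have "htpy_class (B \<Gamma>) (BD \<G>) ?f = classifying_map \<Gamma> \<G> x"
    using B.classifying_map_coh_class[OF c0(1)] c0(2) by simp
  finally show ?thesis .
qed

section \<open>Naturality in the crossed module\<close>

lemma crossed_module_morphism_D: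
  assumes "crossed_module_morphism \<G> \<G>' \<phi>\<^sub>1 \<phi>\<^sub>2"
  shows "v \<in> carrier (Hgrp \<G>) \<Longrightarrow> \<phi>\<^sub>1 v \<in> carrier (Hgrp \<G>')"
    and "b \<in> carrier (Ggrp \<G>) \<Longrightarrow> \<phi>\<^sub>2 b \<in> carrier (Ggrp \<G>')"
    and "v \<in> carrier (Hgrp \<G>) \<Longrightarrow> v' \<in> carrier (Hgrp \<G>) \<Longrightarrow>
      \<phi>\<^sub>1 v \<otimes>\<^bsub>Hgrp \<G>'\<^esub> \<phi>\<^sub>1 v' = \<phi>\<^sub>1 (v \<otimes>\<^bsub>Hgrp \<G>\<^esub> v')"
    and "b \<in> carrier (Ggrp \<G>) \<Longrightarrow> b' \<in> carrier (Ggrp \<G>) \<Longrightarrow>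
      \<phi>\<^sub>2 b \<otimes>\<^bsub>Ggrp \<G>'\<^esub> \<phi>\<^sub>2 b' = \<phi>\<^sub>2 (b \<otimes>\<^bsub>Ggrp \<G>\<^esub> b')"
    and "v \<in> carrier (Hgrp \<G>) \<Longrightarrow> bd \<G>' (\<phi>\<^sub>1 v) = \<phi>\<^sub>2 (bd \<G> v)"
    and "b \<in> carrier (Ggrp \<G>) \<Longrightarrow> v \<in> carrier (Hgrp \<G>) \<Longrightarrow>
      act \<G>' (\<phi>\<^sub>2 b) (\<phi>\<^sub>1 v) = \<phi>\<^sub>1 (act \<G> b v)"
  using assms by (auto simp: crossed_module_morphism_def hom_def)

lemma duskin_map_in_simplices:
  assumes phi: "crossed_module_morphism \<G> \<G>' \<phi>\<^sub>1 \<phi>\<^sub>2"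
    and cm: "topological_crossed_module \<G>" and x: "x \<in> duskin_simplices \<G> n"
  shows "duskin_map \<phi>\<^sub>1 \<phi>\<^sub>2 n x \<in> duskin_simplices \<G>' n"
proof -
  interpret topological_crossed \<G> by unfold_locales (rule cm)
  obtain \<alpha> u where \<alpha>u: "x = (\<alpha>, u)" by force
  have \<alpha>: "\<alpha> (i, j) \<in> carrier G" if "i < j" "j \<le> n" for i j
    using x that by (auto simp: duskin_simplices_def Let_def \<alpha>u pairs_def PiE_iff)
  have u: "u (i, j, k) \<in> carrier H" if "i < j" "j < k" "k \<le> n" for i j k
    using x that by (auto simp: duskin_simplices_def Let_def \<alpha>u triples_def PiE_iff)
  have edge: "\<alpha> (i, j) \<otimes>\<^bsub>G\<^esub> \<alpha> (j, k) = d (u (i, j, k)) \<otimes>\<^bsub>G\<^esub> \<alpha> (i, k)" if "i < j" "j < k" "k \<le> n" for i j k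
    using x that by (auto simp: duskin_simplices_def Let_def \<alpha>u)
  have tri: "a (\<alpha> (i, j)) (u (j, k, l)) \<otimes>\<^bsub>H\<^esub> u (i, j, l) = u (i, j, k) \<otimes>\<^bsub>H\<^esub> u (i, k, l)"
    if "i < j" "j < k" "k < l" "l \<le> n" for i j k l
    using x that by (auto simp: duskin_simplices_def Let_def \<alpha>u)
  note \<phi> = crossed_module_morphism_D[OF phi]
  have "\<phi>\<^sub>2 (\<alpha> (i, j)) \<otimes>\<^bsub>Ggrp \<G>'\<^esub> \<phi>\<^sub>2 (\<alpha> (j, k)) = bd \<G>' (\<phi>\<^sub>1 (u (i, j, k))) \<otimes>\<^bsub>Ggrp \<G>'\<^esub> \<phi>\<^sub>2 (\<alpha> (i, k))"
    if "i < j" "j < k" "k \<le> n" for i j k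
    using edge[OF that] \<alpha>[of i j] \<alpha>[of j k] \<alpha>[of i k] u[OF that] that
    by (simp add: \<phi>)
  moreover have "act \<G>' (\<phi>\<^sub>2 (\<alpha> (i, j))) (\<phi>\<^sub>1 (u (j, k, l))) \<otimes>\<^bsub>Hgrp \<G>'\<^esub> \<phi>\<^sub>1 (u (i, j, l)) =
      \<phi>\<^sub>1 (u (i, j, k)) \<otimes>\<^bsub>Hgrp \<G>'\<^esub> \<phi>\<^sub>1 (u (i, k, l))"
    if "i < j" "j < k" "k < l" "l \<le> n" for i j k l
    using tri[OF that] \<alpha>[of i j] u[of j k l] u[of i j l] u[of i j k] u[of i k l] that
    by (simp add: \<phi>)
  ultimately show ?thesis
    using \<alpha> u \<phi>(1,2)
    unfolding duskin_simplices_def Let_def \<alpha>u duskin_map_def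
    by (auto simp: pairs_def triples_def)
qed

text \<open>
  Compatibility with faces is immediate; the content is continuity for the compactly generated topology
  of the levels, where the weak Hausdorffness of both groups of \<open>\<G>'\<close> is needed.
\<close>

lemma semisimplicial_map_duskin_map:
  assumes phi: "crossed_module_morphism \<G> \<G>' \<phi>\<^sub>1 \<phi>\<^sub>2"
    and cm: "topological_crossed_module \<G>" and cm': "topological_crossed_module \<G>'"
  shows "semisimplicial_map (duskin_nerve \<G>) (duskin_nerve \<G>') (duskin_map \<phi>\<^sub>1 \<phi>\<^sub>2)"
  unfolding semisimplicial_map_def
proof (intro conjI allI impI ballI)
  interpret A: topological_crossed \<G> by unfold_locales (rule cm)
  interpret B: topological_crossed \<G>' by unfold_locales (rule cm')
  fix n
  have "continuous_map (Gtop \<G>) (Gtop \<G>') \<phi>\<^sub>2" "continuous_map (Htop \<G>) (Htop \<G>') \<phi>\<^sub>1"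
    using phi by (auto simp: crossed_module_morphism_def)
  then have "continuous_map
      (cg_prod (product_topology (\<lambda>_. Gtop \<G>) (pairs n)) (product_topology (\<lambda>_. Htop \<G>) (triples n)))
      (cg_prod (product_topology (\<lambda>_. Gtop \<G>') (pairs n)) (product_topology (\<lambda>_. Htop \<G>') (triples n)))
      (duskin_map \<phi>\<^sub>1 \<phi>\<^sub>2 n)"
    unfolding duskin_map_def
    by (rule continuous_map_cg_prod_of_powers[OF B.weakly_Hausdorff_Gtop B.weakly_Hausdorff_Htop])
  then show "continuous_map (level (duskin_nerve \<G>) n) (level (duskin_nerve \<G>') n) (duskin_map \<phi>\<^sub>1 \<phi>\<^sub>2 n)"
    using duskin_map_in_simplices[OF phi cm]
    by (auto simp: duskin_nerve_def continuous_map_in_subtopology continuous_map_from_subtopology)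
next
  fix n i x assume "i \<le> Suc n" "x \<in> topspace (level (duskin_nerve \<G>) (Suc n))"
  then show "duskin_map \<phi>\<^sub>1 \<phi>\<^sub>2 n (pull (duskin_nerve \<G>) n (Suc n) (coface i) x) =
      pull (duskin_nerve \<G>') n (Suc n) (coface i) (duskin_map \<phi>\<^sub>1 \<phi>\<^sub>2 (Suc n) x)"
    by (auto simp: duskin_nerve_def duskin_map_def pairs_def triples_def coface_def
        intro!: restrict_ext split: prod.splits)
qed

definition push_cochain ::
  "'c monoid \<Rightarrow> ('h \<Rightarrow> 'h2) \<Rightarrow> ('g \<Rightarrow> 'g2) \<Rightarrow> ('c, 'g, 'h) cochain \<Rightarrow> ('c, 'g2, 'h2) cochain" where
  "push_cochain \<Gamma> \<phi>\<^sub>1 \<phi>\<^sub>2 = (\<lambda>(\<alpha>, u).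
     (restrict (\<lambda>g. \<phi>\<^sub>2 (\<alpha> g)) (carrier \<Gamma>),
      restrict (\<lambda>p. \<phi>\<^sub>1 (u p)) (carrier \<Gamma> \<times> carrier \<Gamma>)))"

lemma H1_push_eq: "H1_push \<Gamma> \<G>' \<phi>\<^sub>1 \<phi>\<^sub>2 x = (\<Union>c\<in>push_cochain \<Gamma> \<phi>\<^sub>1 \<phi>\<^sub>2 ` x. coh_class \<Gamma> \<G>' c)"
  by (auto simp: H1_push_def push_cochain_def split: prod.splits)

lemma push_cochain_Z1:
  assumes phi: "crossed_module_morphism \<G> \<G>' \<phi>\<^sub>1 \<phi>\<^sub>2"
    and cm: "topological_crossed_module \<G>" and "group \<Gamma>" and c: "c \<in> Z1 \<Gamma> \<G>"
  shows "push_cochain \<Gamma> \<phi>\<^sub>1 \<phi>\<^sub>2 c \<in> Z1 \<Gamma> \<G>'"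
proof -
  interpret crossed_cohomology \<G> \<Gamma>
    using cm \<open>group \<Gamma>\<close> by (simp add: crossed_cohomology_def topological_crossed_def nerve_group_def)
  obtain \<alpha> u where \<alpha>u: "c = (\<alpha>, u)" by force
  have Z: "(\<alpha>, u) \<in> Z1 \<Gamma> \<G>" using c \<alpha>u by simp
  note [simp] = Z1_D(1,2)[OF Z]
  note \<phi> = crossed_module_morphism_D[OF phi]
  have "\<phi>\<^sub>2 (\<alpha> g) \<otimes>\<^bsub>Ggrp \<G>'\<^esub> \<phi>\<^sub>2 (\<alpha> h) = bd \<G>' (\<phi>\<^sub>1 (u (g, h))) \<otimes>\<^bsub>Ggrp \<G>'\<^esub> \<phi>\<^sub>2 (\<alpha> (g \<otimes>\<^bsub>\<Gamma>\<^esub> h))"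
    if "g \<in> carrier \<Gamma>" "h \<in> carrier \<Gamma>" for g h
    using Z1_D(3)[OF Z that] that
    by (simp add: \<phi>)
  moreover have "act \<G>' (\<phi>\<^sub>2 (\<alpha> g)) (\<phi>\<^sub>1 (u (h, k))) \<otimes>\<^bsub>Hgrp \<G>'\<^esub> \<phi>\<^sub>1 (u (g, h \<otimes>\<^bsub>\<Gamma>\<^esub> k)) =
      \<phi>\<^sub>1 (u (g, h)) \<otimes>\<^bsub>Hgrp \<G>'\<^esub> \<phi>\<^sub>1 (u (g \<otimes>\<^bsub>\<Gamma>\<^esub> h, k))"
    if "g \<in> carrier \<Gamma>" "h \<in> carrier \<Gamma>" "k \<in> carrier \<Gamma>" for g h k
    using Z1_D(4)[OF Z that] that
    by (simp add: \<phi>)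
  ultimately show ?thesis
    using \<phi>(1,2)
    unfolding Z1_def Let_def \<alpha>u push_cochain_def by auto
qed

lemma cocycle_map_push_cochain:
  assumes "group \<Gamma>" and gs: "gs \<in> topspace (level (nerve \<Gamma>) n)"
  shows "cocycle_map \<Gamma> (push_cochain \<Gamma> \<phi>\<^sub>1 \<phi>\<^sub>2 c) n gs = duskin_map \<phi>\<^sub>1 \<phi>\<^sub>2 n (cocycle_map \<Gamma> c n gs)"
proof -
  interpret nerve_group \<Gamma> using assms by (simp add: nerve_group_def)
  have "set gs \<subseteq> carrier \<Gamma>"
    using gs by (simp add: topspace_nerve)
  then show ?thesis
    using seg_prod_closed[of gs]
    by (auto simp: cocycle_map_def duskin_map_def push_cochain_def intro!: restrict_ext split: prod.splits)
qed

text \<open>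
  Continuity of the induced map between the realisations is essential: the homotopy class on the right is
  formed from arbitrary maps homotopic to the realisation of a cocycle.
\<close>

lemma classifying_map_H1_push:
  assumes cm: "topological_crossed_module \<G>" "topological_crossed_module \<G>'" and grp: "group \<Gamma>"
    and phi: "crossed_module_morphism \<G> \<G>' \<phi>\<^sub>1 \<phi>\<^sub>2" and x: "x \<in> H1 \<Gamma> \<G>"
  shows "classifying_map \<Gamma> \<G>' (H1_push \<Gamma> \<G>' \<phi>\<^sub>1 \<phi>\<^sub>2 x) =
    htpy_postcompose (B \<Gamma>) (BD \<G>') (fat_map (duskin_nerve \<G>') (duskin_map \<phi>\<^sub>1 \<phi>\<^sub>2)) (classifying_map \<Gamma> \<G> x)"
proof -
  interpret A: crossed_cohomology \<G> \<Gamma>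
    using cm grp by (simp add: crossed_cohomology_def topological_crossed_def nerve_group_def)
  interpret B: crossed_cohomology \<G>' \<Gamma>
    using cm grp by (simp add: crossed_cohomology_def topological_crossed_def nerve_group_def)
  let ?q = "fat_map (duskin_nerve \<G>') (duskin_map \<phi>\<^sub>1 \<phi>\<^sub>2)"
  have q: "continuous_map (BD \<G>) (BD \<G>') ?q"
    by (rule continuous_map_fat_map[OF semisimplicial_map_duskin_map[OF phi cm]])
  obtain c0 where c0: "c0 \<in> Z1 \<Gamma> \<G>" "x = coh_class \<Gamma> \<G> c0"
    using A.H1_cases[OF x] .
  let ?f = "A.cocycle_realisation c0"
  have pushed: "homotopic_with (\<lambda>_. True) (B \<Gamma>) (BD \<G>')
      (B.cocycle_realisation (push_cochain \<Gamma> \<phi>\<^sub>1 \<phi>\<^sub>2 c)) (?q \<circ> A.cocycle_realisation c)" if c: "c \<in> Z1 \<Gamma> \<G>" for c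
  proof (rule homotopic_with_equal)
    have Z: "push_cochain \<Gamma> \<phi>\<^sub>1 \<phi>\<^sub>2 c \<in> Z1 \<Gamma> \<G>'"
      by (rule push_cochain_Z1[OF phi cm(1) grp c])
    then show "continuous_map (B \<Gamma>) (BD \<G>') (B.cocycle_realisation (push_cochain \<Gamma> \<phi>\<^sub>1 \<phi>\<^sub>2 c))"
      by (rule B.continuous_map_cocycle_realisation)
    fix p assume p_top: "p \<in> topspace (B \<Gamma>)"
    obtain n gs t where p: "p = fat_rel (nerve \<Gamma>) `` {(n, gs, t)}"
      and gs: "gs \<in> topspace (level (nerve \<Gamma>) n)"
      using topspace_fat_realisation_cases[OF p_top] by blast
    show "B.cocycle_realisation (push_cochain \<Gamma> \<phi>\<^sub>1 \<phi>\<^sub>2 c) p = (?q \<circ> A.cocycle_realisation c) p"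
      unfolding p o_def fat_map_class[OF B.semisimplicial_map_cocycle_map[OF Z]]
        fat_map_class[OF A.semisimplicial_map_cocycle_map[OF c]] fat_map_class[OF semisimplicial_map_duskin_map[OF phi cm]]
        cocycle_map_push_cochain[OF grp gs] ..
  qed auto
  have "classifying_map \<Gamma> \<G>' (H1_push \<Gamma> \<G>' \<phi>\<^sub>1 \<phi>\<^sub>2 x) = htpy_class (B \<Gamma>) (BD \<G>') (?q \<circ> ?f)"
    unfolding H1_push_eq
  proof (rule B.classifying_map_eqI)
    have "c0 \<in> x"
      using A.cohomologous_refl c0 by (simp add: coh_class_def)
    then show "\<exists>c\<in>push_cochain \<Gamma> \<phi>\<^sub>1 \<phi>\<^sub>2 ` x. c \<in> Z1 \<Gamma> \<G>'"
      using push_cochain_Z1[OF phi cm(1) grp c0(1)] by blast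
    fix c' assume "c' \<in> push_cochain \<Gamma> \<phi>\<^sub>1 \<phi>\<^sub>2 ` x"
    then obtain c where c: "c' = push_cochain \<Gamma> \<phi>\<^sub>1 \<phi>\<^sub>2 c" "(c0, c) \<in> cohomologous \<Gamma> \<G>"
      using c0(2) by (auto simp: coh_class_def)
    have "c \<in> Z1 \<Gamma> \<G>"
      using c c0(2) A.coh_class_subset[of c c0] by (simp add: coh_class_def)
    then have "homotopic_with (\<lambda>_. True) (B \<Gamma>) (BD \<G>') (B.cocycle_realisation c') (?q \<circ> A.cocycle_realisation c)"
      unfolding c(1) by (rule pushed)
    moreover have "homotopic_with (\<lambda>_. True) (B \<Gamma>) (BD \<G>') (?q \<circ> A.cocycle_realisation c) (?q \<circ> ?f)"
      using A.cohomologous_imp_homotopic[OF c(2)] q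
      by (intro homotopic_with_compose_continuous_map_left[where p = "\<lambda>_. True"]) (auto simp: homotopic_with_sym)
    ultimately show "homotopic_with (\<lambda>_. True) (B \<Gamma>) (BD \<G>') (B.cocycle_realisation c') (?q \<circ> ?f)"
      by (rule homotopic_with_trans)
  qed
  also have "\<dots> = htpy_postcompose (B \<Gamma>) (BD \<G>') ?q (htpy_class (B \<Gamma>) (BD \<G>) ?f)"
    unfolding htpy_postcompose_def
  proof (rule UN_constant_eq[symmetric, OF _ ballI])
    show "?f \<in> htpy_class (B \<Gamma>) (BD \<G>) ?f"
      by (rule htpy_class_self[OF A.continuous_map_cocycle_realisation[OF c0(1)]])
    fix f assume "f \<in> htpy_class (B \<Gamma>) (BD \<G>) ?f"
    then have "homotopic_with (\<lambda>_. True) (B \<Gamma>) (BD \<G>) f ?f"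
      by (simp add: htpy_class_def homotopy_rel_def homotopic_with_sym)
    then have "homotopic_with (\<lambda>_. True) (B \<Gamma>) (BD \<G>') (?q \<circ> f) (?q \<circ> ?f)"
      using q by (intro homotopic_with_compose_continuous_map_left[where p = "\<lambda>_. True"]) auto
    then show "htpy_class (B \<Gamma>) (BD \<G>') (?q \<circ> f) = htpy_class (B \<Gamma>) (BD \<G>') (?q \<circ> ?f)"
      by (rule htpy_class_eq)
  qed
  also have "htpy_class (B \<Gamma>) (BD \<G>) ?f = classifying_map \<Gamma> \<G> x"
    using A.classifying_map_coh_class[OF c0(1)] c0(2) by simp
  finally show ?thesis .
qed

section \<open>The comparison map\<close>

theorem lemma4p4:
  fixes \<G> :: "('g, 'h) crossed_module" and \<G>' :: "('g2, 'h2) crossed_module"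
    and \<Gamma> :: "'c monoid" and \<Gamma>' :: "'d monoid"
  assumes "topological_crossed_module \<G>" and "topological_crossed_module \<G>'"
    and "group \<Gamma>" and "group \<Gamma>'"
  shows
    "(\<forall>c \<in> normalised_Z1 \<Gamma> \<G>.
        simplicial_map (nerve \<Gamma>) (duskin_nerve \<G>) (cocycle_map \<Gamma> c) \<and>
        classifying_map \<Gamma> \<G> (coh_class \<Gamma> \<G> c) =
          htpy_class (B \<Gamma>) (BD \<G>) (fat_map (duskin_nerve \<G>) (cocycle_map \<Gamma> c))) \<and>
     classifying_map \<Gamma> \<G> \<in> H1 \<Gamma> \<G> \<rightarrow> htpy_classes (B \<Gamma>) (BD \<G>) \<and>
     classifying_map \<Gamma> \<G> (coh_class \<Gamma> \<G> (trivial_cocycle \<Gamma> \<G>)) =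
       htpy_class (B \<Gamma>) (BD \<G>) (\<lambda>_. BD_vertex \<G>) \<and>
     (\<forall>\<psi> \<in> hom \<Gamma>' \<Gamma>. \<forall>x \<in> H1 \<Gamma> \<G>.
        classifying_map \<Gamma>' \<G> (H1_pull \<Gamma>' \<G> \<psi> x) =
          htpy_precompose (B \<Gamma>') (BD \<G>) (fat_map (nerve \<Gamma>) (nerve_map \<psi>))
            (classifying_map \<Gamma> \<G> x)) \<and>
     (\<forall>\<phi>\<^sub>1 \<phi>\<^sub>2. crossed_module_morphism \<G> \<G>' \<phi>\<^sub>1 \<phi>\<^sub>2 \<longrightarrow>
        (\<forall>x \<in> H1 \<Gamma> \<G>.
          classifying_map \<Gamma> \<G>' (H1_push \<Gamma> \<G>' \<phi>\<^sub>1 \<phi>\<^sub>2 x) =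
            htpy_postcompose (B \<Gamma>) (BD \<G>') (fat_map (duskin_nerve \<G>') (duskin_map \<phi>\<^sub>1 \<phi>\<^sub>2))
              (classifying_map \<Gamma> \<G> x)))"
proof -
  interpret crossed_cohomology \<G> \<Gamma>
    using assms by (simp add: crossed_cohomology_def topological_crossed_def nerve_group_def)
  have Z: "c \<in> Z1 \<Gamma> \<G>" if "c \<in> normalised_Z1 \<Gamma> \<G>" for c
    using that by (auto simp: normalised_Z1_def)
  have "classifying_map \<Gamma> \<G> x \<in> htpy_classes (B \<Gamma>) (BD \<G>)" if x: "x \<in> H1 \<Gamma> \<G>" for x
  proof -
    obtain c where c: "c \<in> Z1 \<Gamma> \<G>" "x = coh_class \<Gamma> \<G> c"
      using H1_cases[OF x] .
    show ?thesis
      unfolding c(2) classifying_map_coh_class[OF c(1)] htpy_classes_def htpy_class_def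
      using continuous_map_cocycle_realisation[OF c(1)] by (intro quotientI) simp
  qed
  moreover have "classifying_map \<Gamma> \<G> (coh_class \<Gamma> \<G> (trivial_cocycle \<Gamma> \<G>)) =
      htpy_class (B \<Gamma>) (BD \<G>) (\<lambda>_. BD_vertex \<G>)"
    unfolding classifying_map_coh_class[OF Z[OF trivial_cocycle_normalised]]
    by (rule htpy_class_eq[OF homotopic_trivial_constant])
  ultimately show ?thesis
    using simplicial_map_cocycle_map classifying_map_coh_class Z
      classifying_map_H1_pull[OF assms(1,3,4)] classifying_map_H1_push[OF assms(1,2,3)]
    by auto
qed

end
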